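(* Let $(\mathbb{M},\Delta,\xi)$ be an abstract distribution monad, $\mathbb{M}=(M,\delta,\kappa)$, and let $E\in\mathscr{L}$ be an $\mathbb{M}$-distributionally complete linear space. Then the underlying space of $E$ carries the structure of an $\mathbb{M}$-algebra. In particular, there is a unique linear map $b_E:ME\to E$ whose underlying map serves as $\mathbb{M}$-algebra structure. Moreover: (1) $b_E$ is the counit $b_E:ME\to E$ of the representation $\mathscr{L}(M-,E)\cong\underline{\mathscr{X}}(-,E)$ given by the isomorphisms $\mathscr{L}(MX,E)\xrightarrow{G}\underline{\mathscr{X}}(MX,E)\xrightarrow{\underline{\mathscr{X}}(\delta_X,E)}\underline{\mathscr{X}}(X,E)$ $(X\in\mathscr{X})$, i.e. the linear map corresponding to the identity map of $E$; (2) $b_E$ is the unique linear map whose underlying map is a retraction of $\delta_E:E\to ME$.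
   Context: Standing data. $\mathscr{X}=(\mathscr{X},\boxtimes,I)$ is a closed symmetric monoidal category that is finitely well-complete (it has finite limits and intersections, i.e. fibre products, of arbitrary class-indexed families of strong monomorphisms with common codomain); $\underline{\mathscr{X}}$ is $\mathscr{X}$ enriched in itself. $\mathbb{L}=(L,\eta,\mu^{\mathbb{L}})$ is an $\mathscr{X}$-monad on $\underline{\mathscr{X}}$ that is commutative: with $t'_{XY}:LX\boxtimes Y\to L(X\boxtimes Y)$, $t''_{XY}:X\boxtimes LY\to L(X\boxtimes Y)$ the strengths (transposes of $Y\to\underline{\mathscr{X}}(X,X\boxtimes Y)\xrightarrow{L}\underline{\mathscr{X}}(LX,L(X\boxtimes Y))$ and $X\to\underline{\mathscr{X}}(Y,X\boxtimes Y)\xrightarrow{L}\underline{\mathscr{X}}(LY,L(X\boxtimes Y))$), the morphisms $\otimes_{XY}=\mu^{\mathbb{L}}\cdot Lt'_{XY}\cdot t''_{LX,Y}$ and $\mu^{\mathbb{L}}\cdot Lt''_{XY}\cdot t'_{X,LY}$ from $LX\boxtimes LY$ to $L(X\boxtimes Y)$ coincide. It has tensor products of algebras: for all algebras $(X,a),(Y,b)$ the pair $\mu^{\mathbb{L}}\cdot L\otimes_{XY},\ L(a\boxtimes b):(L(LX\boxtimes LY),\mu^{\mathbb{L}})\rightrightarrows(L(X\boxtimes Y),\mu^{\mathbb{L}})$ has a coequalizer in $\mathscr{X}^{\mathbb{L}}$. $\mathscr{L}:=\mathscr{X}^{\mathbb{L}}$, with Eilenberg–Moore $\mathscr{X}$-adjunction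 $F\dashv G:\mathscr{L}\to\underline{\mathscr{X}}$ (unit $\eta$, counit $\varepsilon$). $\mathscr{L}$ is closed symmetric monoidal (tensor product: for algebras $A=(X,a)$, $B=(Y,b)$, $A\otimes B$ is the coequalizer in $\mathscr{X}^{\mathbb{L}}$ of the pair $\mu^{\mathbb{L}}\cdot L\otimes_{XY},\ L(a\boxtimes b):(L(LX\boxtimes LY),\mu^{\mathbb{L}})\rightrightarrows(L(X\boxtimes Y),\mu^{\mathbb{L}})$; unit object $R:=FI$; internal hom $\underline{\mathscr{L}}(A,B)$ with $G\underline{\mathscr{L}}(A,B)=\mathscr{L}(A,B)$, the hom-object of the Eilenberg–Moore $\mathscr{X}$-category). Objects (morphisms) of $\mathscr{X}$ are called spaces (maps); objects (morphisms) of $\mathscr{L}$ are called linear spaces (linear maps). Duality. $E^*:=\underline{\mathscr{L}}(E,R)$; $\mathbb{H}=(H,\mathfrak{d},\mathfrak{k})$ is the double-dualization monad on $\mathscr{L}$ induced by $\underline{\mathscr{L}}(-,R)\dashv\underline{\mathscr{L}}(-,R):\underline{\mathscr{L}}^{\mathrm{op}}\to\underline{\mathscr{L}}$, so $HE=E^{**}$; applying $G$ to hom-objects, it is an $\mathscr{X}$-monad on $\mathscr{L}$. Monad morphisms. For an $\mathscr{X}$-monad $(T,\eta,\mu)$ on $\mathscr{A}$ and an $\mathscr{X}$-monad $(S,\phi,\nu)$ on $\mathscr{B}$, a morphism $(\lambda,Q):\mathbb{T}\to\mathbb{S}$ consists of an $\mathscr{X}$-functor $Q:\mathscr{B}\to\mathscr{A}$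 and an $\mathscr{X}$-natural $\lambda:TQ\to QS$ with $\lambda\cdot\eta Q=Q\phi$ and $\lambda\cdot\mu Q=Q\nu\cdot\lambda S\cdot T\lambda$. Abstract distribution monads. The canonical morphism $(\zeta,G):\mathbb{L}\to\mathbb{H}$ is given by $\zeta_E=G\mathfrak{d}_E\cdot G\varepsilon_E:LGE\to GHE$. An abstract distribution monad $(\mathbb{M},\Delta,\xi)$ is an $\mathscr{X}$-monad $\mathbb{M}=(M,\delta,\kappa)$ on $\underline{\mathscr{X}}$ with $\mathscr{X}$-natural $\Delta:L\to M$, $\xi:MG\to GH$ such that $(\Delta,1):\mathbb{L}\to\mathbb{M}$ and $(\xi,G):\mathbb{M}\to\mathbb{H}$ are monad morphisms with $\xi\cdot\Delta G=\zeta$. Each $\mathbb{M}$-algebra $(Z,a)$ has an underlying linear space $(Z,a\cdot\Delta_Z)$; in particular $MX$ is regarded as a linear space via $\kappa_X\cdot\Delta_{MX}$, and then $\Delta_X:FX\to MX$ is a linear map. The forgetful functor $G$ is omitted from the notation, so $ME$ means $MGE$, etc. $E$ is $\mathbb{M}$-distributionally complete if for each space $X$ the morphism $\underline{\mathscr{L}}(\Delta_X,E):\underline{\mathscr{L}}(MX,E)\to\underline{\mathscr{L}}(FX,E)$ is an isomorphism in $\mathscr{L}$; equivalently, if the composite $\mathscr{L}(MX,E)\xrightarrow{G}\underline{\mathscr{X}}(MX,E)\xrightarrow{\underline{\mathscr{X}}(\delta_X,E)}\underline{\mathscr{X}}(X,E)$ is an isomorphism in $\mathscr{X}$ for each space $X$.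 *)

theory Defs
  imports Main
begin

section \<open>Categories\<close>

record ('o, 'm) category =
  Obj :: "'o set"
  Arr :: "'m set"
  Dom :: "'m \<Rightarrow> 'o"
  Cod :: "'m \<Rightarrow> 'o"
  Id :: "'o \<Rightarrow> 'm"
  Comp :: "'m \<Rightarrow> 'm \<Rightarrow> 'm" (infixr "\<cdot>\<index>" 60)

definition Hom :: "('o, 'm, 'z) category_scheme \<Rightarrow> 'o \<Rightarrow> 'o \<Rightarrow> 'm set" where
  "Hom C A B = {f \<in> Arr C. Dom C f = A \<and> Cod C f = B}"

locale category =
  fixes C :: "('o, 'm, 'z) category_scheme" (structure)
  assumes Dom_in_Obj: "f \<in> Arr C \<Longrightarrow> Dom C f \<in> Obj C"
    and Cod_in_Obj: "f \<in> Arr C \<Longrightarrow> Cod C f \<in> Obj C"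
    and Id_in_Hom: "A \<in> Obj C \<Longrightarrow> Id C A \<in> Hom C A A"
    and Comp_in_Hom: "f \<in> Hom C A B \<Longrightarrow> g \<in> Hom C B D \<Longrightarrow> g \<cdot> f \<in> Hom C A D"
    and Comp_Id: "f \<in> Hom C A B \<Longrightarrow> f \<cdot> Id C A = f"
    and Id_Comp: "f \<in> Hom C A B \<Longrightarrow> Id C B \<cdot> f = f"
    and Comp_assoc: "f \<in> Hom C A B \<Longrightarrow> g \<in> Hom C B D \<Longrightarrow> h \<in> Hom C D E \<Longrightarrow>
      (h \<cdot> g) \<cdot> f = h \<cdot> (g \<cdot> f)"

definition is_inverse :: "('o, 'm, 'z) category_scheme \<Rightarrow> 'm \<Rightarrow> 'm \<Rightarrow> bool" where
  "is_inverse C f g \<longleftrightarrow> g \<in> Hom C (Cod C f) (Dom C f) \<and>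
     g \<cdot>\<^bsub>C\<^esub> f = Id C (Dom C f) \<and> f \<cdot>\<^bsub>C\<^esub> g = Id C (Cod C f)"

definition is_iso :: "('o, 'm, 'z) category_scheme \<Rightarrow> 'm \<Rightarrow> bool" where
  "is_iso C f \<longleftrightarrow> f \<in> Arr C \<and> (\<exists>g. is_inverse C f g)"

definition inverse_arr :: "('o, 'm, 'z) category_scheme \<Rightarrow> 'm \<Rightarrow> 'm" where
  "inverse_arr C f = (THE g. is_inverse C f g)"

definition is_mono :: "('o, 'm, 'z) category_scheme \<Rightarrow> 'm \<Rightarrow> bool" where
  "is_mono C m \<longleftrightarrow> m \<in> Arr C \<and>
     (\<forall>A. \<forall>f\<in>Hom C A (Dom C m). \<forall>g\<in>Hom C A (Dom C m). m \<cdot>\<^bsub>C\<^esub> f = m \<cdot>\<^bsub>C\<^esub> g \<longrightarrow> f = g)"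

definition is_epi :: "('o, 'm, 'z) category_scheme \<Rightarrow> 'm \<Rightarrow> bool" where
  "is_epi C e \<longleftrightarrow> e \<in> Arr C \<and>
     (\<forall>B. \<forall>f\<in>Hom C (Cod C e) B. \<forall>g\<in>Hom C (Cod C e) B. f \<cdot>\<^bsub>C\<^esub> e = g \<cdot>\<^bsub>C\<^esub> e \<longrightarrow> f = g)"

definition is_strong_mono :: "('o, 'm, 'z) category_scheme \<Rightarrow> 'm \<Rightarrow> bool" where
  "is_strong_mono C m \<longleftrightarrow> is_mono C m \<and>
     (\<forall>e. is_epi C e \<longrightarrow>
       (\<forall>u\<in>Hom C (Dom C e) (Dom C m). \<forall>v\<in>Hom C (Cod C e) (Cod C m).
          m \<cdot>\<^bsub>C\<^esub> u = v \<cdot>\<^bsub>C\<^esub> e \<longrightarrow>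
          (\<exists>!d. d \<in> Hom C (Cod C e) (Dom C m) \<and> d \<cdot>\<^bsub>C\<^esub> e = u \<and> m \<cdot>\<^bsub>C\<^esub> d = v)))"

definition is_equalizer :: "('o, 'm, 'z) category_scheme \<Rightarrow> 'm \<Rightarrow> 'm \<Rightarrow> 'm \<Rightarrow> bool" where
  "is_equalizer C f g e \<longleftrightarrow> e \<in> Hom C (Dom C e) (Dom C f) \<and> f \<cdot>\<^bsub>C\<^esub> e = g \<cdot>\<^bsub>C\<^esub> e \<and>
     (\<forall>A. \<forall>h\<in>Hom C A (Dom C f). f \<cdot>\<^bsub>C\<^esub> h = g \<cdot>\<^bsub>C\<^esub> h \<longrightarrow>
        (\<exists>!k. k \<in> Hom C A (Dom C e) \<and> e \<cdot>\<^bsub>C\<^esub> k = h))"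

definition is_coequalizer :: "('o, 'm, 'z) category_scheme \<Rightarrow> 'm \<Rightarrow> 'm \<Rightarrow> 'm \<Rightarrow> bool" where
  "is_coequalizer C f g q \<longleftrightarrow> q \<in> Hom C (Cod C f) (Cod C q) \<and> q \<cdot>\<^bsub>C\<^esub> f = q \<cdot>\<^bsub>C\<^esub> g \<and>
     (\<forall>B. \<forall>h\<in>Hom C (Cod C f) B. h \<cdot>\<^bsub>C\<^esub> f = h \<cdot>\<^bsub>C\<^esub> g \<longrightarrow>
        (\<exists>!k. k \<in> Hom C (Cod C q) B \<and> k \<cdot>\<^bsub>C\<^esub> q = h))"

definition is_diagram :: "('i, 'j, 'y) category_scheme \<Rightarrow> ('o, 'm, 'z) category_scheme \<Rightarrow>
    ('i \<Rightarrow> 'o) \<Rightarrow> ('j \<Rightarrow> 'm) \<Rightarrow> bool" where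
  "is_diagram J C D0 D1 \<longleftrightarrow>
     (\<forall>i\<in>Obj J. D0 i \<in> Obj C \<and> D1 (Id J i) = Id C (D0 i)) \<and>
     (\<forall>u\<in>Arr J. D1 u \<in> Hom C (D0 (Dom J u)) (D0 (Cod J u))) \<and>
     (\<forall>u\<in>Arr J. \<forall>v\<in>Arr J. Dom J v = Cod J u \<longrightarrow> D1 (v \<cdot>\<^bsub>J\<^esub> u) = D1 v \<cdot>\<^bsub>C\<^esub> D1 u)"

definition is_cone :: "('i, 'j, 'y) category_scheme \<Rightarrow> ('o, 'm, 'z) category_scheme \<Rightarrow>
    ('i \<Rightarrow> 'o) \<Rightarrow> ('j \<Rightarrow> 'm) \<Rightarrow> 'o \<Rightarrow> ('i \<Rightarrow> 'm) \<Rightarrow> bool" where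
  "is_cone J C D0 D1 P p \<longleftrightarrow> P \<in> Obj C \<and>
     (\<forall>i\<in>Obj J. p i \<in> Hom C P (D0 i)) \<and>
     (\<forall>u\<in>Arr J. D1 u \<cdot>\<^bsub>C\<^esub> p (Dom J u) = p (Cod J u))"

definition is_limit :: "('i, 'j, 'y) category_scheme \<Rightarrow> ('o, 'm, 'z) category_scheme \<Rightarrow>
    ('i \<Rightarrow> 'o) \<Rightarrow> ('j \<Rightarrow> 'm) \<Rightarrow> 'o \<Rightarrow> ('i \<Rightarrow> 'm) \<Rightarrow> bool" where
  "is_limit J C D0 D1 P p \<longleftrightarrow> is_cone J C D0 D1 P p \<and>
     (\<forall>Q q. is_cone J C D0 D1 Q q \<longrightarrow>
        (\<exists>!h. h \<in> Hom C Q P \<and> (\<forall>i\<in>Obj J. p i \<cdot>\<^bsub>C\<^esub> h = q i)))"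

text \<open>Quantifying over shapes in type \<open>nat\<close> is enough: every finite category is isomorphic to one of these.\<close>

definition has_finite_limits :: "('o, 'm, 'z) category_scheme \<Rightarrow> bool" where
  "has_finite_limits C \<longleftrightarrow>
     (\<forall>(J :: (nat, nat) category) D0 D1.
        category J \<longrightarrow> finite (Obj J) \<longrightarrow> finite (Arr J) \<longrightarrow> is_diagram J C D0 D1 \<longrightarrow>
        (\<exists>P p. is_limit J C D0 D1 P p))"

text \<open>A fibre product of a family of arrows with codomain \<open>B\<close>.  Repeating a monomorphism in the
  family does not change its fibre product, so a family of monomorphisms is given by a set.\<close>

definition is_fibre_product ::
    "('o, 'm, 'z) category_scheme \<Rightarrow> 'o \<Rightarrow> 'm set \<Rightarrow> 'o \<Rightarrow> 'm \<Rightarrow> ('m \<Rightarrow> 'm) \<Rightarrow> bool" where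
  "is_fibre_product C B S P p \<pi> \<longleftrightarrow>
     P \<in> Obj C \<and> p \<in> Hom C P B \<and>
     (\<forall>m\<in>S. \<pi> m \<in> Hom C P (Dom C m) \<and> m \<cdot>\<^bsub>C\<^esub> \<pi> m = p) \<and>
     (\<forall>Q. \<forall>q\<in>Hom C Q B. \<forall>\<rho>.
        (\<forall>m\<in>S. \<rho> m \<in> Hom C Q (Dom C m) \<and> m \<cdot>\<^bsub>C\<^esub> \<rho> m = q) \<longrightarrow>
        (\<exists>!h. h \<in> Hom C Q P \<and> p \<cdot>\<^bsub>C\<^esub> h = q \<and> (\<forall>m\<in>S. \<pi> m \<cdot>\<^bsub>C\<^esub> h = \<rho> m)))"

definition finitely_well_complete :: "('o, 'm, 'z) category_scheme \<Rightarrow> bool" where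
  "finitely_well_complete C \<longleftrightarrow> has_finite_limits C \<and>
     (\<forall>B\<in>Obj C. \<forall>S. (\<forall>m\<in>S. is_strong_mono C m \<and> Cod C m = B) \<longrightarrow>
        (\<exists>P p \<pi>. is_fibre_product C B S P p \<pi>))"


section \<open>Closed symmetric monoidal categories\<close>

text \<open>The internal hom is a bifunctor: for \<open>f : A' \<rightarrow> A\<close> and \<open>g : B \<rightarrow> B'\<close>, the arrow
  \<open>IHomArr f g : IHom A B \<rightarrow> IHom A' B'\<close> is \<open>[f, g]\<close>.  The evaluation is
  \<open>Eval A B : IHom A B \<otimes> A \<rightarrow> B\<close>, so \<open>IHom A\<close> is right adjoint to tensoring with \<open>A\<close> on the right.\<close>

record ('o, 'm) closed_monoidal = "('o, 'm) category" +
  Tensor :: "'o \<Rightarrow> 'o \<Rightarrow> 'o" (infixr "\<otimes>\<index>" 70)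
  TensorArr :: "'m \<Rightarrow> 'm \<Rightarrow> 'm" (infixr "\<otimes>\<^sub>a\<index>" 70)
  Unit :: 'o
  Assoc :: "'o \<Rightarrow> 'o \<Rightarrow> 'o \<Rightarrow> 'm"
  LUnit :: "'o \<Rightarrow> 'm"
  RUnit :: "'o \<Rightarrow> 'm"
  Braid :: "'o \<Rightarrow> 'o \<Rightarrow> 'm"
  IHom :: "'o \<Rightarrow> 'o \<Rightarrow> 'o"
  IHomArr :: "'m \<Rightarrow> 'm \<Rightarrow> 'm"
  Eval :: "'o \<Rightarrow> 'o \<Rightarrow> 'm"

locale closed_symmetric_monoidal_category = category V
  for V :: "('o, 'm) closed_monoidal" (structure) +
  assumes Tensor_in_Obj: "A \<in> Obj V \<Longrightarrow> B \<in> Obj V \<Longrightarrow> A \<otimes> B \<in> Obj V"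
    and TensorArr_in_Hom: "f \<in> Hom V A A' \<Longrightarrow> g \<in> Hom V B B' \<Longrightarrow>
      f \<otimes>\<^sub>a g \<in> Hom V (A \<otimes> B) (A' \<otimes> B')"
    and TensorArr_Id: "A \<in> Obj V \<Longrightarrow> B \<in> Obj V \<Longrightarrow> Id V A \<otimes>\<^sub>a Id V B = Id V (A \<otimes> B)"
    and TensorArr_Comp:
      "f \<in> Hom V A A' \<Longrightarrow> f' \<in> Hom V A' A'' \<Longrightarrow> g \<in> Hom V B B' \<Longrightarrow> g' \<in> Hom V B' B'' \<Longrightarrow>
      (f' \<cdot> f) \<otimes>\<^sub>a (g' \<cdot> g) = (f' \<otimes>\<^sub>a g') \<cdot> (f \<otimes>\<^sub>a g)"
    and Unit_in_Obj: "Unit V \<in> Obj V"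
    and Assoc_in_Hom: "A \<in> Obj V \<Longrightarrow> B \<in> Obj V \<Longrightarrow> D \<in> Obj V \<Longrightarrow>
      Assoc V A B D \<in> Hom V ((A \<otimes> B) \<otimes> D) (A \<otimes> (B \<otimes> D))"
    and Assoc_iso: "A \<in> Obj V \<Longrightarrow> B \<in> Obj V \<Longrightarrow> D \<in> Obj V \<Longrightarrow> is_iso V (Assoc V A B D)"
    and Assoc_natural: "f \<in> Hom V A A' \<Longrightarrow> g \<in> Hom V B B' \<Longrightarrow> h \<in> Hom V D D' \<Longrightarrow>
      Assoc V A' B' D' \<cdot> ((f \<otimes>\<^sub>a g) \<otimes>\<^sub>a h) = (f \<otimes>\<^sub>a (g \<otimes>\<^sub>a h)) \<cdot> Assoc V A B D"
    and LUnit_in_Hom: "A \<in> Obj V \<Longrightarrow> LUnit V A \<in> Hom V (Unit V \<otimes> A) A"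
    and LUnit_iso: "A \<in> Obj V \<Longrightarrow> is_iso V (LUnit V A)"
    and LUnit_natural: "f \<in> Hom V A B \<Longrightarrow>
      LUnit V B \<cdot> (Id V (Unit V) \<otimes>\<^sub>a f) = f \<cdot> LUnit V A"
    and RUnit_in_Hom: "A \<in> Obj V \<Longrightarrow> RUnit V A \<in> Hom V (A \<otimes> Unit V) A"
    and RUnit_iso: "A \<in> Obj V \<Longrightarrow> is_iso V (RUnit V A)"
    and RUnit_natural: "f \<in> Hom V A B \<Longrightarrow>
      RUnit V B \<cdot> (f \<otimes>\<^sub>a Id V (Unit V)) = f \<cdot> RUnit V A"
    and Braid_in_Hom: "A \<in> Obj V \<Longrightarrow> B \<in> Obj V \<Longrightarrow> Braid V A B \<in> Hom V (A \<otimes> B) (B \<otimes> A)"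
    and Braid_natural: "f \<in> Hom V A A' \<Longrightarrow> g \<in> Hom V B B' \<Longrightarrow>
      Braid V A' B' \<cdot> (f \<otimes>\<^sub>a g) = (g \<otimes>\<^sub>a f) \<cdot> Braid V A B"
    and symmetry: "A \<in> Obj V \<Longrightarrow> B \<in> Obj V \<Longrightarrow> Braid V B A \<cdot> Braid V A B = Id V (A \<otimes> B)"
    and pentagon: "A \<in> Obj V \<Longrightarrow> B \<in> Obj V \<Longrightarrow> D \<in> Obj V \<Longrightarrow> E \<in> Obj V \<Longrightarrow>
      Assoc V A B (D \<otimes> E) \<cdot> Assoc V (A \<otimes> B) D E =
      (Id V A \<otimes>\<^sub>a Assoc V B D E) \<cdot> Assoc V A (B \<otimes> D) E \<cdot> (Assoc V A B D \<otimes>\<^sub>a Id V E)"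
    and triangle: "A \<in> Obj V \<Longrightarrow> B \<in> Obj V \<Longrightarrow>
      (Id V A \<otimes>\<^sub>a LUnit V B) \<cdot> Assoc V A (Unit V) B = RUnit V A \<otimes>\<^sub>a Id V B"
    and hexagon: "A \<in> Obj V \<Longrightarrow> B \<in> Obj V \<Longrightarrow> D \<in> Obj V \<Longrightarrow>
      Assoc V B D A \<cdot> Braid V A (B \<otimes> D) \<cdot> Assoc V A B D =
      (Id V B \<otimes>\<^sub>a Braid V A D) \<cdot> Assoc V B A D \<cdot> (Braid V A B \<otimes>\<^sub>a Id V D)"
    and IHom_in_Obj: "A \<in> Obj V \<Longrightarrow> B \<in> Obj V \<Longrightarrow> IHom V A B \<in> Obj V"
    and Eval_in_Hom: "A \<in> Obj V \<Longrightarrow> B \<in> Obj V \<Longrightarrow> Eval V A B \<in> Hom V (IHom V A B \<otimes> A) B"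
    and closed: "A \<in> Obj V \<Longrightarrow> B \<in> Obj V \<Longrightarrow> f \<in> Hom V (A \<otimes> B) D \<Longrightarrow>
      \<exists>!h. h \<in> Hom V A (IHom V B D) \<and> Eval V B D \<cdot> (h \<otimes>\<^sub>a Id V B) = f"
    and IHomArr_in_Hom: "f \<in> Hom V A' A \<Longrightarrow> g \<in> Hom V B B' \<Longrightarrow>
      IHomArr V f g \<in> Hom V (IHom V A B) (IHom V A' B')"
    and Eval_IHomArr: "f \<in> Hom V A' A \<Longrightarrow> g \<in> Hom V B B' \<Longrightarrow>
      Eval V A' B' \<cdot> (IHomArr V f g \<otimes>\<^sub>a Id V A') =
      g \<cdot> Eval V A B \<cdot> (Id V (IHom V A B) \<otimes>\<^sub>a f)"

definition curry_arr :: "('o, 'm) closed_monoidal \<Rightarrow> 'o \<Rightarrow> 'o \<Rightarrow> 'm \<Rightarrow> 'm" where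
  "curry_arr V A B f =
     (THE h. h \<in> Hom V A (IHom V B (Cod V f)) \<and>
        Eval V B (Cod V f) \<cdot>\<^bsub>V\<^esub> (h \<otimes>\<^sub>a\<^bsub>V\<^esub> Id V B) = f)"

definition uncurry_arr :: "('o, 'm) closed_monoidal \<Rightarrow> 'o \<Rightarrow> 'o \<Rightarrow> 'm \<Rightarrow> 'm" where
  "uncurry_arr V B C h = Eval V B C \<cdot>\<^bsub>V\<^esub> (h \<otimes>\<^sub>a\<^bsub>V\<^esub> Id V B)"


section \<open>Enriched categories, functors and monads\<close>

text \<open>A \<open>V\<close>-category is given together with its underlying ordinary category (with objects of
  type \<open>'a\<close> and arrows of type \<open>'b\<close>) and the bijections
  \<open>Name : Hom A B \<cong> Hom V I (EHom A B)\<close>; the identity element of \<open>A\<close> is \<open>Name (Id A)\<close>.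
  \<open>EComp A B C : EHom B C \<otimes> EHom A B \<rightarrow> EHom A C\<close> is the composition.\<close>

record ('a, 'b, 'o, 'm) enriched = "('a, 'b) category" +
  EHom :: "'a \<Rightarrow> 'a \<Rightarrow> 'o"
  EComp :: "'a \<Rightarrow> 'a \<Rightarrow> 'a \<Rightarrow> 'm"
  Name :: "'b \<Rightarrow> 'm"

text \<open>The category \<open>V\<close> enriched in itself.\<close>

definition self :: "('o, 'm) closed_monoidal \<Rightarrow> ('o, 'm, 'o, 'm) enriched" where
  "self V =
    \<lparr> Obj = Obj V, Arr = Arr V, Dom = Dom V, Cod = Cod V, Id = Id V, Comp = Comp V,
      EHom = IHom V,
      EComp = (\<lambda>A B C. curry_arr V (IHom V B C \<otimes>\<^bsub>V\<^esub> IHom V A B) A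
        (Eval V B C \<cdot>\<^bsub>V\<^esub> (Id V (IHom V B C) \<otimes>\<^sub>a\<^bsub>V\<^esub> Eval V A B)
          \<cdot>\<^bsub>V\<^esub> Assoc V (IHom V B C) (IHom V A B) A)),
      Name = (\<lambda>f. curry_arr V (Unit V) (Dom V f) (f \<cdot>\<^bsub>V\<^esub> LUnit V (Dom V f))) \<rparr>"

definition op_enriched ::
    "('o, 'm) closed_monoidal \<Rightarrow> ('a, 'b, 'o, 'm) enriched \<Rightarrow> ('a, 'b, 'o, 'm) enriched" where
  "op_enriched V A =
    \<lparr> Obj = Obj A, Arr = Arr A, Dom = Cod A, Cod = Dom A, Id = Id A, Comp = (\<lambda>g f. f \<cdot>\<^bsub>A\<^esub> g),
      EHom = (\<lambda>X Y. EHom A Y X),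
      EComp = (\<lambda>X Y Z. EComp A Z Y X \<cdot>\<^bsub>V\<^esub> Braid V (EHom A Z Y) (EHom A Y X)),
      Name = Name A \<rparr>"

text \<open>The arrow \<open>A(X, g) : A(X, Y) \<rightarrow> A(X, Z)\<close> for \<open>g : Y \<rightarrow> Z\<close>, the arrow
  \<open>A(f, Z) : A(Y, Z) \<rightarrow> A(X, Z)\<close> for \<open>f : X \<rightarrow> Y\<close>, and \<open>A(f, g)\<close>.\<close>

definition ehom_post ::
    "('o, 'm) closed_monoidal \<Rightarrow> ('a, 'b, 'o, 'm) enriched \<Rightarrow> 'a \<Rightarrow> 'b \<Rightarrow> 'm" where
  "ehom_post V A X g = EComp A X (Dom A g) (Cod A g)
     \<cdot>\<^bsub>V\<^esub> (Name A g \<otimes>\<^sub>a\<^bsub>V\<^esub> Id V (EHom A X (Dom A g)))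
     \<cdot>\<^bsub>V\<^esub> inverse_arr V (LUnit V (EHom A X (Dom A g)))"

definition ehom_pre ::
    "('o, 'm) closed_monoidal \<Rightarrow> ('a, 'b, 'o, 'm) enriched \<Rightarrow> 'b \<Rightarrow> 'a \<Rightarrow> 'm" where
  "ehom_pre V A f Z = EComp A (Dom A f) (Cod A f) Z
     \<cdot>\<^bsub>V\<^esub> (Id V (EHom A (Cod A f) Z) \<otimes>\<^sub>a\<^bsub>V\<^esub> Name A f)
     \<cdot>\<^bsub>V\<^esub> inverse_arr V (RUnit V (EHom A (Cod A f) Z))"

definition ehom_arr ::
    "('o, 'm) closed_monoidal \<Rightarrow> ('a, 'b, 'o, 'm) enriched \<Rightarrow> 'b \<Rightarrow> 'b \<Rightarrow> 'm" where
  "ehom_arr V A f g = ehom_post V A (Dom A f) g \<cdot>\<^bsub>V\<^esub> ehom_pre V A f (Dom A g)"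

text \<open>\<open>FHom F X Y : A(X, Y) \<rightarrow> B(F X, F Y)\<close>.\<close>

record ('a, 'c, 'm) enriched_functor =
  FOb :: "'a \<Rightarrow> 'c"
  FHom :: "'a \<Rightarrow> 'a \<Rightarrow> 'm"

locale enriched_functor =
  fixes V :: "('o, 'm) closed_monoidal"
    and A :: "('a, 'b, 'o, 'm) enriched"
    and B :: "('c, 'd, 'o, 'm) enriched"
    and F :: "('a, 'c, 'm) enriched_functor"
  assumes FOb_in_Obj: "X \<in> Obj A \<Longrightarrow> FOb F X \<in> Obj B"
    and FHom_in_Hom: "X \<in> Obj A \<Longrightarrow> Y \<in> Obj A \<Longrightarrow>
      FHom F X Y \<in> Hom V (EHom A X Y) (EHom B (FOb F X) (FOb F Y))"
    and FHom_Id: "X \<in> Obj A \<Longrightarrow>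
      FHom F X X \<cdot>\<^bsub>V\<^esub> Name A (Id A X) = Name B (Id B (FOb F X))"
    and FHom_Comp: "X \<in> Obj A \<Longrightarrow> Y \<in> Obj A \<Longrightarrow> Z \<in> Obj A \<Longrightarrow>
      FHom F X Z \<cdot>\<^bsub>V\<^esub> EComp A X Y Z =
      EComp B (FOb F X) (FOb F Y) (FOb F Z) \<cdot>\<^bsub>V\<^esub> (FHom F Y Z \<otimes>\<^sub>a\<^bsub>V\<^esub> FHom F X Y)"

text \<open>The underlying ordinary functor on arrows.\<close>

definition FArr :: "('o, 'm) closed_monoidal \<Rightarrow> ('a, 'b, 'o, 'm) enriched \<Rightarrow>
    ('c, 'd, 'o, 'm) enriched \<Rightarrow> ('a, 'c, 'm) enriched_functor \<Rightarrow> 'b \<Rightarrow> 'd" where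
  "FArr V A B F f =
     (THE g. g \<in> Hom B (FOb F (Dom A f)) (FOb F (Cod A f)) \<and>
        Name B g = FHom F (Dom A f) (Cod A f) \<cdot>\<^bsub>V\<^esub> Name A f)"

definition id_functor ::
    "('o, 'm) closed_monoidal \<Rightarrow> ('a, 'b, 'o, 'm) enriched \<Rightarrow> ('a, 'a, 'm) enriched_functor" where
  "id_functor V A = \<lparr> FOb = (\<lambda>X. X), FHom = (\<lambda>X Y. Id V (EHom A X Y)) \<rparr>"

definition comp_functor :: "('o, 'm) closed_monoidal \<Rightarrow> ('b, 'c, 'm) enriched_functor \<Rightarrow>
    ('a, 'b, 'm) enriched_functor \<Rightarrow> ('a, 'c, 'm) enriched_functor" where
  "comp_functor V K F =
    \<lparr> FOb = (\<lambda>X. FOb K (FOb F X)),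
      FHom = (\<lambda>X Y. FHom K (FOb F X) (FOb F Y) \<cdot>\<^bsub>V\<^esub> FHom F X Y) \<rparr>"

definition op_functor :: "('a, 'c, 'm) enriched_functor \<Rightarrow> ('a, 'c, 'm) enriched_functor" where
  "op_functor F = \<lparr> FOb = FOb F, FHom = (\<lambda>X Y. FHom F Y X) \<rparr>"

text \<open>The representable functor \<open>A(-, K)\<close> from \<open>op_enriched V A\<close> to \<open>self V\<close>.\<close>

definition hom_into :: "('o, 'm) closed_monoidal \<Rightarrow> ('a, 'b, 'o, 'm) enriched \<Rightarrow> 'a \<Rightarrow>
    ('a, 'o, 'm) enriched_functor" where
  "hom_into V A K =
    \<lparr> FOb = (\<lambda>X. EHom A X K),
      FHom = (\<lambda>X Y. curry_arr V (EHom A Y X) (EHom A X K)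
        (EComp A Y X K \<cdot>\<^bsub>V\<^esub> Braid V (EHom A Y X) (EHom A X K))) \<rparr>"

definition enriched_natural :: "('o, 'm) closed_monoidal \<Rightarrow> ('a, 'b, 'o, 'm) enriched \<Rightarrow>
    ('c, 'd, 'o, 'm) enriched \<Rightarrow> ('a, 'c, 'm) enriched_functor \<Rightarrow>
    ('a, 'c, 'm) enriched_functor \<Rightarrow> ('a \<Rightarrow> 'd) \<Rightarrow> bool" where
  "enriched_natural V A B F K \<alpha> \<longleftrightarrow>
     (\<forall>X\<in>Obj A. \<alpha> X \<in> Hom B (FOb F X) (FOb K X)) \<and>
     (\<forall>X\<in>Obj A. \<forall>Y\<in>Obj A.
        ehom_post V B (FOb F X) (\<alpha> Y) \<cdot>\<^bsub>V\<^esub> FHom F X Y =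
        ehom_pre V B (\<alpha> X) (FOb K Y) \<cdot>\<^bsub>V\<^esub> FHom K X Y)"

record ('a, 'b, 'm) enriched_monad =
  MFun :: "('a, 'a, 'm) enriched_functor"
  MUnit :: "'a \<Rightarrow> 'b"
  MMult :: "'a \<Rightarrow> 'b"

abbreviation MOb :: "('a, 'b, 'm) enriched_monad \<Rightarrow> 'a \<Rightarrow> 'a" where
  "MOb T \<equiv> FOb (MFun T)"

abbreviation MArr :: "('o, 'm) closed_monoidal \<Rightarrow> ('a, 'b, 'o, 'm) enriched \<Rightarrow>
    ('a, 'b, 'm) enriched_monad \<Rightarrow> 'b \<Rightarrow> 'b" where
  "MArr V A T \<equiv> FArr V A A (MFun T)"

locale enriched_monad =
  fixes V :: "('o, 'm) closed_monoidal"
    and A :: "('a, 'b, 'o, 'm) enriched"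
    and T :: "('a, 'b, 'm) enriched_monad"
  assumes MFun_functor: "enriched_functor V A A (MFun T)"
    and unit_natural: "enriched_natural V A A (id_functor V A) (MFun T) (MUnit T)"
    and mult_natural:
      "enriched_natural V A A (comp_functor V (MFun T) (MFun T)) (MFun T) (MMult T)"
    and left_unit: "X \<in> Obj A \<Longrightarrow> MMult T X \<cdot>\<^bsub>A\<^esub> MUnit T (MOb T X) = Id A (MOb T X)"
    and right_unit: "X \<in> Obj A \<Longrightarrow> MMult T X \<cdot>\<^bsub>A\<^esub> MArr V A T (MUnit T X) = Id A (MOb T X)"
    and mult_assoc: "X \<in> Obj A \<Longrightarrow>
      MMult T X \<cdot>\<^bsub>A\<^esub> MMult T (MOb T X) = MMult T X \<cdot>\<^bsub>A\<^esub> MArr V A T (MMult T X)"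

text \<open>A morphism \<open>(\<theta>, Q) : T \<rightarrow> S\<close> from a monad \<open>T\<close> on \<open>A\<close> to a monad \<open>S\<close> on \<open>B\<close>, with
  \<open>Q : B \<rightarrow> A\<close> and \<open>\<theta> : T Q \<rightarrow> Q S\<close>.\<close>

definition monad_morphism :: "('o, 'm) closed_monoidal \<Rightarrow> ('a, 'b, 'o, 'm) enriched \<Rightarrow>
    ('c, 'd, 'o, 'm) enriched \<Rightarrow> ('a, 'b, 'm) enriched_monad \<Rightarrow> ('c, 'd, 'm) enriched_monad \<Rightarrow>
    ('c \<Rightarrow> 'b) \<Rightarrow> ('c, 'a, 'm) enriched_functor \<Rightarrow> bool" where
  "monad_morphism V A B T S \<theta> Q \<longleftrightarrow>
     enriched_functor V B A Q \<and>
     enriched_natural V B A (comp_functor V (MFun T) Q) (comp_functor V Q (MFun S)) \<theta> \<and>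
     (\<forall>X\<in>Obj B. \<theta> X \<cdot>\<^bsub>A\<^esub> MUnit T (FOb Q X) = FArr V B A Q (MUnit S X)) \<and>
     (\<forall>X\<in>Obj B. \<theta> X \<cdot>\<^bsub>A\<^esub> MMult T (FOb Q X) =
        FArr V B A Q (MMult S X) \<cdot>\<^bsub>A\<^esub> \<theta> (MOb S X) \<cdot>\<^bsub>A\<^esub> MArr V A T (\<theta> X))"

text \<open>A representation of \<open>P\<close>, a functor from \<open>op_enriched V A\<close> to \<open>self V\<close>, by the object \<open>K\<close>,
  and its counit, an element of \<open>P K\<close>.\<close>

definition is_representation :: "('o, 'm) closed_monoidal \<Rightarrow> ('a, 'b, 'o, 'm) enriched \<Rightarrow>
    ('a, 'o, 'm) enriched_functor \<Rightarrow> 'a \<Rightarrow> ('a \<Rightarrow> 'm) \<Rightarrow> bool" where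
  "is_representation V A P K \<phi> \<longleftrightarrow>
     enriched_natural V (op_enriched V A) (self V) P (hom_into V A K) \<phi> \<and>
     (\<forall>X\<in>Obj A. is_iso V (\<phi> X))"

definition is_counit :: "('o, 'm) closed_monoidal \<Rightarrow> ('a, 'b, 'o, 'm) enriched \<Rightarrow>
    ('a, 'o, 'm) enriched_functor \<Rightarrow> 'a \<Rightarrow> ('a \<Rightarrow> 'm) \<Rightarrow> 'm \<Rightarrow> bool" where
  "is_counit V A P K \<phi> u \<longleftrightarrow>
     u \<in> Hom V (Unit V) (FOb P K) \<and> \<phi> K \<cdot>\<^bsub>V\<^esub> u = Name A (Id A K)"


section \<open>Algebras of an enriched monad\<close>

type_synonym ('o, 'm) algebra = "'o \<times> 'm"
type_synonym ('o, 'm) alg_arr = "('o, 'm) algebra \<times> 'm \<times> ('o, 'm) algebra"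
type_synonym ('o, 'm) self_monad = "('o, 'm, 'm) enriched_monad"

abbreviation und :: "('o, 'm) alg_arr \<Rightarrow> 'm" where
  "und f \<equiv> fst (snd f)"

abbreviation SArr :: "('o, 'm) closed_monoidal \<Rightarrow> ('o, 'm) self_monad \<Rightarrow> 'm \<Rightarrow> 'm" where
  "SArr V T \<equiv> MArr V (self V) T"

definition is_algebra ::
    "('o, 'm) closed_monoidal \<Rightarrow> ('o, 'm) self_monad \<Rightarrow> ('o, 'm) algebra \<Rightarrow> bool" where
  "is_algebra V T A \<longleftrightarrow> (case A of (X, a) \<Rightarrow>
     X \<in> Obj V \<and> a \<in> Hom V (MOb T X) X \<and>
     a \<cdot>\<^bsub>V\<^esub> MUnit T X = Id V X \<and> a \<cdot>\<^bsub>V\<^esub> MMult T X = a \<cdot>\<^bsub>V\<^esub> SArr V T a)"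

definition EM_cat :: "('o, 'm) closed_monoidal \<Rightarrow> ('o, 'm) self_monad \<Rightarrow>
    (('o, 'm) algebra, ('o, 'm) alg_arr) category" where
  "EM_cat V T =
    \<lparr> Obj = {A. is_algebra V T A},
      Arr = {(A, f, B). is_algebra V T A \<and> is_algebra V T B \<and> f \<in> Hom V (fst A) (fst B) \<and>
        f \<cdot>\<^bsub>V\<^esub> snd A = snd B \<cdot>\<^bsub>V\<^esub> SArr V T f},
      Dom = (\<lambda>(A, f, B). A),
      Cod = (\<lambda>(A, f, B). B),
      Id = (\<lambda>A. (A, Id V (fst A), A)),
      Comp = (\<lambda>(B', g, C) (A, f, B). (A, g \<cdot>\<^bsub>V\<^esub> f, C)) \<rparr>"

definition free_alg ::
    "('o, 'm) closed_monoidal \<Rightarrow> ('o, 'm) self_monad \<Rightarrow> 'o \<Rightarrow> ('o, 'm) algebra" where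
  "free_alg V T X = (MOb T X, MMult T X)"

text \<open>The hom-object \<open>V\<^sup>T(A, B)\<close> is the domain of an equalizer of
  \<open>[a, 1], [1, b] \<cdot> T : [X, Y] \<rightarrow> [T X, Y]\<close>, where \<open>A = (X, a)\<close> and \<open>B = (Y, b)\<close>.\<close>

definition EM_incl :: "('o, 'm) closed_monoidal \<Rightarrow> ('o, 'm) self_monad \<Rightarrow>
    ('o, 'm) algebra \<Rightarrow> ('o, 'm) algebra \<Rightarrow> 'm" where
  "EM_incl V T A B = (SOME e. is_equalizer V
     (IHomArr V (snd A) (Id V (fst B)))
     (IHomArr V (Id V (MOb T (fst A))) (snd B) \<cdot>\<^bsub>V\<^esub> FHom (MFun T) (fst A) (fst B)) e)"

abbreviation EM_hom :: "('o, 'm) closed_monoidal \<Rightarrow> ('o, 'm) self_monad \<Rightarrow>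
    ('o, 'm) algebra \<Rightarrow> ('o, 'm) algebra \<Rightarrow> 'o" where
  "EM_hom V T A B \<equiv> Dom V (EM_incl V T A B)"

definition EM :: "('o, 'm) closed_monoidal \<Rightarrow> ('o, 'm) self_monad \<Rightarrow>
    (('o, 'm) algebra, ('o, 'm) alg_arr, 'o, 'm) enriched" where
  "EM V T =
    \<lparr> Obj = Obj (EM_cat V T), Arr = Arr (EM_cat V T), Dom = Dom (EM_cat V T),
      Cod = Cod (EM_cat V T), Id = Id (EM_cat V T), Comp = Comp (EM_cat V T),
      EHom = EM_hom V T,
      EComp = (\<lambda>A B C. THE h.
        h \<in> Hom V (EM_hom V T B C \<otimes>\<^bsub>V\<^esub> EM_hom V T A B) (EM_hom V T A C) \<and>
        EM_incl V T A C \<cdot>\<^bsub>V\<^esub> h =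
        EComp (self V) (fst A) (fst B) (fst C)
          \<cdot>\<^bsub>V\<^esub> (EM_incl V T B C \<otimes>\<^sub>a\<^bsub>V\<^esub> EM_incl V T A B)),
      Name = (\<lambda>f. THE h.
        h \<in> Hom V (Unit V) (EM_hom V T (Dom (EM_cat V T) f) (Cod (EM_cat V T) f)) \<and>
        EM_incl V T (Dom (EM_cat V T) f) (Cod (EM_cat V T) f) \<cdot>\<^bsub>V\<^esub> h = Name (self V) (und f)) \<rparr>"

definition EM_forget :: "('o, 'm) closed_monoidal \<Rightarrow> ('o, 'm) self_monad \<Rightarrow>
    (('o, 'm) algebra, 'o, 'm) enriched_functor" where
  "EM_forget V T = \<lparr> FOb = fst, FHom = EM_incl V T \<rparr>"

definition EM_counit :: "('o, 'm) closed_monoidal \<Rightarrow> ('o, 'm) self_monad \<Rightarrow>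
    ('o, 'm) algebra \<Rightarrow> ('o, 'm) alg_arr" where
  "EM_counit V T A = (free_alg V T (fst A), snd A, A)"


section \<open>Commutative monads and tensor products of algebras\<close>

definition strength_left ::
    "('o, 'm) closed_monoidal \<Rightarrow> ('o, 'm) self_monad \<Rightarrow> 'o \<Rightarrow> 'o \<Rightarrow> 'm" where
  "strength_left V T X Y =
     uncurry_arr V (MOb T X) (MOb T (X \<otimes>\<^bsub>V\<^esub> Y))
       (FHom (MFun T) X (X \<otimes>\<^bsub>V\<^esub> Y) \<cdot>\<^bsub>V\<^esub> curry_arr V Y X (Braid V Y X))
     \<cdot>\<^bsub>V\<^esub> Braid V (MOb T X) Y"

definition strength_right ::
    "('o, 'm) closed_monoidal \<Rightarrow> ('o, 'm) self_monad \<Rightarrow> 'o \<Rightarrow> 'o \<Rightarrow> 'm" where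
  "strength_right V T X Y =
     uncurry_arr V (MOb T Y) (MOb T (X \<otimes>\<^bsub>V\<^esub> Y))
       (FHom (MFun T) Y (X \<otimes>\<^bsub>V\<^esub> Y) \<cdot>\<^bsub>V\<^esub> curry_arr V X Y (Id V (X \<otimes>\<^bsub>V\<^esub> Y)))"

definition monad_tensor ::
    "('o, 'm) closed_monoidal \<Rightarrow> ('o, 'm) self_monad \<Rightarrow> 'o \<Rightarrow> 'o \<Rightarrow> 'm" where
  "monad_tensor V T X Y = MMult T (X \<otimes>\<^bsub>V\<^esub> Y)
     \<cdot>\<^bsub>V\<^esub> SArr V T (strength_left V T X Y) \<cdot>\<^bsub>V\<^esub> strength_right V T (MOb T X) Y"

definition commutative_monad ::
    "('o, 'm) closed_monoidal \<Rightarrow> ('o, 'm) self_monad \<Rightarrow> bool" where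
  "commutative_monad V T \<longleftrightarrow>
     (\<forall>X\<in>Obj V. \<forall>Y\<in>Obj V.
        monad_tensor V T X Y = MMult T (X \<otimes>\<^bsub>V\<^esub> Y)
          \<cdot>\<^bsub>V\<^esub> SArr V T (strength_right V T X Y) \<cdot>\<^bsub>V\<^esub> strength_left V T X (MOb T Y))"

definition is_alg_tensor :: "('o, 'm) closed_monoidal \<Rightarrow> ('o, 'm) self_monad \<Rightarrow>
    ('o, 'm) algebra \<Rightarrow> ('o, 'm) algebra \<Rightarrow> ('o, 'm) alg_arr \<Rightarrow> bool" where
  "is_alg_tensor V T A B q \<longleftrightarrow> (case (A, B) of ((X, a), (Y, b)) \<Rightarrow>
     is_coequalizer (EM_cat V T)
       (free_alg V T (MOb T X \<otimes>\<^bsub>V\<^esub> MOb T Y),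
        MMult T (X \<otimes>\<^bsub>V\<^esub> Y) \<cdot>\<^bsub>V\<^esub> SArr V T (monad_tensor V T X Y),
        free_alg V T (X \<otimes>\<^bsub>V\<^esub> Y))
       (free_alg V T (MOb T X \<otimes>\<^bsub>V\<^esub> MOb T Y),
        SArr V T (a \<otimes>\<^sub>a\<^bsub>V\<^esub> b),
        free_alg V T (X \<otimes>\<^bsub>V\<^esub> Y))
       q)"

definition has_alg_tensors ::
    "('o, 'm) closed_monoidal \<Rightarrow> ('o, 'm) self_monad \<Rightarrow> bool" where
  "has_alg_tensors V T \<longleftrightarrow>
     (\<forall>A\<in>Obj (EM_cat V T). \<forall>B\<in>Obj (EM_cat V T). \<exists>q. is_alg_tensor V T A B q)"


section \<open>The closed symmetric monoidal category of algebras\<close>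

definition alg_tensor_quot :: "('o, 'm) closed_monoidal \<Rightarrow> ('o, 'm) self_monad \<Rightarrow>
    ('o, 'm) algebra \<Rightarrow> ('o, 'm) algebra \<Rightarrow> ('o, 'm) alg_arr" where
  "alg_tensor_quot V T A B = (SOME q. is_alg_tensor V T A B q)"

abbreviation alg_tensor :: "('o, 'm) closed_monoidal \<Rightarrow> ('o, 'm) self_monad \<Rightarrow>
    ('o, 'm) algebra \<Rightarrow> ('o, 'm) algebra \<Rightarrow> ('o, 'm) algebra" where
  "alg_tensor V T A B \<equiv> Cod (EM_cat V T) (alg_tensor_quot V T A B)"

text \<open>The universal bimorphism \<open>X \<otimes> Y \<rightarrow> T (X \<otimes> Y) \<rightarrow> A \<otimes> B\<close>.\<close>

definition univ_bimorphism :: "('o, 'm) closed_monoidal \<Rightarrow> ('o, 'm) self_monad \<Rightarrow>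
    ('o, 'm) algebra \<Rightarrow> ('o, 'm) algebra \<Rightarrow> 'm" where
  "univ_bimorphism V T A B =
     und (alg_tensor_quot V T A B) \<cdot>\<^bsub>V\<^esub> MUnit T (fst A \<otimes>\<^bsub>V\<^esub> fst B)"

text \<open>The hom-object \<open>H = V\<^sup>T(A, B)\<close> is an algebra under the restriction of the pointwise structure
  \<open>T [X, Y] \<rightarrow> [X, T Y] \<rightarrow> [X, Y]\<close>, the last arrow being \<open>[X, b]\<close>.\<close>

definition alg_ihom :: "('o, 'm) closed_monoidal \<Rightarrow> ('o, 'm) self_monad \<Rightarrow>
    ('o, 'm) algebra \<Rightarrow> ('o, 'm) algebra \<Rightarrow> ('o, 'm) algebra" where
  "alg_ihom V T A B =
     (let H = EM_hom V T A B; e = EM_incl V T A B; X = fst A; Y = fst B in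
      (H, THE s. s \<in> Hom V (MOb T H) H \<and>
         e \<cdot>\<^bsub>V\<^esub> s = curry_arr V (MOb T H) X
           (snd B \<cdot>\<^bsub>V\<^esub> SArr V T (Eval V X Y \<cdot>\<^bsub>V\<^esub> (e \<otimes>\<^sub>a\<^bsub>V\<^esub> Id V X)) \<cdot>\<^bsub>V\<^esub> strength_left V T H X)))"

text \<open>The structure arrows are those induced from \<open>V\<close> through the universal bimorphisms
  \<open>u A B : X \<otimes> Y \<rightarrow> A \<otimes> B\<close>.\<close>

definition EM_closed :: "('o, 'm) closed_monoidal \<Rightarrow> ('o, 'm) self_monad \<Rightarrow>
    (('o, 'm) algebra, ('o, 'm) alg_arr) closed_monoidal" where
  "EM_closed V T =
    (let L = EM_cat V T; tensor = alg_tensor V T; u = univ_bimorphism V T;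
         R = free_alg V T (Unit V) in
     \<lparr> Obj = Obj L, Arr = Arr L, Dom = Dom L, Cod = Cod L, Id = Id L, Comp = Comp L,
       Tensor = tensor,
       TensorArr = (\<lambda>f g. THE h.
         h \<in> Hom L (tensor (Dom L f) (Dom L g)) (tensor (Cod L f) (Cod L g)) \<and>
         und h \<cdot>\<^bsub>V\<^esub> u (Dom L f) (Dom L g) =
         u (Cod L f) (Cod L g) \<cdot>\<^bsub>V\<^esub> (und f \<otimes>\<^sub>a\<^bsub>V\<^esub> und g)),
       Unit = R,
       Assoc = (\<lambda>A B C. THE h.
         h \<in> Hom L (tensor (tensor A B) C) (tensor A (tensor B C)) \<and>
         und h \<cdot>\<^bsub>V\<^esub> u (tensor A B) C \<cdot>\<^bsub>V\<^esub> (u A B \<otimes>\<^sub>a\<^bsub>V\<^esub> Id V (fst C)) =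
         u A (tensor B C) \<cdot>\<^bsub>V\<^esub> (Id V (fst A) \<otimes>\<^sub>a\<^bsub>V\<^esub> u B C)
           \<cdot>\<^bsub>V\<^esub> Assoc V (fst A) (fst B) (fst C)),
       LUnit = (\<lambda>A. THE h. h \<in> Hom L (tensor R A) A \<and>
         und h \<cdot>\<^bsub>V\<^esub> u R A \<cdot>\<^bsub>V\<^esub> (MUnit T (Unit V) \<otimes>\<^sub>a\<^bsub>V\<^esub> Id V (fst A)) = LUnit V (fst A)),
       RUnit = (\<lambda>A. THE h. h \<in> Hom L (tensor A R) A \<and>
         und h \<cdot>\<^bsub>V\<^esub> u A R \<cdot>\<^bsub>V\<^esub> (Id V (fst A) \<otimes>\<^sub>a\<^bsub>V\<^esub> MUnit T (Unit V)) = RUnit V (fst A)),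
       Braid = (\<lambda>A B. THE h. h \<in> Hom L (tensor A B) (tensor B A) \<and>
         und h \<cdot>\<^bsub>V\<^esub> u A B = u B A \<cdot>\<^bsub>V\<^esub> Braid V (fst A) (fst B)),
       IHom = alg_ihom V T,
       IHomArr = (\<lambda>f g. (alg_ihom V T (Cod L f) (Dom L g), ehom_arr V (EM V T) f g,
         alg_ihom V T (Dom L f) (Cod L g))),
       Eval = (\<lambda>A B. THE h. h \<in> Hom L (tensor (alg_ihom V T A B) A) B \<and>
         und h \<cdot>\<^bsub>V\<^esub> u (alg_ihom V T A B) A =
         Eval V (fst A) (fst B) \<cdot>\<^bsub>V\<^esub> (EM_incl V T A B \<otimes>\<^sub>a\<^bsub>V\<^esub> Id V (fst A))) \<rparr>)"


section \<open>Double dualization\<close>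

text \<open>The monad on \<open>self V\<close> induced by the adjunction of \<open>[-, R]\<close> with itself: its unit
  \<open>E \<rightarrow> [[E, R], R]\<close> is the transpose of \<open>E \<otimes> [E, R] \<rightarrow> [E, R] \<otimes> E \<rightarrow> R\<close>, and its
  multiplication is the dual of the unit at \<open>[E, R]\<close>.\<close>

definition ddual_unit :: "('o, 'm) closed_monoidal \<Rightarrow> 'o \<Rightarrow> 'o \<Rightarrow> 'm" where
  "ddual_unit V R E = curry_arr V E (IHom V E R) (Eval V E R \<cdot>\<^bsub>V\<^esub> Braid V E (IHom V E R))"

definition ddual_monad :: "('o, 'm) closed_monoidal \<Rightarrow> 'o \<Rightarrow> ('o, 'm) self_monad" where
  "ddual_monad V R =
    \<lparr> MFun = comp_functor V (hom_into V (self V) R) (op_functor (hom_into V (self V) R)),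
      MUnit = ddual_unit V R,
      MMult = (\<lambda>E. IHomArr V (ddual_unit V R (IHom V E R)) (Id V R)) \<rparr>"

text \<open>On the category of algebras with \<open>R = F I\<close>, the hom-objects are mapped along the forgetful
  functor to make the double dualization monad a \<open>V\<close>-monad on \<open>EM V T\<close>.\<close>

definition EM_ddual :: "('o, 'm) closed_monoidal \<Rightarrow> ('o, 'm) self_monad \<Rightarrow>
    (('o, 'm) algebra, ('o, 'm) alg_arr, 'm) enriched_monad" where
  "EM_ddual V T =
    (let H = ddual_monad (EM_closed V T) (Unit (EM_closed V T)) in
     \<lparr> MFun = \<lparr> FOb = MOb H, FHom = (\<lambda>A B. und (FHom (MFun H) A B)) \<rparr>,
       MUnit = MUnit H,
       MMult = MMult H \<rparr>)"


section \<open>Abstract distribution monads\<close>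

definition canonical_morphism :: "('o, 'm) closed_monoidal \<Rightarrow> ('o, 'm) self_monad \<Rightarrow>
    ('o, 'm) algebra \<Rightarrow> 'm" where
  "canonical_morphism V L E = und (MUnit (EM_ddual V L) E) \<cdot>\<^bsub>V\<^esub> und (EM_counit V L E)"

definition abstract_distribution_monad :: "('o, 'm) closed_monoidal \<Rightarrow> ('o, 'm) self_monad \<Rightarrow>
    ('o, 'm) self_monad \<Rightarrow> ('o \<Rightarrow> 'm) \<Rightarrow> (('o, 'm) algebra \<Rightarrow> 'm) \<Rightarrow> bool" where
  "abstract_distribution_monad V L M \<Delta> \<xi> \<longleftrightarrow>
     enriched_monad V (self V) M \<and>
     monad_morphism V (self V) (self V) L M \<Delta> (id_functor V (self V)) \<and>
     monad_morphism V (self V) (EM V L) M (EM_ddual V L) \<xi> (EM_forget V L) \<and>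
     (\<forall>E\<in>Obj (EM V L). \<xi> E \<cdot>\<^bsub>V\<^esub> \<Delta> (fst E) = canonical_morphism V L E)"

text \<open>The space \<open>M X\<close> as a linear space, i.e. as an \<open>L\<close>-algebra.\<close>

definition dist_space :: "('o, 'm) closed_monoidal \<Rightarrow> ('o, 'm) self_monad \<Rightarrow> ('o \<Rightarrow> 'm) \<Rightarrow> 'o \<Rightarrow>
    ('o, 'm) algebra" where
  "dist_space V M \<Delta> X = (MOb M X, MMult M X \<cdot>\<^bsub>V\<^esub> \<Delta> (MOb M X))"

definition dist_complete :: "('o, 'm) closed_monoidal \<Rightarrow> ('o, 'm) self_monad \<Rightarrow>
    ('o, 'm) self_monad \<Rightarrow> ('o \<Rightarrow> 'm) \<Rightarrow> ('o, 'm) algebra \<Rightarrow> bool" where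
  "dist_complete V L M \<Delta> E \<longleftrightarrow>
     (\<forall>X\<in>Obj V. is_iso (EM_closed V L)
        (IHomArr (EM_closed V L) (free_alg V L X, \<Delta> X, dist_space V M \<Delta> X)
          (Id (EM_closed V L) E)))"

text \<open>\<open>M\<close> as a \<open>V\<close>-functor from \<open>self V\<close> to \<open>EM V L\<close>, and the presheaf \<open>EM V L(M -, E)\<close>.\<close>

definition dist_functor :: "('o, 'm) closed_monoidal \<Rightarrow> ('o, 'm) self_monad \<Rightarrow>
    ('o, 'm) self_monad \<Rightarrow> ('o \<Rightarrow> 'm) \<Rightarrow> ('o, ('o, 'm) algebra, 'm) enriched_functor" where
  "dist_functor V L M \<Delta> =
    \<lparr> FOb = dist_space V M \<Delta>,
      FHom = (\<lambda>X Y. THE h.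
        h \<in> Hom V (IHom V X Y) (EM_hom V L (dist_space V M \<Delta> X) (dist_space V M \<Delta> Y)) \<and>
        EM_incl V L (dist_space V M \<Delta> X) (dist_space V M \<Delta> Y) \<cdot>\<^bsub>V\<^esub> h = FHom (MFun M) X Y) \<rparr>"

definition dist_presheaf :: "('o, 'm) closed_monoidal \<Rightarrow> ('o, 'm) self_monad \<Rightarrow>
    ('o, 'm) self_monad \<Rightarrow> ('o \<Rightarrow> 'm) \<Rightarrow> ('o, 'm) algebra \<Rightarrow> ('o, 'o, 'm) enriched_functor" where
  "dist_presheaf V L M \<Delta> E =
     comp_functor V (hom_into V (EM V L) E) (op_functor (dist_functor V L M \<Delta>))"

definition dist_restrict :: "('o, 'm) closed_monoidal \<Rightarrow> ('o, 'm) self_monad \<Rightarrow>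
    ('o, 'm) self_monad \<Rightarrow> ('o \<Rightarrow> 'm) \<Rightarrow> ('o, 'm) algebra \<Rightarrow> 'o \<Rightarrow> 'm" where
  "dist_restrict V L M \<Delta> E X =
     IHomArr V (MUnit M X) (Id V (fst E))
       \<cdot>\<^bsub>V\<^esub> FHom (EM_forget V L) (dist_space V M \<Delta> X) E"

end

theory Submission
  imports Defs
begin

text \<open>Write \<open>\<phi> X : \<L>(M X, E) \<rightarrow> [X, E]\<close> for restriction along \<open>\<delta> X\<close>.  Since \<open>\<delta> X = \<Delta> X \<cdot> \<eta> X\<close>, it is the composite
  of \<open>\<L>(\<Delta> X, E)\<close>, invertible by distributional completeness, with the free-algebra isomorphism
  \<open>\<L>(F X, E) \<cong> [X, E]\<close>; so \<open>\<phi>\<close> is an isomorphism, and a linear map out of \<open>M X\<close> is determined by its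
  restriction along \<open>\<delta> X\<close>, which can be prescribed.  Let \<open>b\<close> be the linear map with \<open>b \<cdot> \<delta> = 1\<close>.  The maps
  \<open>b \<cdot> \<kappa>\<close> and \<open>b \<cdot> M b\<close> are linear with the same restriction \<open>b\<close> along \<open>\<delta>\<close>, so they agree and \<open>b\<close> is
  an \<open>M\<close>-algebra structure; any linear algebra structure is a retraction of \<open>\<delta>\<close>, hence equals \<open>b\<close>.\<close>

section \<open>Categories\<close>

text \<open>Completeness speaks of hom-objects, and a hom-object of linear maps is an arbitrarily
  chosen equalizer, known only through its inclusion \<open>EM_incl\<close> into an internal hom.
  Equations between arrows into it are therefore tested after \<open>EM_incl\<close>, and equations
  between arrows into an internal hom after \<open>Eval\<close>. The way back to ordinary maps is by
  elements: arrows from the unit object into a hom-object correspond to linear maps through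
  \<open>Name\<close>. Most of the work lies in computing what the composition of \<open>EM\<close>
  and its actions \<open>ehom_post\<close> and \<open>ehom_pre\<close> become under these tests;
  read on elements, each long chain is a short calculation with maps.

  Linearity of \<open>b \<cdot> \<kappa>\<close> and \<open>b \<cdot> M b\<close> has a source of
  its own. At first \<open>b\<close> is a homomorphism for \<open>L\<close> only, whereas
  \<open>\<kappa>\<close> and \<open>M b\<close> are homomorphisms of free
  \<open>M\<close>-algebras; pulling algebras back along \<open>\<Delta>\<close> turns these into
  linear maps, which can then be composed with \<open>b\<close>.\<close>

lemma Hom_iff: "f \<in> Hom C A B \<longleftrightarrow> f \<in> Arr C \<and> Dom C f = A \<and> Cod C f = B"
  by (simp add: Hom_def)

context category
begin

lemma Dom_obj [simp]: "f \<in> Arr C \<Longrightarrow> Dom C f \<in> Obj C"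
  and Cod_obj [simp]: "f \<in> Arr C \<Longrightarrow> Cod C f \<in> Obj C"
  by (rule Dom_in_Obj Cod_in_Obj, assumption)+

lemma Hom_obj: "f \<in> Hom C A B \<Longrightarrow> A \<in> Obj C" "f \<in> Hom C A B \<Longrightarrow> B \<in> Obj C"
  by (auto simp: Hom_iff)

lemma Id_arr [simp]:
  assumes "A \<in> Obj C"
  shows "Id C A \<in> Arr C" "Dom C (Id C A) = A" "Cod C (Id C A) = A"
  using Id_in_Hom[OF assms] by (simp_all add: Hom_iff)

text \<open>Typing is kept as equations on \<open>Dom\<close> and \<open>Cod\<close> rather than as
  membership in \<open>Hom\<close>, so that the simplifier computes the type of a composite without
  having to guess the middle object.\<close>

lemma Comp_arr [simp]:
  assumes "f \<in> Arr C" "g \<in> Arr C" "Dom C g = Cod C f"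
  shows "g \<cdot> f \<in> Arr C" "Dom C (g \<cdot> f) = Dom C f" "Cod C (g \<cdot> f) = Cod C g"
  using Comp_in_Hom[of f "Dom C f" "Cod C f" g "Cod C g"] assms by (simp_all add: Hom_iff)

text \<open>Composites are normalized to the right; a step that contracts an inner pair such as
  \<open>g' \<cdot> g\<close> has to switch this rule off or regroup first.\<close>

lemma Comp_assoc_arr [simp]:
  assumes "f \<in> Arr C" "g \<in> Arr C" "h \<in> Arr C" "Dom C g = Cod C f" "Dom C h = Cod C g"
  shows "(h \<cdot> g) \<cdot> f = h \<cdot> (g \<cdot> f)"
  using Comp_assoc[of f "Dom C f" "Cod C f" g "Cod C g" h "Cod C h"] assms by (simp add: Hom_iff)

lemma Comp_Id_arr [simp]: "f \<in> Arr C \<Longrightarrow> Dom C f = A \<Longrightarrow> f \<cdot> Id C A = f"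
  by (rule Comp_Id) (simp add: Hom_iff)

lemma Id_Comp_arr [simp]: "f \<in> Arr C \<Longrightarrow> Cod C f = A \<Longrightarrow> Id C A \<cdot> f = f"
  by (rule Id_Comp) (simp add: Hom_iff)

lemma is_isoI:
  assumes "f \<in> Hom C A B" "g \<in> Hom C B A" "g \<cdot> f = Id C A" "f \<cdot> g = Id C B"
  shows "is_iso C f"
  using assms unfolding is_iso_def is_inverse_def by (auto simp: Hom_iff)

lemma is_isoE:
  assumes "is_iso C f"
  obtains g where "f \<in> Arr C" "g \<in> Arr C" "Dom C g = Cod C f" "Cod C g = Dom C f"
    "g \<cdot> f = Id C (Dom C f)" "f \<cdot> g = Id C (Cod C f)"
  using assms unfolding is_iso_def is_inverse_def by (auto simp: Hom_iff)

text \<open>\<open>inverse_arr\<close> is a definite description, so two-sided inverses must be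
  shown unique: \<open>h = h \<cdot> (f \<cdot> g) = (h \<cdot> f) \<cdot> g = g\<close>.\<close>

lemma inverse_arr_is_inverse:
  assumes "is_iso C f"
  shows "is_inverse C f (inverse_arr C f)"
proof -
  obtain g where g: "is_inverse C f g" and f: "f \<in> Arr C"
    using assms unfolding is_iso_def by blast
  have "h = g" if h: "is_inverse C f h" for h
  proof -
    have "h = h \<cdot> (f \<cdot> g)"
      using f g h by (simp add: is_inverse_def Hom_iff)
    also have "\<dots> = (h \<cdot> f) \<cdot> g"
      using f g h by (intro Comp_assoc_arr[symmetric]) (simp_all add: is_inverse_def Hom_iff)
    also have "\<dots> = g"
      using f g h by (simp add: is_inverse_def Hom_iff)
    finally show ?thesis .
  qed
  with g show ?thesis
    unfolding inverse_arr_def by (rule theI)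
qed

lemma inverse_arr_simps [simp]:
  assumes "is_iso C f"
  shows "inverse_arr C f \<in> Arr C" "Dom C (inverse_arr C f) = Cod C f"
    "Cod C (inverse_arr C f) = Dom C f"
    "inverse_arr C f \<cdot> f = Id C (Dom C f)" "f \<cdot> inverse_arr C f = Id C (Cod C f)"
  using inverse_arr_is_inverse[OF assms] by (auto simp: is_inverse_def Hom_iff)

lemma iso_Comp:
  assumes "is_iso C f" "is_iso C g" "Dom C g = Cod C f"
  shows "is_iso C (g \<cdot> f)"
proof -
  from assms(1) obtain f' where f: "f \<in> Arr C" "f' \<in> Arr C" "Dom C f' = Cod C f"
    "Cod C f' = Dom C f" "f' \<cdot> f = Id C (Dom C f)" "f \<cdot> f' = Id C (Cod C f)"
    by (rule is_isoE)
  from assms(2) obtain g' where g: "g \<in> Arr C" "g' \<in> Arr C" "Dom C g' = Cod C g"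
    "Cod C g' = Dom C g" "g' \<cdot> g = Id C (Dom C g)" "g \<cdot> g' = Id C (Cod C g)"
    by (rule is_isoE)
  have "(f' \<cdot> g') \<cdot> (g \<cdot> f) = f' \<cdot> ((g' \<cdot> g) \<cdot> f)"
    using f(1-4) g(1-4) assms(3) by simp
  also have "\<dots> = Id C (Dom C f)"
    using f g assms(3) by (simp del: Comp_assoc_arr)
  finally have l: "(f' \<cdot> g') \<cdot> (g \<cdot> f) = Id C (Dom C f)" .
  have "(g \<cdot> f) \<cdot> (f' \<cdot> g') = g \<cdot> ((f \<cdot> f') \<cdot> g')"
    using f(1-4) g(1-4) assms(3) by simp
  also have "\<dots> = Id C (Cod C g)"
    using f g assms(3) by (simp del: Comp_assoc_arr)
  finally have r: "(g \<cdot> f) \<cdot> (f' \<cdot> g') = Id C (Cod C g)" .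
  show ?thesis
    using f(1-4) g(1-4) assms(3) l r
    by (intro is_isoI[of _ "Dom C f" "Cod C g" "f' \<cdot> g'"]) (simp_all add: Hom_iff)
qed

lemma iso_cancel_right:
  assumes "is_iso C e" "f \<in> Arr C" "g \<in> Arr C" "Dom C f = Cod C e" "Dom C g = Cod C e"
    "f \<cdot> e = g \<cdot> e"
  shows "f = g"
proof -
  from assms(1) obtain e' where e: "e \<in> Arr C" "e' \<in> Arr C" "Dom C e' = Cod C e"
    "Cod C e' = Dom C e" "e' \<cdot> e = Id C (Dom C e)" "e \<cdot> e' = Id C (Cod C e)"
    by (rule is_isoE)
  have "(f \<cdot> e) \<cdot> e' = (g \<cdot> e) \<cdot> e'"
    by (simp only: assms(6))
  then show ?thesis
    using assms(2-5) e by simp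
qed

lemma iso_cancel_left:
  assumes "is_iso C e" "f \<in> Arr C" "g \<in> Arr C" "Cod C f = Dom C e" "Cod C g = Dom C e"
    "e \<cdot> f = e \<cdot> g"
  shows "f = g"
proof -
  from assms(1) obtain e' where e: "e \<in> Arr C" "e' \<in> Arr C" "Dom C e' = Cod C e"
    "Cod C e' = Dom C e" "e' \<cdot> e = Id C (Dom C e)" "e \<cdot> e' = Id C (Cod C e)"
    by (rule is_isoE)
  have "e' \<cdot> (e \<cdot> f) = e' \<cdot> (e \<cdot> g)"
    by (simp only: assms(6))
  then have "(e' \<cdot> e) \<cdot> f = (e' \<cdot> e) \<cdot> g"
    using assms(2-5) e(1-4) by simp
  then show ?thesis
    using assms(2-5) e by (simp del: Comp_assoc_arr)
qed

end

section \<open>Equalizers as finite limits\<close>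

text \<open>The parallel pair \<open>2, 3 : 0 \<rightarrow> 1\<close>, with the identities numbered like the objects.\<close>

definition parallel_pair :: "(nat, nat) category" where
  "parallel_pair = \<lparr> Obj = {0, 1}, Arr = {0, 1, 2, 3}, Dom = (\<lambda>u. if u = 1 then 1 else 0),
     Cod = (\<lambda>u. if u = 0 then 0 else 1), Id = (\<lambda>i. i), Comp = (\<lambda>v u. if v < 2 then u else v) \<rparr>"

lemma parallel_pair_simps:
  "Obj parallel_pair = {0, 1}" "Arr parallel_pair = {0, 1, 2, 3}"
  "Dom parallel_pair u = (if u = 1 then 1 else 0)" "Cod parallel_pair u = (if u = 0 then 0 else 1)"
  "Id parallel_pair i = i" "Comp parallel_pair v u = (if v < 2 then u else v)"
  by (simp_all add: parallel_pair_def)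

lemma category_parallel_pair: "category parallel_pair"
proof
  fix f g A B D
  assume "f \<in> Hom parallel_pair A B" "g \<in> Hom parallel_pair B D"
  then have "f \<in> {0, 1, 2, 3}" "g \<in> {0, 1, 2, 3}"
   "A = (if f = 1 then 1 else 0)" "D = (if g = 0 then 0 else 1)"
   "(if f = 0 then 0 else 1) = (if g = 1 then 1 else (0::nat))"
    by (simp_all add: Hom_def parallel_pair_simps)
  then show "Comp parallel_pair g f \<in> Hom parallel_pair A D"
    unfolding Hom_def parallel_pair_simps by (elim insertE; simp)
next
  fix f A B
  assume "f \<in> Hom parallel_pair A B"
  then have "f \<in> {0, 1, 2, 3}"  "B = (if f = 0 then 0 else 1)"
    by (simp_all add: Hom_def parallel_pair_simps)
  then show "Comp parallel_pair f (Id parallel_pair A) = f"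
    "Comp parallel_pair (Id parallel_pair B) f = f"
    using \<open>f \<in> Hom parallel_pair A B\<close>
    unfolding Hom_def parallel_pair_simps by (elim insertE; simp)+
qed (simp_all add: Hom_def parallel_pair_simps, auto)

text \<open>Each of the six pairs contains an identity, 0 or 1, so functoriality of a diagram of
  this shape is a matter of unit laws.\<close>

lemma parallel_pair_composable:
  assumes "u \<in> Arr parallel_pair" "v \<in> Arr parallel_pair" "Dom parallel_pair v = Cod parallel_pair u"
  obtains "v = 0" "u = 0" | "v = 1" "u = 1" | "v = 1" "u = 2" | "v = 1" "u = 3"
    | "v = 2" "u = 0" | "v = 3" "u = 0"
  using assms unfolding parallel_pair_simps by (elim insertE; simp)

context category
begin

text \<open>A cone over a parallel pair is determined by its component at the source: the component
  at the target has to be both \<open>f \<cdot> p 0\<close> and \<open>g \<cdot> p 0\<close>. Hence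
  the component \<open>p 0\<close> of a limit is an equalizer.\<close>

lemma has_equalizer:
  assumes "has_finite_limits C" "f \<in> Hom C A B" "g \<in> Hom C A B"
  shows "\<exists>e. is_equalizer C f g e"
proof -
  define D0 where "D0 i = (if i = 0 then A else B)" for i :: nat
  define D1 where "D1 u = (if u = 0 then Id C A else if u = 1 then Id C B else if u = 2 then f else g)"
    for u :: nat
  have fg: "f \<in> Arr C" "g \<in> Arr C" "Dom C f = A" "Cod C f = B" "Dom C g = A" "Cod C g = B"
    using assms by (auto simp: Hom_iff)
  then have AB: "A \<in> Obj C" "B \<in> Obj C"
    using Dom_in_Obj Cod_in_Obj by blast+
  have "D1 u \<in> Hom C (D0 (Dom parallel_pair u)) (D0 (Cod parallel_pair u))"
    if "u \<in> Arr parallel_pair" for u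
    using that fg AB unfolding parallel_pair_simps
    by (elim insertE; simp add: D0_def D1_def Hom_iff)
  moreover have "D1 (v \<cdot>\<^bsub>parallel_pair\<^esub> u) = D1 v \<cdot> D1 u"
    if uv: "u \<in> Arr parallel_pair" "v \<in> Arr parallel_pair"
      "Dom parallel_pair v = Cod parallel_pair u" for u v
  proof -
    from uv show ?thesis
      using fg AB by (cases rule: parallel_pair_composable) (simp_all add: parallel_pair_simps D1_def)
  qed
  moreover have "D0 i \<in> Obj C \<and> D1 (Id parallel_pair i) = Id C (D0 i)"
    if "i \<in> Obj parallel_pair" for i
    using that AB unfolding parallel_pair_simps by (elim insertE; simp add: D0_def D1_def)
  ultimately have "is_diagram parallel_pair C D0 D1"
    unfolding is_diagram_def by blast
  moreover have "finite (Obj parallel_pair)" "finite (Arr parallel_pair)"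
    by (simp_all add: parallel_pair_def)
  ultimately obtain P p where lim: "is_limit parallel_pair C D0 D1 P p"
    using assms(1) category_parallel_pair unfolding has_finite_limits_def by blast
  then have cone: "is_cone parallel_pair C D0 D1 P p"
    by (simp add: is_limit_def)
  then have p0: "p 0 \<in> Hom C P A" and p1: "f \<cdot> p 0 = p 1" "g \<cdot> p 0 = p 1"
    by (simp_all add: is_cone_def parallel_pair_def D0_def D1_def)
  have "\<exists>!k. k \<in> Hom C Q P \<and> p 0 \<cdot> k = h" if h: "h \<in> Hom C Q A" "f \<cdot> h = g \<cdot> h" for Q h
  proof -
    define q where "q i = (if i = 0 then h else f \<cdot> h)" for i :: nat
    have "h \<in> Arr C" "Dom C h = Q" "Cod C h = A"
      using h by (auto simp: Hom_iff)
    then have "is_cone parallel_pair C D0 D1 Q q"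
      using h(2) fg AB Dom_in_Obj
      by (auto simp: is_cone_def parallel_pair_def D0_def D1_def q_def Hom_iff)
    then have ex1: "\<exists>!k. k \<in> Hom C Q P \<and> (\<forall>i\<in>Obj parallel_pair. p i \<cdot> k = q i)"
      using lim by (simp add: is_limit_def)
    \<comment> \<open>The condition at vertex 1 follows from the one at vertex 0, since
      \<open>p 1 = f \<cdot> p 0\<close>.\<close>
    have "(\<forall>i\<in>Obj parallel_pair. p i \<cdot> k = q i) \<longleftrightarrow> p 0 \<cdot> k = h" if "k \<in> Hom C Q P" for k
    proof -
      have "p 1 \<cdot> k = f \<cdot> (p 0 \<cdot> k)"
        unfolding p1(1)[symmetric] using that p0 fg by (simp add: Hom_iff)
      then show ?thesis
        by (auto simp: parallel_pair_def q_def)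
    qed
    then have "(k \<in> Hom C Q P \<and> (\<forall>i\<in>Obj parallel_pair. p i \<cdot> k = q i)) \<longleftrightarrow>
        (k \<in> Hom C Q P \<and> p 0 \<cdot> k = h)" for k
      by blast
    then show ?thesis
      using ex1 by simp
  qed
  moreover have "Dom C (p 0) = P"
    using p0 by (simp add: Hom_iff)
  ultimately have "is_equalizer C f g (p 0)"
    using p0 p1 fg(3) by (simp add: is_equalizer_def)
  then show ?thesis ..
qed

end

section \<open>Closed symmetric monoidal categories\<close>

context closed_symmetric_monoidal_category
begin

declare Tensor_in_Obj [simp] Unit_in_Obj [simp] IHom_in_Obj [simp] TensorArr_Id [simp]

lemma TensorArr_arr [simp]:
  assumes "f \<in> Arr V" "g \<in> Arr V"
  shows "f \<otimes>\<^sub>a g \<in> Arr V" "Dom V (f \<otimes>\<^sub>a g) = Dom V f \<otimes> Dom V g"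
    "Cod V (f \<otimes>\<^sub>a g) = Cod V f \<otimes> Cod V g"
  using TensorArr_in_Hom[of f "Dom V f" "Cod V f" g "Dom V g" "Cod V g"] assms
  by (simp_all add: Hom_iff)

lemma interchange [simp]:
  assumes "f \<in> Arr V" "f' \<in> Arr V" "g \<in> Arr V" "g' \<in> Arr V"
    "Dom V f' = Cod V f" "Dom V g' = Cod V g"
  shows "(f' \<otimes>\<^sub>a g') \<cdot> (f \<otimes>\<^sub>a g) = (f' \<cdot> f) \<otimes>\<^sub>a (g' \<cdot> g)"
  using TensorArr_Comp[of f "Dom V f" "Cod V f" f' "Cod V f'" g "Dom V g" "Cod V g" g' "Cod V g'"]
    assms by (simp add: Hom_iff)

lemma interchange_Comp [simp]:
  assumes "f \<in> Arr V" "f' \<in> Arr V" "g \<in> Arr V" "g' \<in> Arr V"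
    "Dom V f' = Cod V f" "Dom V g' = Cod V g" "h \<in> Arr V" "Cod V h = Dom V f \<otimes> Dom V g"
  shows "(f' \<otimes>\<^sub>a g') \<cdot> ((f \<otimes>\<^sub>a g) \<cdot> h) = ((f' \<cdot> f) \<otimes>\<^sub>a (g' \<cdot> g)) \<cdot> h"
  using assms Comp_assoc_arr[of h "f \<otimes>\<^sub>a g" "f' \<otimes>\<^sub>a g'"] by simp

lemma unitor_arr [simp]:
  assumes "A \<in> Obj V"
  shows "LUnit V A \<in> Arr V" "Dom V (LUnit V A) = Unit V \<otimes> A" "Cod V (LUnit V A) = A"
    "RUnit V A \<in> Arr V" "Dom V (RUnit V A) = A \<otimes> Unit V" "Cod V (RUnit V A) = A"
  using LUnit_in_Hom[OF assms] RUnit_in_Hom[OF assms] by (simp_all add: Hom_iff)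

lemma Braid_Eval_arr [simp]:
  assumes "A \<in> Obj V" "B \<in> Obj V"
  shows "Braid V A B \<in> Arr V" "Dom V (Braid V A B) = A \<otimes> B" "Cod V (Braid V A B) = B \<otimes> A"
    "Eval V A B \<in> Arr V" "Dom V (Eval V A B) = IHom V A B \<otimes> A" "Cod V (Eval V A B) = B"
  using Braid_in_Hom[OF assms] Eval_in_Hom[OF assms] by (simp_all add: Hom_iff)

lemma Assoc_arr [simp]:
  assumes "A \<in> Obj V" "B \<in> Obj V" "D \<in> Obj V"
  shows "Assoc V A B D \<in> Arr V" "Dom V (Assoc V A B D) = (A \<otimes> B) \<otimes> D"
    "Cod V (Assoc V A B D) = A \<otimes> (B \<otimes> D)"
  using Assoc_in_Hom[OF assms] by (simp_all add: Hom_iff)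

lemma IHomArr_arr [simp]:
  assumes "f \<in> Arr V" "g \<in> Arr V"
  shows "IHomArr V f g \<in> Arr V" "Dom V (IHomArr V f g) = IHom V (Cod V f) (Dom V g)"
    "Cod V (IHomArr V f g) = IHom V (Dom V f) (Cod V g)"
  using IHomArr_in_Hom[of f "Dom V f" "Cod V f" g "Dom V g" "Cod V g"] assms
  by (simp_all add: Hom_iff)

lemma Assoc_natural_arr:
  assumes "f \<in> Arr V" "g \<in> Arr V" "h \<in> Arr V"
  shows "Assoc V (Cod V f) (Cod V g) (Cod V h) \<cdot> ((f \<otimes>\<^sub>a g) \<otimes>\<^sub>a h) =
    (f \<otimes>\<^sub>a (g \<otimes>\<^sub>a h)) \<cdot> Assoc V (Dom V f) (Dom V g) (Dom V h)"
  by (rule Assoc_natural) (use assms in \<open>simp_all add: Hom_iff\<close>)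

lemma iso_TensorArr:
  assumes "is_iso V f" "is_iso V g"
  shows "is_iso V (f \<otimes>\<^sub>a g)"
proof -
  from assms(1) obtain f' where "f \<in> Arr V" "f' \<in> Arr V" "Dom V f' = Cod V f"
    "Cod V f' = Dom V f" "f' \<cdot> f = Id V (Dom V f)" "f \<cdot> f' = Id V (Cod V f)"
    by (rule is_isoE)
  moreover from assms(2) obtain g' where "g \<in> Arr V" "g' \<in> Arr V" "Dom V g' = Cod V g"
    "Cod V g' = Dom V g" "g' \<cdot> g = Id V (Dom V g)" "g \<cdot> g' = Id V (Cod V g)"
    by (rule is_isoE)
  ultimately show ?thesis
    by (intro is_isoI[of _ "Dom V f \<otimes> Dom V g" "Cod V f \<otimes> Cod V g" "f' \<otimes>\<^sub>a g'"])
      (simp_all add: Hom_iff)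
qed

lemma iso_Id: "A \<in> Obj V \<Longrightarrow> is_iso V (Id V A)"
  by (rule is_isoI[of _ A A "Id V A"]) (simp_all add: Hom_iff)

text \<open>Naturality of the invertible \<open>LUnit\<close> conjugates
  \<open>Id V (Unit V) \<otimes>\<^sub>a f\<close> into \<open>f\<close>.\<close>

lemma Unit_tensor_faithful:
  assumes "f \<in> Hom V A B" "g \<in> Hom V A B" "Id V (Unit V) \<otimes>\<^sub>a f = Id V (Unit V) \<otimes>\<^sub>a g"
  shows "f = g"
proof -
  have eq: "f \<cdot> LUnit V A = g \<cdot> LUnit V A"
    using LUnit_natural[OF assms(1)] LUnit_natural[OF assms(2)] assms(3) by simp
  have "A \<in> Obj V"
    using assms(1) by (auto simp: Hom_iff)
  with assms(1,2) show ?thesis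
    by (intro iso_cancel_right[OF LUnit_iso[of A] _ _ _ _ eq]) (simp_all add: Hom_iff)
qed

text \<open>Kelly's argument: tensor with the unit on the left and compare the two sides through the
  pentagon and the triangle.\<close>

lemma LUnit_tensor:
  assumes A: "A \<in> Obj V" and B: "B \<in> Obj V"
  shows "LUnit V (A \<otimes> B) \<cdot> Assoc V (Unit V) A B = LUnit V A \<otimes>\<^sub>a Id V B"
proof -
  let ?I = "Unit V" and ?i = "Id V (Unit V)"
  \<comment> \<open>Precomposing with this invertible arrow completes one side of the pentagon on
    the unit, the unit, \<open>A\<close> and \<open>B\<close>; it is cancelled at the end.\<close>
  let ?e = "Assoc V ?I (?I \<otimes> A) B \<cdot> (Assoc V ?I ?I A \<otimes>\<^sub>a Id V B)"
  have iso: "is_iso V ?e"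
    using A B by (intro iso_Comp iso_TensorArr Assoc_iso iso_Id) simp_all
  have "(?i \<otimes>\<^sub>a (LUnit V (A \<otimes> B) \<cdot> Assoc V ?I A B)) \<cdot> ?e
      = (?i \<otimes>\<^sub>a LUnit V (A \<otimes> B)) \<cdot> ((?i \<otimes>\<^sub>a Assoc V ?I A B) \<cdot> ?e)"
    using A B by simp
  also have "\<dots> = (?i \<otimes>\<^sub>a LUnit V (A \<otimes> B)) \<cdot> (Assoc V ?I ?I (A \<otimes> B) \<cdot> Assoc V (?I \<otimes> ?I) A B)"
    by (subst pentagon) (use A B in simp_all)
  also have "\<dots> = ((?i \<otimes>\<^sub>a LUnit V (A \<otimes> B)) \<cdot> Assoc V ?I ?I (A \<otimes> B)) \<cdot> Assoc V (?I \<otimes> ?I) A B"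
    using A B by (intro Comp_assoc_arr[symmetric]) simp_all
  also have "\<dots> = (RUnit V ?I \<otimes>\<^sub>a (Id V A \<otimes>\<^sub>a Id V B)) \<cdot> Assoc V (?I \<otimes> ?I) A B"
    using A B by (simp only: triangle Tensor_in_Obj TensorArr_Id Unit_in_Obj)
  also have "\<dots> = Assoc V ?I A B \<cdot> ((RUnit V ?I \<otimes>\<^sub>a Id V A) \<otimes>\<^sub>a Id V B)"
    using Assoc_natural_arr[of "RUnit V ?I" "Id V A" "Id V B"] A B by simp
  also have "\<dots> = Assoc V ?I A B \<cdot> (((?i \<otimes>\<^sub>a LUnit V A) \<otimes>\<^sub>a Id V B) \<cdot> (Assoc V ?I ?I A \<otimes>\<^sub>a Id V B))"
    by (subst triangle[symmetric]) (use A B in simp_all)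
  also have "\<dots> = (Assoc V ?I A B \<cdot> ((?i \<otimes>\<^sub>a LUnit V A) \<otimes>\<^sub>a Id V B)) \<cdot> (Assoc V ?I ?I A \<otimes>\<^sub>a Id V B)"
    using A B by (intro Comp_assoc_arr[symmetric]) simp_all
  also have "\<dots> = (?i \<otimes>\<^sub>a (LUnit V A \<otimes>\<^sub>a Id V B)) \<cdot> ?e"
    using Assoc_natural_arr[of ?i "LUnit V A" "Id V B"] A B by simp
  finally have eq: "(?i \<otimes>\<^sub>a (LUnit V (A \<otimes> B) \<cdot> Assoc V ?I A B)) \<cdot> ?e =
      (?i \<otimes>\<^sub>a (LUnit V A \<otimes>\<^sub>a Id V B)) \<cdot> ?e" .
  have eq': "?i \<otimes>\<^sub>a (LUnit V (A \<otimes> B) \<cdot> Assoc V ?I A B) = ?i \<otimes>\<^sub>a (LUnit V A \<otimes>\<^sub>a Id V B)"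
    by (rule iso_cancel_right[OF iso _ _ _ _ eq]) (use A B in simp_all)
  show ?thesis
    by (rule Unit_tensor_faithful[OF _ _ eq', where A = "(?I \<otimes> A) \<otimes> B" and B = "A \<otimes> B"])
      (use A B in \<open>simp_all add: Hom_iff\<close>)
qed

section \<open>Transposition and functoriality of the internal hom\<close>

lemma curry_arr_ex:
  assumes "A \<in> Obj V" "B \<in> Obj V" "f \<in> Arr V" "Dom V f = A \<otimes> B"
  shows "curry_arr V A B f \<in> Hom V A (IHom V B (Cod V f)) \<and>
    Eval V B (Cod V f) \<cdot> (curry_arr V A B f \<otimes>\<^sub>a Id V B) = f"
  unfolding curry_arr_def
  by (rule theI', rule closed) (use assms in \<open>simp_all add: Hom_iff\<close>)

lemma curry_arr_arr [simp]:
  assumes "A \<in> Obj V" "B \<in> Obj V" "f \<in> Arr V" "Dom V f = A \<otimes> B"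
  shows "curry_arr V A B f \<in> Arr V" "Dom V (curry_arr V A B f) = A"
    "Cod V (curry_arr V A B f) = IHom V B (Cod V f)"
  using curry_arr_ex[OF assms] by (simp_all add: Hom_iff)

lemma Eval_curry_arr:
  assumes "A \<in> Obj V" "B \<in> Obj V" "f \<in> Arr V" "Dom V f = A \<otimes> B" "Cod V f = D"
  shows "Eval V B D \<cdot> (curry_arr V A B f \<otimes>\<^sub>a Id V B) = f"
  using curry_arr_ex[OF assms(1-4)] assms(5) by simp

text \<open>The uniqueness half of closedness. It is the extensionality principle by which equations
  between arrows into internal homs are reduced to equations through \<open>Eval\<close>.\<close>

lemma IHom_eqI:
  assumes "h \<in> Arr V" "k \<in> Arr V" "Dom V h = Dom V k" "Cod V h = IHom V B D" "Cod V k = IHom V B D"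
    "B \<in> Obj V" "D \<in> Obj V"
    "Eval V B D \<cdot> (h \<otimes>\<^sub>a Id V B) = Eval V B D \<cdot> (k \<otimes>\<^sub>a Id V B)"
  shows "h = k"
proof -
  let ?f = "Eval V B D \<cdot> (k \<otimes>\<^sub>a Id V B)"
  have "?f \<in> Hom V (Dom V k \<otimes> B) D"
    using assms(2,5-7) by (simp add: Hom_iff)
  with closed[of "Dom V k" B ?f D] assms(2,6)
  have "\<exists>!h. h \<in> Hom V (Dom V k) (IHom V B D) \<and> Eval V B D \<cdot> (h \<otimes>\<^sub>a Id V B) = ?f"
    by simp
  moreover have "h \<in> Hom V (Dom V k) (IHom V B D)" "k \<in> Hom V (Dom V k) (IHom V B D)"
    using assms(1-5) by (simp_all add: Hom_iff)
  ultimately show ?thesis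
    using assms(8) by blast
qed

lemma Eval_IHomArr_arr:
  assumes "f \<in> Arr V" "g \<in> Arr V"
  shows "Eval V (Dom V f) (Cod V g) \<cdot> (IHomArr V f g \<otimes>\<^sub>a Id V (Dom V f)) =
    g \<cdot> (Eval V (Cod V f) (Dom V g) \<cdot> (Id V (IHom V (Cod V f) (Dom V g)) \<otimes>\<^sub>a f))"
  by (rule Eval_IHomArr) (use assms in \<open>simp_all add: Hom_iff\<close>)

text \<open>The defining equation of \<open>IHomArr\<close> in the form that occurs after
  \<open>IHom_eqI\<close>: a further arrow \<open>h\<close> stands inside the tensor, and
  \<open>A'\<close>, \<open>B'\<close> are variables so that the left side matches before
  \<open>Dom\<close> and \<open>Cod\<close> are computed.\<close>

lemma Eval_IHomArr_Comp:
  assumes "f \<in> Arr V" "g \<in> Arr V" "h \<in> Arr V" "Cod V h = IHom V (Cod V f) (Dom V g)"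
    "A' = Dom V f" "B' = Cod V g"
  shows "Eval V A' B' \<cdot> ((IHomArr V f g \<cdot> h) \<otimes>\<^sub>a Id V A') =
    g \<cdot> (Eval V (Cod V f) (Dom V g) \<cdot> (h \<otimes>\<^sub>a f))"
proof -
  have "Eval V A' B' \<cdot> ((IHomArr V f g \<cdot> h) \<otimes>\<^sub>a Id V A') =
      (Eval V A' B' \<cdot> (IHomArr V f g \<otimes>\<^sub>a Id V A')) \<cdot> (h \<otimes>\<^sub>a Id V A')"
    using assms by simp
  also have "\<dots> = (g \<cdot> (Eval V (Cod V f) (Dom V g) \<cdot> (Id V (IHom V (Cod V f) (Dom V g)) \<otimes>\<^sub>a f)))
      \<cdot> (h \<otimes>\<^sub>a Id V A')"
    using assms Eval_IHomArr_arr by simp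
  also have "\<dots> = g \<cdot> (Eval V (Cod V f) (Dom V g) \<cdot> (h \<otimes>\<^sub>a f))"
    using assms by simp
  finally show ?thesis .
qed

text \<open>Functoriality of the internal hom is not among the axioms; it follows from the defining
  equation of \<open>IHomArr\<close>, used once for each factor.\<close>

lemma IHomArr_Comp:
  assumes "f \<in> Arr V" "f' \<in> Arr V" "g \<in> Arr V" "g' \<in> Arr V" "Dom V f' = Cod V f" "Dom V g = Cod V g'"
  shows "IHomArr V f g \<cdot> IHomArr V f' g' = IHomArr V (f' \<cdot> f) (g \<cdot> g')"
proof (rule IHom_eqI[of _ _ "Dom V f" "Cod V g"])
  \<comment> \<open>Interchange slides \<open>f\<close> to the right of
    \<open>IHomArr V f' g'\<close>, which exposes the defining equation of the latter.\<close>
  have "Eval V (Dom V f') (Cod V g') \<cdot> (IHomArr V f' g' \<otimes>\<^sub>a f) =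
     (Eval V (Dom V f') (Cod V g') \<cdot> (IHomArr V f' g' \<otimes>\<^sub>a Id V (Dom V f')))
       \<cdot> (Id V (Dom V (IHomArr V f' g')) \<otimes>\<^sub>a f)"
    using assms by simp
  also have "\<dots> = g' \<cdot> (Eval V (Cod V f') (Dom V g') \<cdot>
      (Id V (IHom V (Cod V f') (Dom V g')) \<otimes>\<^sub>a (f' \<cdot> f)))"
    by (subst Eval_IHomArr_arr) (use assms in simp_all)
  finally have *: "Eval V (Dom V f') (Cod V g') \<cdot> (IHomArr V f' g' \<otimes>\<^sub>a f) =
    g' \<cdot> (Eval V (Cod V f') (Dom V g') \<cdot> (Id V (IHom V (Cod V f') (Dom V g')) \<otimes>\<^sub>a (f' \<cdot> f)))" .
  have "Eval V (Dom V f) (Cod V g) \<cdot> ((IHomArr V f g \<cdot> IHomArr V f' g') \<otimes>\<^sub>a Id V (Dom V f)) =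
     g \<cdot> (Eval V (Cod V f) (Dom V g) \<cdot> (IHomArr V f' g' \<otimes>\<^sub>a f))"
    using assms by (intro Eval_IHomArr_Comp) simp_all
  also have "\<dots> = (g \<cdot> g') \<cdot> (Eval V (Cod V f') (Dom V g') \<cdot>
      (Id V (IHom V (Cod V f') (Dom V g')) \<otimes>\<^sub>a (f' \<cdot> f)))"
    using assms * by simp
  also have "\<dots> = Eval V (Dom V f) (Cod V g) \<cdot> (IHomArr V (f' \<cdot> f) (g \<cdot> g') \<otimes>\<^sub>a Id V (Dom V f))"
    using assms Eval_IHomArr_arr[of "f' \<cdot> f" "g \<cdot> g'"] by simp
  finally show "Eval V (Dom V f) (Cod V g) \<cdot> ((IHomArr V f g \<cdot> IHomArr V f' g') \<otimes>\<^sub>a Id V (Dom V f)) =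
    Eval V (Dom V f) (Cod V g) \<cdot> (IHomArr V (f' \<cdot> f) (g \<cdot> g') \<otimes>\<^sub>a Id V (Dom V f))" .
qed (use assms in simp_all)

lemma IHomArr_Id [simp]:
  assumes "A \<in> Obj V" "B \<in> Obj V"
  shows "IHomArr V (Id V A) (Id V B) = Id V (IHom V A B)"
  by (rule IHom_eqI[of _ _ A B]) (use assms Eval_IHomArr_arr[of "Id V A" "Id V B"] in simp_all)

lemma curry_arr_Comp:
  assumes "A \<in> Obj V" "B \<in> Obj V" "f \<in> Arr V" "Dom V f = A \<otimes> B" "h \<in> Arr V" "Cod V h = A"
  shows "curry_arr V A B f \<cdot> h = curry_arr V (Dom V h) B (f \<cdot> (h \<otimes>\<^sub>a Id V B))"
proof (rule IHom_eqI[of _ _ B "Cod V f"])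
  have "Eval V B (Cod V f) \<cdot> ((curry_arr V A B f \<cdot> h) \<otimes>\<^sub>a Id V B) =
      (Eval V B (Cod V f) \<cdot> (curry_arr V A B f \<otimes>\<^sub>a Id V B)) \<cdot> (h \<otimes>\<^sub>a Id V B)"
    using assms by simp
  then show "Eval V B (Cod V f) \<cdot> ((curry_arr V A B f \<cdot> h) \<otimes>\<^sub>a Id V B) =
      Eval V B (Cod V f) \<cdot> (curry_arr V (Dom V h) B (f \<cdot> (h \<otimes>\<^sub>a Id V B)) \<otimes>\<^sub>a Id V B)"
    using assms by (simp add: Eval_curry_arr del: Comp_assoc_arr)
qed (use assms in simp_all)

text \<open>Naturality of transposition in the codomain and in the evaluated argument at once;
  \<open>curry_arr_Comp\<close> is its naturality in the remaining variable.\<close>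

lemma IHomArr_curry_arr:
  assumes "A \<in> Obj V" "B \<in> Obj V" "f \<in> Arr V" "Dom V f = A \<otimes> B"
    "g \<in> Arr V" "Dom V g = Cod V f" "k \<in> Arr V" "Cod V k = B"
  shows "IHomArr V k g \<cdot> curry_arr V A B f =
    curry_arr V A (Dom V k) (g \<cdot> (f \<cdot> (Id V A \<otimes>\<^sub>a k)))"
proof (rule IHom_eqI[of _ _ "Dom V k" "Cod V g"])
  have "Eval V B (Cod V f) \<cdot> (curry_arr V A B f \<otimes>\<^sub>a k) =
      (Eval V B (Cod V f) \<cdot> (curry_arr V A B f \<otimes>\<^sub>a Id V B)) \<cdot> (Id V A \<otimes>\<^sub>a k)"
    using assms by simp
  also have "\<dots> = f \<cdot> (Id V A \<otimes>\<^sub>a k)"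
    using assms by (simp add: Eval_curry_arr del: Comp_assoc_arr)
  finally show "Eval V (Dom V k) (Cod V g) \<cdot> ((IHomArr V k g \<cdot> curry_arr V A B f) \<otimes>\<^sub>a Id V (Dom V k)) =
      Eval V (Dom V k) (Cod V g) \<cdot>
        (curry_arr V A (Dom V k) (g \<cdot> (f \<cdot> (Id V A \<otimes>\<^sub>a k))) \<otimes>\<^sub>a Id V (Dom V k))"
    using assms by (simp add: Eval_curry_arr Eval_IHomArr_Comp)
qed (use assms in simp_all)

end

section \<open>The self-enrichment\<close>

lemma self_simps [simp]:
  "Obj (self V) = Obj V" "Arr (self V) = Arr V" "Dom (self V) = Dom V" "Cod (self V) = Cod V"
  "Id (self V) = Id V" "Comp (self V) = Comp V" "EHom (self V) = IHom V" "Hom (self V) A B = Hom V A B"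
  by (simp_all add: self_def Hom_def)

context closed_symmetric_monoidal_category
begin

lemma EComp_self_arr [simp]:
  assumes "A \<in> Obj V" "B \<in> Obj V" "D \<in> Obj V"
  shows "EComp (self V) A B D \<in> Arr V" "Dom V (EComp (self V) A B D) = IHom V B D \<otimes> IHom V A B"
    "Cod V (EComp (self V) A B D) = IHom V A D"
  using assms by (simp_all add: self_def)

lemma Eval_EComp_self:
  assumes "A \<in> Obj V" "B \<in> Obj V" "D \<in> Obj V"
  shows "Eval V A D \<cdot> (EComp (self V) A B D \<otimes>\<^sub>a Id V A) =
    Eval V B D \<cdot> ((Id V (IHom V B D) \<otimes>\<^sub>a Eval V A B) \<cdot> Assoc V (IHom V B D) (IHom V A B) A)"
  using assms by (simp add: self_def Eval_curry_arr)

text \<open>Internal composition on generalized elements \<open>u\<close>, \<open>v\<close>,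
  \<open>k\<close>: evaluate \<open>v\<close> at \<open>k\<close>, then \<open>u\<close> at the
  result. Stating it for arbitrary arrows spares a naturality argument for \<open>Assoc\<close> in
  every application.\<close>

lemma Eval_EComp_self_Comp:
  assumes "A \<in> Obj V" "B \<in> Obj V" "D \<in> Obj V" "u \<in> Arr V" "v \<in> Arr V" "k \<in> Arr V"
    "Cod V u = IHom V B D" "Cod V v = IHom V A B" "Cod V k = A"
  shows "Eval V A D \<cdot> ((EComp (self V) A B D \<cdot> (u \<otimes>\<^sub>a v)) \<otimes>\<^sub>a k) =
    Eval V B D \<cdot> ((u \<otimes>\<^sub>a (Eval V A B \<cdot> (v \<otimes>\<^sub>a k))) \<cdot> Assoc V (Dom V u) (Dom V v) (Dom V k))"
proof -
  have "Eval V A D \<cdot> ((EComp (self V) A B D \<cdot> (u \<otimes>\<^sub>a v)) \<otimes>\<^sub>a k) =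
      (Eval V A D \<cdot> (EComp (self V) A B D \<otimes>\<^sub>a Id V A)) \<cdot> ((u \<otimes>\<^sub>a v) \<otimes>\<^sub>a k)"
    using assms by simp
  also have "\<dots> = Eval V B D \<cdot> ((Id V (IHom V B D) \<otimes>\<^sub>a Eval V A B)
      \<cdot> (Assoc V (Cod V u) (Cod V v) (Cod V k) \<cdot> ((u \<otimes>\<^sub>a v) \<otimes>\<^sub>a k)))"
    unfolding Eval_EComp_self[OF assms(1-3)] using assms by simp
  also have "\<dots> = Eval V B D \<cdot> ((u \<otimes>\<^sub>a (Eval V A B \<cdot> (v \<otimes>\<^sub>a k)))
      \<cdot> Assoc V (Dom V u) (Dom V v) (Dom V k))"
    unfolding Assoc_natural_arr[OF assms(4-6)] using assms by simp
  finally show ?thesis .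
qed

section \<open>Arrows as elements of internal homs\<close>

lemma Name_self_arr [simp]:
  assumes "f \<in> Arr V"
  shows "Name (self V) f \<in> Arr V" "Dom V (Name (self V) f) = Unit V"
    "Cod V (Name (self V) f) = IHom V (Dom V f) (Cod V f)"
  using assms by (simp_all add: self_def)

lemma Eval_Name_self:
  assumes "f \<in> Arr V" "Dom V f = A" "Cod V f = B"
  shows "Eval V A B \<cdot> (Name (self V) f \<otimes>\<^sub>a Id V A) = f \<cdot> LUnit V A"
proof -
  have "A \<in> Obj V"
    using assms by auto
  with assms show ?thesis
    by (simp add: self_def Eval_curry_arr)
qed

lemma Name_self_inject:
  assumes "f \<in> Hom V A B" "g \<in> Hom V A B" "Name (self V) f = Name (self V) g"
  shows "f = g"
proof (rule iso_cancel_right[OF LUnit_iso[of A]])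
  show "f \<cdot> LUnit V A = g \<cdot> LUnit V A"
    using Eval_Name_self[of f A B] Eval_Name_self[of g A B] assms by (simp add: Hom_iff)
qed (use assms in \<open>auto simp: Hom_iff\<close>)

lemma Name_self_surj:
  assumes "h \<in> Hom V (Unit V) (IHom V A B)" and A: "A \<in> Obj V" and B: "B \<in> Obj V"
  obtains f where "f \<in> Hom V A B" "Name (self V) f = h"
proof
  have h: "h \<in> Arr V" "Dom V h = Unit V" "Cod V h = IHom V A B"
    using assms(1) by (simp_all add: Hom_iff)
  have l: "inverse_arr V (LUnit V A) \<in> Arr V" "Dom V (inverse_arr V (LUnit V A)) = A"
    "Cod V (inverse_arr V (LUnit V A)) = Unit V \<otimes> A"
    "inverse_arr V (LUnit V A) \<cdot> LUnit V A = Id V (Unit V \<otimes> A)"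
    using inverse_arr_simps[OF LUnit_iso[OF A]] A by simp_all
  \<comment> \<open>The map named by \<open>h\<close>: insert a unit before the argument, apply
    \<open>h\<close> to it, and evaluate.\<close>
  let ?f = "Eval V A B \<cdot> ((h \<otimes>\<^sub>a Id V A) \<cdot> inverse_arr V (LUnit V A))"
  show f: "?f \<in> Hom V A B"
    using h l A B by (simp add: Hom_iff)
  show "Name (self V) ?f = h"
  proof (rule IHom_eqI[of _ _ A B])
    show "Eval V A B \<cdot> (Name (self V) ?f \<otimes>\<^sub>a Id V A) = Eval V A B \<cdot> (h \<otimes>\<^sub>a Id V A)"
      by (subst Eval_Name_self) (use h l A B in simp_all)
  qed (use h l A B in simp_all)
qed

text \<open>The action of \<open>IHomArr\<close> on elements. Applying an enriched equation to a
  name turns it, by this rule, into an equation of ordinary arrows.\<close>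

lemma IHomArr_Name_self:
  assumes "f \<in> Arr V" "g \<in> Arr V" "k \<in> Arr V" "Dom V g = Cod V f" "Cod V k = Dom V f"
  shows "IHomArr V k g \<cdot> Name (self V) f = Name (self V) (g \<cdot> (f \<cdot> k))"
proof -
  have "LUnit V (Dom V f) \<cdot> (Id V (Unit V) \<otimes>\<^sub>a k) = k \<cdot> LUnit V (Dom V k)"
    by (rule LUnit_natural) (use assms in \<open>simp add: Hom_iff\<close>)
  then show ?thesis
    using assms IHomArr_curry_arr[of "Unit V" "Dom V f" "f \<cdot> LUnit V (Dom V f)" g k]
    by (simp add: self_def)
qed

text \<open>\<open>ehom_post\<close> inserts a unit, fills it with the name of \<open>g\<close> and
  composes. After evaluation that unit stands to the left of a whole tensor product, which is why
  \<open>LUnit_tensor\<close> is required.\<close>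

lemma ehom_post_self:
  assumes A: "A \<in> Obj V" and g: "g \<in> Arr V"
  shows "ehom_post V (self V) A g = IHomArr V (Id V A) g"
proof (rule IHom_eqI[of _ _ A "Cod V g"])
  let ?B = "Dom V g" and ?D = "Cod V g"
  let ?l = "inverse_arr V (LUnit V (IHom V A ?B))"
  have l: "?l \<in> Arr V" "Dom V ?l = IHom V A ?B" "Cod V ?l = Unit V \<otimes> IHom V A ?B"
    "LUnit V (IHom V A ?B) \<cdot> ?l = Id V (IHom V A ?B)"
    using inverse_arr_simps[OF LUnit_iso[of "IHom V A ?B"]] A g by simp_all
  let ?n = "Name (self V) g" and ?i = "Id V (IHom V A ?B)"
  have "Eval V A ?D \<cdot> (ehom_post V (self V) A g \<otimes>\<^sub>a Id V A) =
      (Eval V A ?D \<cdot> ((EComp (self V) A ?B ?D \<cdot> (?n \<otimes>\<^sub>a ?i)) \<otimes>\<^sub>a Id V A)) \<cdot> (?l \<otimes>\<^sub>a Id V A)"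
    using A g l(1-3) by (simp add: ehom_post_def)
  also have "\<dots> = (Eval V ?B ?D \<cdot> (?n \<otimes>\<^sub>a Id V ?B)) \<cdot>
      ((Id V (Unit V) \<otimes>\<^sub>a Eval V A ?B) \<cdot> (Assoc V (Unit V) (IHom V A ?B) A \<cdot> (?l \<otimes>\<^sub>a Id V A)))"
    by (subst Eval_EComp_self_Comp) (use A g l(1-3) in simp_all)
  also have "\<dots> = (g \<cdot> LUnit V ?B) \<cdot>
      ((Id V (Unit V) \<otimes>\<^sub>a Eval V A ?B) \<cdot> (Assoc V (Unit V) (IHom V A ?B) A \<cdot> (?l \<otimes>\<^sub>a Id V A)))"
    by (subst Eval_Name_self) (use A g l(1-3) in simp_all)
  also have "\<dots> = g \<cdot> ((LUnit V ?B \<cdot> (Id V (Unit V) \<otimes>\<^sub>a Eval V A ?B)) \<cdot>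
      (Assoc V (Unit V) (IHom V A ?B) A \<cdot> (?l \<otimes>\<^sub>a Id V A)))"
    using A g l(1-3) by simp
  also have "LUnit V ?B \<cdot> (Id V (Unit V) \<otimes>\<^sub>a Eval V A ?B) = Eval V A ?B \<cdot> LUnit V (IHom V A ?B \<otimes> A)"
    by (rule LUnit_natural) (use A g in \<open>simp add: Hom_iff\<close>)
  also have "g \<cdot> ((Eval V A ?B \<cdot> LUnit V (IHom V A ?B \<otimes> A)) \<cdot>
      (Assoc V (Unit V) (IHom V A ?B) A \<cdot> (?l \<otimes>\<^sub>a Id V A))) =
      g \<cdot> (Eval V A ?B \<cdot> ((LUnit V (IHom V A ?B \<otimes> A) \<cdot> Assoc V (Unit V) (IHom V A ?B) A)
      \<cdot> (?l \<otimes>\<^sub>a Id V A)))"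
    using A g l(1-3) by simp
  also have "\<dots> = g \<cdot> Eval V A ?B"
    by (subst LUnit_tensor) (use A g l in simp_all)
  also have "\<dots> = Eval V A ?D \<cdot> (IHomArr V (Id V A) g \<otimes>\<^sub>a Id V A)"
    using Eval_IHomArr_arr[of "Id V A" g] A g by simp
  finally show "Eval V A ?D \<cdot> (ehom_post V (self V) A g \<otimes>\<^sub>a Id V A) =
      Eval V A ?D \<cdot> (IHomArr V (Id V A) g \<otimes>\<^sub>a Id V A)" .
qed (use A g inverse_arr_simps[OF LUnit_iso[of "IHom V A (Dom V g)"]]
    in \<open>simp_all add: ehom_post_def\<close>)

text \<open>Here the inserted unit stands between the internal hom and the argument, so the triangle
  axiom removes it.\<close>

lemma ehom_pre_self:
  assumes f: "f \<in> Arr V" and D: "D \<in> Obj V"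
  shows "ehom_pre V (self V) f D = IHomArr V f (Id V D)"
proof (rule IHom_eqI[of _ _ "Dom V f" D])
  let ?A = "Dom V f" and ?B = "Cod V f" and ?I = "Unit V"
  let ?H = "IHom V ?B D"
  let ?r = "inverse_arr V (RUnit V ?H)"
  have r: "?r \<in> Arr V" "Dom V ?r = ?H" "Cod V ?r = ?H \<otimes> ?I" "RUnit V ?H \<cdot> ?r = Id V ?H"
    using inverse_arr_simps[OF RUnit_iso[of ?H]] f D by simp_all
  let ?n = "Name (self V) f"
  have "Eval V ?A D \<cdot> (ehom_pre V (self V) f D \<otimes>\<^sub>a Id V ?A) =
      (Eval V ?A D \<cdot> ((EComp (self V) ?A ?B D \<cdot> (Id V ?H \<otimes>\<^sub>a ?n)) \<otimes>\<^sub>a Id V ?A)) \<cdot> (?r \<otimes>\<^sub>a Id V ?A)"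
    using f D r(1-3) by (simp add: ehom_pre_def)
  also have "\<dots> = Eval V ?B D \<cdot>
      ((Id V ?H \<otimes>\<^sub>a (Eval V ?A ?B \<cdot> (?n \<otimes>\<^sub>a Id V ?A))) \<cdot> (Assoc V ?H ?I ?A \<cdot> (?r \<otimes>\<^sub>a Id V ?A)))"
    by (subst Eval_EComp_self_Comp) (use f D r(1-3) in simp_all)
  also have "\<dots> = Eval V ?B D \<cdot>
      ((Id V ?H \<otimes>\<^sub>a (f \<cdot> LUnit V ?A)) \<cdot> (Assoc V ?H ?I ?A \<cdot> (?r \<otimes>\<^sub>a Id V ?A)))"
    using Eval_Name_self[OF f refl refl] by simp
  also have "\<dots> = Eval V ?B D \<cdot> ((Id V ?H \<otimes>\<^sub>a f) \<cdot>
      (((Id V ?H \<otimes>\<^sub>a LUnit V ?A) \<cdot> Assoc V ?H ?I ?A) \<cdot> (?r \<otimes>\<^sub>a Id V ?A)))"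
    using f D r(1-3) by simp
  also have "\<dots> = Eval V ?B D \<cdot> (Id V ?H \<otimes>\<^sub>a f)"
    by (subst triangle) (use f D r in simp_all)
  also have "\<dots> = Eval V ?A D \<cdot> (IHomArr V f (Id V D) \<otimes>\<^sub>a Id V ?A)"
    using Eval_IHomArr_arr[of f "Id V D"] f D by simp
  finally show "Eval V ?A D \<cdot> (ehom_pre V (self V) f D \<otimes>\<^sub>a Id V ?A) =
      Eval V ?A D \<cdot> (IHomArr V f (Id V D) \<otimes>\<^sub>a Id V ?A)" .
qed (use f D inverse_arr_simps[OF RUnit_iso[of "IHom V (Cod V f) D"]]
    in \<open>simp_all add: ehom_pre_def\<close>)

section \<open>Naturality of internal composition in its three objects\<close>

lemma EComp_self_post:
  assumes "A \<in> Obj V" "B \<in> Obj V" "g \<in> Arr V" "Dom V g = D" "Cod V g = D'"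
  shows "IHomArr V (Id V A) g \<cdot> EComp (self V) A B D =
    EComp (self V) A B D' \<cdot> (IHomArr V (Id V B) g \<otimes>\<^sub>a Id V (IHom V A B))"
proof (rule IHom_eqI[of _ _ A D'])
  have D: "D \<in> Obj V" "D' \<in> Obj V"
    using assms by auto
  have "Eval V B D' \<cdot> (IHomArr V (Id V B) g \<otimes>\<^sub>a Eval V A B) =
      (Eval V B D' \<cdot> (IHomArr V (Id V B) g \<otimes>\<^sub>a Id V B)) \<cdot> (Id V (IHom V B D) \<otimes>\<^sub>a Eval V A B)"
    using assms D by simp
  also have "\<dots> = g \<cdot> (Eval V B D \<cdot> (Id V (IHom V B D) \<otimes>\<^sub>a Eval V A B))"
    using Eval_IHomArr_arr[of "Id V B" g] assms D by simp
  finally have *: "Eval V B D' \<cdot> (IHomArr V (Id V B) g \<otimes>\<^sub>a Eval V A B) =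
      g \<cdot> (Eval V B D \<cdot> (Id V (IHom V B D) \<otimes>\<^sub>a Eval V A B))" .
  let ?a = "Assoc V (IHom V B D) (IHom V A B) A"
  have "Eval V A D' \<cdot> ((EComp (self V) A B D' \<cdot> (IHomArr V (Id V B) g \<otimes>\<^sub>a Id V (IHom V A B))) \<otimes>\<^sub>a Id V A)
      = (Eval V B D' \<cdot> (IHomArr V (Id V B) g \<otimes>\<^sub>a Eval V A B)) \<cdot> ?a"
    by (subst Eval_EComp_self_Comp) (use assms D in simp_all)
  also have "\<dots> = g \<cdot> (Eval V B D \<cdot> ((Id V (IHom V B D) \<otimes>\<^sub>a Eval V A B) \<cdot> ?a))"
    unfolding * using assms D by simp
  also have "\<dots> = Eval V A D' \<cdot> ((IHomArr V (Id V A) g \<cdot> EComp (self V) A B D) \<otimes>\<^sub>a Id V A)"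
    using assms D by (simp add: Eval_IHomArr_Comp Eval_EComp_self)
  finally show "Eval V A D' \<cdot> ((IHomArr V (Id V A) g \<cdot> EComp (self V) A B D) \<otimes>\<^sub>a Id V A) =
    Eval V A D' \<cdot> ((EComp (self V) A B D' \<cdot> (IHomArr V (Id V B) g \<otimes>\<^sub>a Id V (IHom V A B))) \<otimes>\<^sub>a Id V A)" ..
qed (use assms in auto)

lemma EComp_self_pre:
  assumes "D \<in> Obj V" "B \<in> Obj V" "f \<in> Arr V" "Dom V f = A'" "Cod V f = A"
  shows "IHomArr V f (Id V D) \<cdot> EComp (self V) A B D =
    EComp (self V) A' B D \<cdot> (Id V (IHom V B D) \<otimes>\<^sub>a IHomArr V f (Id V B))"
proof (rule IHom_eqI[of _ _ A' D])
  have A: "A \<in> Obj V" "A' \<in> Obj V"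
    using assms by auto
  have "Eval V A' D \<cdot> ((IHomArr V f (Id V D) \<cdot> EComp (self V) A B D) \<otimes>\<^sub>a Id V A') =
      Eval V A D \<cdot> ((EComp (self V) A B D \<cdot> (Id V (IHom V B D) \<otimes>\<^sub>a Id V (IHom V A B))) \<otimes>\<^sub>a f)"
    using assms A by (simp add: Eval_IHomArr_Comp)
  also have "\<dots> = Eval V B D \<cdot> ((Id V (IHom V B D) \<otimes>\<^sub>a (Eval V A B \<cdot> (Id V (IHom V A B) \<otimes>\<^sub>a f)))
      \<cdot> Assoc V (IHom V B D) (IHom V A B) A')"
    by (subst Eval_EComp_self_Comp) (use assms A in simp_all)
  also have "Eval V A B \<cdot> (Id V (IHom V A B) \<otimes>\<^sub>a f) =
      Eval V A' B \<cdot> (IHomArr V f (Id V B) \<otimes>\<^sub>a Id V A')"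
    using Eval_IHomArr_arr[of f "Id V B"] assms A by simp
  also have "Eval V B D \<cdot> ((Id V (IHom V B D) \<otimes>\<^sub>a (Eval V A' B \<cdot> (IHomArr V f (Id V B) \<otimes>\<^sub>a Id V A')))
      \<cdot> Assoc V (IHom V B D) (IHom V A B) A') =
      Eval V A' D \<cdot> ((EComp (self V) A' B D \<cdot> (Id V (IHom V B D) \<otimes>\<^sub>a IHomArr V f (Id V B))) \<otimes>\<^sub>a Id V A')"
    by (subst Eval_EComp_self_Comp) (use assms A in simp_all)
  finally show "Eval V A' D \<cdot> ((IHomArr V f (Id V D) \<cdot> EComp (self V) A B D) \<otimes>\<^sub>a Id V A') =
    Eval V A' D \<cdot> ((EComp (self V) A' B D \<cdot> (Id V (IHom V B D) \<otimes>\<^sub>a IHomArr V f (Id V B))) \<otimes>\<^sub>a Id V A')" .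
qed (use assms in auto)

text \<open>Internal form of \<open>(h \<cdot> f) \<cdot> k = h \<cdot> (f \<cdot> k)\<close>: a
  fixed middle arrow \<open>f\<close> may be absorbed on either side.\<close>

lemma EComp_self_extranatural:
  assumes "A \<in> Obj V" "D \<in> Obj V" "f \<in> Arr V" "Dom V f = B" "Cod V f = B'"
  shows "EComp (self V) A B D \<cdot> (IHomArr V f (Id V D) \<otimes>\<^sub>a Id V (IHom V A B)) =
    EComp (self V) A B' D \<cdot> (Id V (IHom V B' D) \<otimes>\<^sub>a IHomArr V (Id V A) f)"
proof (rule IHom_eqI[of _ _ A D])
  have B: "B \<in> Obj V" "B' \<in> Obj V"
    using assms by auto
  let ?a = "Assoc V (IHom V B' D) (IHom V A B) A"
  have "Eval V A D \<cdot> ((EComp (self V) A B D \<cdot> (IHomArr V f (Id V D) \<otimes>\<^sub>a Id V (IHom V A B))) \<otimes>\<^sub>a Id V A)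
      = (Eval V B D \<cdot> (IHomArr V f (Id V D) \<otimes>\<^sub>a Id V B)) \<cdot> ((Id V (IHom V B' D) \<otimes>\<^sub>a Eval V A B) \<cdot> ?a)"
    by (subst Eval_EComp_self_Comp) (use assms B in simp_all)
  also have "Eval V B D \<cdot> (IHomArr V f (Id V D) \<otimes>\<^sub>a Id V B) =
      Eval V B' D \<cdot> (Id V (IHom V B' D) \<otimes>\<^sub>a f)"
    using Eval_IHomArr_arr[of f "Id V D"] assms B by simp
  also have "(Eval V B' D \<cdot> (Id V (IHom V B' D) \<otimes>\<^sub>a f)) \<cdot> ((Id V (IHom V B' D) \<otimes>\<^sub>a Eval V A B) \<cdot> ?a)
      = Eval V B' D \<cdot> ((Id V (IHom V B' D) \<otimes>\<^sub>a (f \<cdot> Eval V A B)) \<cdot> ?a)"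
    using assms B by simp
  also have "f \<cdot> Eval V A B = Eval V A B' \<cdot> (IHomArr V (Id V A) f \<otimes>\<^sub>a Id V A)"
    using Eval_IHomArr_arr[of "Id V A" f] assms B by simp
  also have "Eval V B' D \<cdot>
      ((Id V (IHom V B' D) \<otimes>\<^sub>a (Eval V A B' \<cdot> (IHomArr V (Id V A) f \<otimes>\<^sub>a Id V A))) \<cdot> ?a) =
      Eval V A D \<cdot> ((EComp (self V) A B' D \<cdot> (Id V (IHom V B' D) \<otimes>\<^sub>a IHomArr V (Id V A) f)) \<otimes>\<^sub>a Id V A)"
    by (subst Eval_EComp_self_Comp) (use assms B in simp_all)
  finally show "Eval V A D \<cdot>
      ((EComp (self V) A B D \<cdot> (IHomArr V f (Id V D) \<otimes>\<^sub>a Id V (IHom V A B))) \<otimes>\<^sub>a Id V A) =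
    Eval V A D \<cdot>
      ((EComp (self V) A B' D \<cdot> (Id V (IHom V B' D) \<otimes>\<^sub>a IHomArr V (Id V A) f)) \<otimes>\<^sub>a Id V A)" .
qed (use assms in auto)

end

section \<open>Enriched functors and monads\<close>

context closed_symmetric_monoidal_category
begin

lemma inverse_LUnit_natural:
  assumes "f \<in> Arr V"
  shows "inverse_arr V (LUnit V (Cod V f)) \<cdot> f =
    (Id V (Unit V) \<otimes>\<^sub>a f) \<cdot> inverse_arr V (LUnit V (Dom V f))"
proof -
  let ?l = "LUnit V (Dom V f)" and ?l' = "LUnit V (Cod V f)"
  note [simp] = inverse_arr_simps[OF LUnit_iso[of "Dom V f"]] inverse_arr_simps[OF LUnit_iso[of "Cod V f"]]
  have "?l' \<cdot> (Id V (Unit V) \<otimes>\<^sub>a f) = f \<cdot> ?l"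
    by (rule LUnit_natural) (use assms in \<open>simp add: Hom_iff\<close>)
  then have "?l' \<cdot> ((Id V (Unit V) \<otimes>\<^sub>a f) \<cdot> inverse_arr V ?l) = (f \<cdot> ?l) \<cdot> inverse_arr V ?l"
    using assms Comp_assoc_arr[of "inverse_arr V ?l" "Id V (Unit V) \<otimes>\<^sub>a f" ?l'] by simp
  also have "\<dots> = (?l' \<cdot> inverse_arr V ?l') \<cdot> f"
    using assms by (subst Comp_assoc_arr) simp_all
  also have "\<dots> = ?l' \<cdot> (inverse_arr V ?l' \<cdot> f)"
    using assms by (intro Comp_assoc_arr) simp_all
  finally have eq: "?l' \<cdot> (inverse_arr V ?l' \<cdot> f) = ?l' \<cdot> ((Id V (Unit V) \<otimes>\<^sub>a f) \<cdot> inverse_arr V ?l)" ..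
  show ?thesis
    by (rule iso_cancel_left[OF LUnit_iso _ _ _ _ eq]) (use assms in simp_all)
qed

lemma inverse_RUnit_natural:
  assumes "f \<in> Arr V"
  shows "inverse_arr V (RUnit V (Cod V f)) \<cdot> f =
    (f \<otimes>\<^sub>a Id V (Unit V)) \<cdot> inverse_arr V (RUnit V (Dom V f))"
proof -
  let ?l = "RUnit V (Dom V f)" and ?l' = "RUnit V (Cod V f)"
  note [simp] = inverse_arr_simps[OF RUnit_iso[of "Dom V f"]] inverse_arr_simps[OF RUnit_iso[of "Cod V f"]]
  have "?l' \<cdot> (f \<otimes>\<^sub>a Id V (Unit V)) = f \<cdot> ?l"
    by (rule RUnit_natural) (use assms in \<open>simp add: Hom_iff\<close>)
  then have "?l' \<cdot> ((f \<otimes>\<^sub>a Id V (Unit V)) \<cdot> inverse_arr V ?l) = (f \<cdot> ?l) \<cdot> inverse_arr V ?l"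
    using assms Comp_assoc_arr[of "inverse_arr V ?l" "f \<otimes>\<^sub>a Id V (Unit V)" ?l'] by simp
  also have "\<dots> = (?l' \<cdot> inverse_arr V ?l') \<cdot> f"
    using assms by (subst Comp_assoc_arr) simp_all
  also have "\<dots> = ?l' \<cdot> (inverse_arr V ?l' \<cdot> f)"
    using assms by (intro Comp_assoc_arr) simp_all
  finally have eq: "?l' \<cdot> (inverse_arr V ?l' \<cdot> f) = ?l' \<cdot> ((f \<otimes>\<^sub>a Id V (Unit V)) \<cdot> inverse_arr V ?l)" ..
  show ?thesis
    by (rule iso_cancel_left[OF RUnit_iso _ _ _ _ eq]) (use assms in simp_all)
qed

text \<open>If \<open>h\<close> carries the composition \<open>c\<close> to the composition \<open>c'\<close>, then it carries composition with
  the element \<open>n\<close> to composition with \<open>s \<cdot> n\<close>; stated without reference to functors so that it applies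
  to \<open>FHom\<close> and to the inclusions \<open>EM_incl\<close> alike.\<close>

lemma post_transfer:
  assumes "c \<in> Hom V (S \<otimes> P) Q" "c' \<in> Hom V (S' \<otimes> P') Q'" "h \<in> Hom V Q Q'" "s \<in> Hom V S S'"
    "p \<in> Hom V P P'" "n \<in> Hom V (Unit V) S" "h \<cdot> c = c' \<cdot> (s \<otimes>\<^sub>a p)"
  shows "h \<cdot> (c \<cdot> ((n \<otimes>\<^sub>a Id V P) \<cdot> inverse_arr V (LUnit V P))) =
    (c' \<cdot> (((s \<cdot> n) \<otimes>\<^sub>a Id V P') \<cdot> inverse_arr V (LUnit V P'))) \<cdot> p"
proof -
  have a: "c \<in> Arr V" "Dom V c = S \<otimes> P" "Cod V c = Q" "c' \<in> Arr V" "Dom V c' = S' \<otimes> P'"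
    "Cod V c' = Q'" "h \<in> Arr V" "Dom V h = Q" "Cod V h = Q'" "s \<in> Arr V" "Dom V s = S" "Cod V s = S'"
    "p \<in> Arr V" "Dom V p = P" "Cod V p = P'" "n \<in> Arr V" "Dom V n = Unit V" "Cod V n = S"
    using assms(1-6) by (auto simp: Hom_iff)
  have o: "P \<in> Obj V" "P' \<in> Obj V"
    using Hom_obj[OF assms(5)] by simp_all
  note [simp] = a o inverse_arr_simps[OF LUnit_iso[of P]] inverse_arr_simps[OF LUnit_iso[of P']]
  have "h \<cdot> (c \<cdot> ((n \<otimes>\<^sub>a Id V P) \<cdot> inverse_arr V (LUnit V P))) =
      (h \<cdot> c) \<cdot> ((n \<otimes>\<^sub>a Id V P) \<cdot> inverse_arr V (LUnit V P))"
    by simp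
  also have "\<dots> = c' \<cdot> (((s \<cdot> n) \<otimes>\<^sub>a p) \<cdot> inverse_arr V (LUnit V P))"
    unfolding assms(7) by simp
  also have "\<dots> = c' \<cdot> (((s \<cdot> n) \<otimes>\<^sub>a Id V P') \<cdot> (inverse_arr V (LUnit V P') \<cdot> p))"
    using inverse_LUnit_natural[of p] by simp
  also have "\<dots> = (c' \<cdot> (((s \<cdot> n) \<otimes>\<^sub>a Id V P') \<cdot> inverse_arr V (LUnit V P'))) \<cdot> p"
    by simp
  finally show ?thesis .
qed

text \<open>The mirror image of \<open>post_transfer\<close>, with the right unitor in place of the
  left one.\<close>

lemma pre_transfer:
  assumes "c \<in> Hom V (P \<otimes> S) Q" "c' \<in> Hom V (P' \<otimes> S') Q'" "h \<in> Hom V Q Q'" "s \<in> Hom V S S'"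
    "p \<in> Hom V P P'" "n \<in> Hom V (Unit V) S" "h \<cdot> c = c' \<cdot> (p \<otimes>\<^sub>a s)"
  shows "h \<cdot> (c \<cdot> ((Id V P \<otimes>\<^sub>a n) \<cdot> inverse_arr V (RUnit V P))) =
    (c' \<cdot> ((Id V P' \<otimes>\<^sub>a (s \<cdot> n)) \<cdot> inverse_arr V (RUnit V P'))) \<cdot> p"
proof -
  have a: "c \<in> Arr V" "Dom V c = P \<otimes> S" "Cod V c = Q" "c' \<in> Arr V" "Dom V c' = P' \<otimes> S'"
    "Cod V c' = Q'" "h \<in> Arr V" "Dom V h = Q" "Cod V h = Q'" "s \<in> Arr V" "Dom V s = S" "Cod V s = S'"
    "p \<in> Arr V" "Dom V p = P" "Cod V p = P'" "n \<in> Arr V" "Dom V n = Unit V" "Cod V n = S"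
    using assms(1-6) by (auto simp: Hom_iff)
  have o: "P \<in> Obj V" "P' \<in> Obj V"
    using Hom_obj[OF assms(5)] by simp_all
  note [simp] = a o inverse_arr_simps[OF RUnit_iso[of P]] inverse_arr_simps[OF RUnit_iso[of P']]
  have "h \<cdot> (c \<cdot> ((Id V P \<otimes>\<^sub>a n) \<cdot> inverse_arr V (RUnit V P))) =
      (h \<cdot> c) \<cdot> ((Id V P \<otimes>\<^sub>a n) \<cdot> inverse_arr V (RUnit V P))"
    by simp
  also have "\<dots> = c' \<cdot> ((p \<otimes>\<^sub>a (s \<cdot> n)) \<cdot> inverse_arr V (RUnit V P))"
    unfolding assms(7) by simp
  also have "\<dots> = c' \<cdot> ((Id V P' \<otimes>\<^sub>a (s \<cdot> n)) \<cdot> (inverse_arr V (RUnit V P') \<cdot> p))"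
    using inverse_RUnit_natural[of p] by simp
  also have "\<dots> = (c' \<cdot> ((Id V P' \<otimes>\<^sub>a (s \<cdot> n)) \<cdot> inverse_arr V (RUnit V P'))) \<cdot> p"
    by simp
  finally show ?thesis .
qed

lemma enriched_natural_self:
  assumes "enriched_natural V (self V) (self V) F K \<alpha>" "X \<in> Obj V" "Y \<in> Obj V"
  shows "\<alpha> X \<in> Hom V (FOb F X) (FOb K X)"
    "IHomArr V (Id V (FOb F X)) (\<alpha> Y) \<cdot> FHom F X Y = IHomArr V (\<alpha> X) (Id V (FOb K Y)) \<cdot> FHom K X Y"
proof -
  show a: "\<alpha> X \<in> Hom V (FOb F X) (FOb K X)"
    using assms by (simp add: enriched_natural_def)
  have b: "\<alpha> Y \<in> Hom V (FOb F Y) (FOb K Y)"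
    using assms by (simp add: enriched_natural_def)
  have ob: "FOb F X \<in> Obj V" "FOb K Y \<in> Obj V"
    using Hom_obj[OF a] Hom_obj[OF b] by simp_all
  have "ehom_post V (self V) (FOb F X) (\<alpha> Y) \<cdot> FHom F X Y =
      ehom_pre V (self V) (\<alpha> X) (FOb K Y) \<cdot> FHom K X Y"
    using assms by (simp add: enriched_natural_def)
  then show "IHomArr V (Id V (FOb F X)) (\<alpha> Y) \<cdot> FHom F X Y =
      IHomArr V (\<alpha> X) (Id V (FOb K Y)) \<cdot> FHom K X Y"
    using a b ob by (simp add: ehom_post_self ehom_pre_self Hom_iff)
qed

text \<open>Ordinary naturality is enriched naturality applied to the name of \<open>f\<close>. The
  images \<open>f'\<close> and \<open>k'\<close> are described by their names instead of by
  \<open>FArr\<close>, so that composite and identity functors are covered without computing their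
  action on arrows first.\<close>

lemma enriched_natural_Name:
  assumes nat: "enriched_natural V (self V) (self V) F K \<alpha>" and f: "f \<in> Hom V X Y"
    and F: "FHom F X Y \<in> Hom V (IHom V X Y) (IHom V (FOb F X) (FOb F Y))"
      "f' \<in> Hom V (FOb F X) (FOb F Y)" "Name (self V) f' = FHom F X Y \<cdot> Name (self V) f"
    and K: "FHom K X Y \<in> Hom V (IHom V X Y) (IHom V (FOb K X) (FOb K Y))"
      "k' \<in> Hom V (FOb K X) (FOb K Y)" "Name (self V) k' = FHom K X Y \<cdot> Name (self V) f"
  shows "\<alpha> Y \<cdot> f' = k' \<cdot> \<alpha> X"
proof (rule Name_self_inject)
  have XY: "X \<in> Obj V" "Y \<in> Obj V"
    using Hom_obj[OF f] by simp_all
  note \<alpha>X = enriched_natural_self[OF nat XY] and \<alpha>Y = enriched_natural_self(1)[OF nat XY(2) XY(1)]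
  have ob: "FOb F X \<in> Obj V" "FOb F Y \<in> Obj V" "FOb K X \<in> Obj V" "FOb K Y \<in> Obj V"
    using Hom_obj[OF \<alpha>X(1)] Hom_obj[OF \<alpha>Y] by simp_all
  show "\<alpha> Y \<cdot> f' \<in> Hom V (FOb F X) (FOb K Y)" "k' \<cdot> \<alpha> X \<in> Hom V (FOb F X) (FOb K Y)"
    using \<alpha>X(1) \<alpha>Y F(2) K(2) by (simp_all add: Hom_iff)
  have "Name (self V) (\<alpha> Y \<cdot> f') = IHomArr V (Id V (FOb F X)) (\<alpha> Y) \<cdot> Name (self V) f'"
    using \<alpha>Y F(2) ob by (subst IHomArr_Name_self) (simp_all add: Hom_iff)
  also have "\<dots> = (IHomArr V (Id V (FOb F X)) (\<alpha> Y) \<cdot> FHom F X Y) \<cdot> Name (self V) f"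
    unfolding F(3) using \<alpha>Y F(1) ob f by (simp add: Hom_iff)
  also have "\<dots> = IHomArr V (\<alpha> X) (Id V (FOb K Y)) \<cdot> Name (self V) k'"
    unfolding \<alpha>X(2) K(3) using \<alpha>X(1) K(1) ob f by (simp add: Hom_iff)
  also have "\<dots> = Name (self V) (k' \<cdot> \<alpha> X)"
    using \<alpha>X(1) K(2) ob by (subst IHomArr_Name_self) (simp_all add: Hom_iff)
  finally show "Name (self V) (\<alpha> Y \<cdot> f') = Name (self V) (k' \<cdot> \<alpha> X)" .
qed

end

section \<open>Enriched endofunctors of the base category\<close>

locale self_functor = closed_symmetric_monoidal_category V + F: enriched_functor V "self V" "self V" F
  for V :: "('o, 'm) closed_monoidal" (structure) and F :: "('o, 'o, 'm) enriched_functor"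
begin

abbreviation map :: "'m \<Rightarrow> 'm" where
  "map \<equiv> FArr V (self V) (self V) F"

lemma FOb_obj [simp]: "X \<in> Obj V \<Longrightarrow> FOb F X \<in> Obj V"
  using F.FOb_in_Obj by simp

lemma FHom_arr [simp]:
  assumes "X \<in> Obj V" "Y \<in> Obj V"
  shows "FHom F X Y \<in> Arr V" "Dom V (FHom F X Y) = IHom V X Y"
    "Cod V (FHom F X Y) = IHom V (FOb F X) (FOb F Y)"
  using F.FHom_in_Hom[of X Y] assms by (simp_all add: Hom_iff)

text \<open>\<open>FArr\<close> is a definite description; \<open>Name_self_surj\<close> provides an
  arrow with the required name and \<open>Name_self_inject\<close> its uniqueness.\<close>

lemma map_ex:
  assumes "f \<in> Arr V"
  shows "map f \<in> Hom V (FOb F (Dom V f)) (FOb F (Cod V f)) \<and>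
    Name (self V) (map f) = FHom F (Dom V f) (Cod V f) \<cdot> Name (self V) f"
proof -
  let ?X = "Dom V f" and ?Y = "Cod V f"
  have "FHom F ?X ?Y \<cdot> Name (self V) f \<in> Hom V (Unit V) (IHom V (FOb F ?X) (FOb F ?Y))"
    using assms by (simp add: Hom_iff)
  then obtain g where g: "g \<in> Hom V (FOb F ?X) (FOb F ?Y)"
      "Name (self V) g = FHom F ?X ?Y \<cdot> Name (self V) f"
    using assms by (elim Name_self_surj) simp_all
  show ?thesis
    unfolding FArr_def self_simps by (rule theI[of _ g]) (use g in \<open>auto intro: Name_self_inject\<close>)
qed

lemma map_arr [simp]:
  assumes "f \<in> Arr V"
  shows "map f \<in> Arr V" "Dom V (map f) = FOb F (Dom V f)" "Cod V (map f) = FOb F (Cod V f)"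
  using map_ex[OF assms] by (simp_all add: Hom_iff)

lemma Name_map:
  "f \<in> Arr V \<Longrightarrow> Name (self V) (map f) = FHom F (Dom V f) (Cod V f) \<cdot> Name (self V) f"
  using map_ex by simp

text \<open>Preservation of composition with one factor fixed to the name of \<open>g\<close>, via
  \<open>post_transfer\<close>. Since the transfer is stated with unitors, \<open>IHomArr\<close> is
  folded back into \<open>ehom_post\<close> to meet it.\<close>

lemma FHom_IHomArr_post:
  assumes X: "X \<in> Obj V" and g: "g \<in> Arr V" "Dom V g = Y" "Cod V g = Z"
  shows "FHom F X Z \<cdot> IHomArr V (Id V X) g = IHomArr V (Id V (FOb F X)) (map g) \<cdot> FHom F X Y"
proof -
  have YZ: "Y \<in> Obj V" "Z \<in> Obj V"
    using g by auto
  have *: "FHom F X Z \<cdot> EComp (self V) X Y Z =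
      EComp (self V) (FOb F X) (FOb F Y) (FOb F Z) \<cdot> (FHom F Y Z \<otimes>\<^sub>a FHom F X Y)"
    by (rule F.FHom_Comp) (use X YZ in simp_all)
  let ?c = "EComp (self V) X Y Z" and ?c' = "EComp (self V) (FOb F X) (FOb F Y) (FOb F Z)"
  let ?P = "IHom V X Y" and ?P' = "IHom V (FOb F X) (FOb F Y)"
  have "FHom F X Z \<cdot> (?c \<cdot> ((Name (self V) g \<otimes>\<^sub>a Id V ?P) \<cdot> inverse_arr V (LUnit V ?P))) =
      (?c' \<cdot> (((FHom F Y Z \<cdot> Name (self V) g) \<otimes>\<^sub>a Id V ?P') \<cdot> inverse_arr V (LUnit V ?P'))) \<cdot> FHom F X Y"
    by (rule post_transfer[where S = "IHom V Y Z" and S' = "IHom V (FOb F Y) (FOb F Z)"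
          and Q = "IHom V X Z" and Q' = "IHom V (FOb F X) (FOb F Z)", OF _ _ _ _ _ _ *])
      (use X g YZ in \<open>simp_all add: Hom_iff\<close>)
  then show ?thesis
    using X g YZ Name_map[of g]
    by (simp add: ehom_post_def flip: ehom_post_self)
qed

lemma FHom_IHomArr_pre:
  assumes Z: "Z \<in> Obj V" and f: "f \<in> Arr V" "Dom V f = X" "Cod V f = Y"
  shows "FHom F X Z \<cdot> IHomArr V f (Id V Z) = IHomArr V (map f) (Id V (FOb F Z)) \<cdot> FHom F Y Z"
proof -
  have XY: "X \<in> Obj V" "Y \<in> Obj V"
    using f by auto
  have *: "FHom F X Z \<cdot> EComp (self V) X Y Z =
      EComp (self V) (FOb F X) (FOb F Y) (FOb F Z) \<cdot> (FHom F Y Z \<otimes>\<^sub>a FHom F X Y)"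
    by (rule F.FHom_Comp) (use Z XY in simp_all)
  let ?c = "EComp (self V) X Y Z" and ?c' = "EComp (self V) (FOb F X) (FOb F Y) (FOb F Z)"
  let ?P = "IHom V Y Z" and ?P' = "IHom V (FOb F Y) (FOb F Z)"
  have "FHom F X Z \<cdot> (?c \<cdot> ((Id V ?P \<otimes>\<^sub>a Name (self V) f) \<cdot> inverse_arr V (RUnit V ?P))) =
      (?c' \<cdot> ((Id V ?P' \<otimes>\<^sub>a (FHom F X Y \<cdot> Name (self V) f)) \<cdot> inverse_arr V (RUnit V ?P'))) \<cdot> FHom F Y Z"
    by (rule pre_transfer[where S = "IHom V X Y" and S' = "IHom V (FOb F X) (FOb F Y)"
          and Q = "IHom V X Z" and Q' = "IHom V (FOb F X) (FOb F Z)", OF _ _ _ _ _ _ *])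
      (use Z f XY in \<open>simp_all add: Hom_iff\<close>)
  then show ?thesis
    using Z f XY Name_map[of f]
    by (simp add: ehom_pre_def flip: ehom_pre_self)
qed

lemma map_Comp:
  assumes "f \<in> Arr V" "g \<in> Arr V" "Dom V g = Cod V f"
  shows "map (g \<cdot> f) = map g \<cdot> map f"
proof (rule Name_self_inject)
  let ?X = "Dom V f"
  have "Name (self V) (map (g \<cdot> f)) = FHom F ?X (Cod V g) \<cdot> (IHomArr V (Id V ?X) g \<cdot> Name (self V) f)"
    using assms by (simp add: Name_map IHomArr_Name_self)
  also have "\<dots> = (FHom F ?X (Cod V g) \<cdot> IHomArr V (Id V ?X) g) \<cdot> Name (self V) f"
    using assms by simp
  also have "\<dots> = IHomArr V (Id V (FOb F ?X)) (map g) \<cdot> (FHom F ?X (Cod V f) \<cdot> Name (self V) f)"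
    by (subst FHom_IHomArr_post[where Y = "Cod V f"]) (use assms in simp_all)
  also have "\<dots> = Name (self V) (map g \<cdot> map f)"
    using assms by (simp add: IHomArr_Name_self flip: Name_map)
  finally show "Name (self V) (map (g \<cdot> f)) = Name (self V) (map g \<cdot> map f)" .
qed (use assms in \<open>simp_all add: Hom_iff\<close>)

lemma map_Id [simp]:
  assumes "X \<in> Obj V"
  shows "map (Id V X) = Id V (FOb F X)"
  by (rule Name_self_inject) (use assms F.FHom_Id[of X] in \<open>simp_all add: Hom_iff Name_map\<close>)

end

section \<open>Enriched monads on the base category\<close>

locale self_monad = closed_symmetric_monoidal_category V + T: enriched_monad V "self V" T
  for V :: "('o, 'm) closed_monoidal" (structure) and T :: "('o, 'm) self_monad"
begin

sublocale self_functor V "MFun T"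
  by (rule self_functor.intro[OF closed_symmetric_monoidal_category_axioms T.MFun_functor])

lemma MUnit_arr [simp]:
  assumes "X \<in> Obj V"
  shows "MUnit T X \<in> Arr V" "Dom V (MUnit T X) = X" "Cod V (MUnit T X) = MOb T X"
  using enriched_natural_self(1)[OF T.unit_natural assms assms] by (simp_all add: Hom_iff id_functor_def)

lemma MMult_arr [simp]:
  assumes "X \<in> Obj V"
  shows "MMult T X \<in> Arr V" "Dom V (MMult T X) = MOb T (MOb T X)" "Cod V (MMult T X) = MOb T X"
  using enriched_natural_self(1)[OF T.mult_natural assms assms] by (simp_all add: Hom_iff comp_functor_def)

lemma MUnit_enriched:
  assumes "X \<in> Obj V" "Y \<in> Obj V"
  shows "IHomArr V (MUnit T X) (Id V (MOb T Y)) \<cdot> FHom (MFun T) X Y = IHomArr V (Id V X) (MUnit T Y)"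
  using enriched_natural_self(2)[OF T.unit_natural assms] assms by (simp add: id_functor_def)

lemma MMult_enriched:
  assumes "X \<in> Obj V" "Y \<in> Obj V"
  shows "IHomArr V (MMult T X) (Id V (MOb T Y)) \<cdot> FHom (MFun T) X Y =
    IHomArr V (Id V (MOb T (MOb T X))) (MMult T Y) \<cdot>
      (FHom (MFun T) (MOb T X) (MOb T Y) \<cdot> FHom (MFun T) X Y)"
  using enriched_natural_self(2)[OF T.mult_natural assms] by (simp add: comp_functor_def)

lemma MUnit_natural:
  assumes "f \<in> Arr V" "Dom V f = X" "Cod V f = Y"
  shows "MUnit T Y \<cdot> f = map f \<cdot> MUnit T X"
proof -
  have "X \<in> Obj V" "Y \<in> Obj V"
    using assms by auto
  then show ?thesis
    using assms
    by (intro enriched_natural_Name[OF T.unit_natural]) (simp_all add: Hom_iff id_functor_def Name_map)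
qed

lemma MMult_natural:
  assumes "f \<in> Arr V" "Dom V f = X" "Cod V f = Y"
  shows "MMult T Y \<cdot> map (map f) = map f \<cdot> MMult T X"
proof -
  have "X \<in> Obj V" "Y \<in> Obj V"
    using assms by auto
  then show ?thesis
    using assms
    by (intro enriched_natural_Name[OF T.mult_natural]) (simp_all add: Hom_iff comp_functor_def Name_map)
qed

lemma left_unit: "X \<in> Obj V \<Longrightarrow> MMult T X \<cdot> MUnit T (MOb T X) = Id V (MOb T X)"
  and right_unit: "X \<in> Obj V \<Longrightarrow> MMult T X \<cdot> map (MUnit T X) = Id V (MOb T X)"
  and mult_assoc: "X \<in> Obj V \<Longrightarrow> MMult T X \<cdot> MMult T (MOb T X) = MMult T X \<cdot> map (MMult T X)"
  using T.left_unit T.right_unit T.mult_assoc by simp_all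

lemma is_algebra_iff:
  "is_algebra V T A \<longleftrightarrow> fst A \<in> Obj V \<and> snd A \<in> Hom V (MOb T (fst A)) (fst A) \<and>
     snd A \<cdot> MUnit T (fst A) = Id V (fst A) \<and>
     snd A \<cdot> MMult T (fst A) = snd A \<cdot> map (snd A)"
  by (simp add: is_algebra_def case_prod_beta)

lemma is_algebra_free: "X \<in> Obj V \<Longrightarrow> is_algebra V T (free_alg V T X)"
  by (simp add: is_algebra_iff free_alg_def Hom_iff left_unit mult_assoc)

end

section \<open>The Eilenberg-Moore category\<close>

lemma EM_cat_simps [simp]:
  "Dom (EM_cat V T) f = fst f" "Cod (EM_cat V T) f = snd (snd f)"
  "Id (EM_cat V T) A = (A, Id V (fst A), A)"
  "Comp (EM_cat V T) g f = (fst f, und g \<cdot>\<^bsub>V\<^esub> und f, snd (snd g))"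
  "Obj (EM_cat V T) = {A. is_algebra V T A}"
  by (simp_all add: EM_cat_def case_prod_beta)

lemma EM_simps [simp]:
  "Obj (EM V T) = {A. is_algebra V T A}" "Arr (EM V T) = Arr (EM_cat V T)"
  "Dom (EM V T) f = fst f" "Cod (EM V T) f = snd (snd f)" "Id (EM V T) A = (A, Id V (fst A), A)"
  "EHom (EM V T) = EM_hom V T" "Hom (EM V T) A B = Hom (EM_cat V T) A B"
  by (simp_all add: EM_def Hom_def)

locale Eilenberg_Moore = self_monad V T
  for V :: "('o, 'm) closed_monoidal" (structure) and T :: "('o, 'm) self_monad" +
  assumes finite_limits: "has_finite_limits V"
begin

lemma algebra_arr [simp]:
  assumes "is_algebra V T A"
  shows "fst A \<in> Obj V" "snd A \<in> Arr V" "Dom V (snd A) = MOb T (fst A)" "Cod V (snd A) = fst A"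
  using assms by (simp_all add: is_algebra_iff Hom_iff)

lemma EM_cat_Arr_iff:
  "f \<in> Arr (EM_cat V T) \<longleftrightarrow> is_algebra V T (fst f) \<and> is_algebra V T (snd (snd f)) \<and>
    und f \<in> Hom V (fst (fst f)) (fst (snd (snd f))) \<and>
    und f \<cdot> snd (fst f) = snd (snd (snd f)) \<cdot> map (und f)"
  by (simp add: EM_cat_def case_prod_beta)

lemma EM_arr_simps [simp]:
  assumes "f \<in> Arr (EM_cat V T)"
  shows "is_algebra V T (fst f)" "is_algebra V T (snd (snd f))" "und f \<in> Arr V"
    "Dom V (und f) = fst (fst f)" "Cod V (und f) = fst (snd (snd f))"
  using assms by (simp_all add: EM_cat_Arr_iff Hom_iff)

lemma Comp_linear:
  assumes "(A, f, B) \<in> Arr (EM_cat V T)" "(B, g, D) \<in> Arr (EM_cat V T)"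
  shows "(A, g \<cdot> f, D) \<in> Arr (EM_cat V T)"
proof -
  note [simp] = EM_arr_simps[OF assms(1), simplified] EM_arr_simps[OF assms(2), simplified]
  have f: "f \<cdot> snd A = snd B \<cdot> map f" and g: "g \<cdot> snd B = snd D \<cdot> map g"
    using assms by (simp_all add: EM_cat_Arr_iff)
  have "(g \<cdot> f) \<cdot> snd A = (g \<cdot> snd B) \<cdot> map f"
    using f by simp
  also have "\<dots> = snd D \<cdot> map (g \<cdot> f)"
    unfolding g by (simp add: map_Comp)
  finally show ?thesis
    by (simp add: EM_cat_Arr_iff Hom_iff)
qed

lemma Id_linear: "is_algebra V T A \<Longrightarrow> (A, Id V (fst A), A) \<in> Arr (EM_cat V T)"
  by (simp add: EM_cat_Arr_iff Hom_iff)

section \<open>Hom-objects of linear maps as equalizers\<close>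

lemma incl_equalizer:
  assumes "is_algebra V T A" "is_algebra V T B"
  shows "is_equalizer V (IHomArr V (snd A) (Id V (fst B)))
    (IHomArr V (Id V (MOb T (fst A))) (snd B) \<cdot> FHom (MFun T) (fst A) (fst B)) (EM_incl V T A B)"
  unfolding EM_incl_def
  by (rule someI_ex, rule has_equalizer[OF finite_limits,
        of _ "IHom V (fst A) (fst B)" "IHom V (MOb T (fst A)) (fst B)"])
    (use assms in \<open>simp_all add: Hom_iff\<close>)

lemma incl_arr [simp]:
  assumes "is_algebra V T A" "is_algebra V T B"
  shows "EM_incl V T A B \<in> Arr V" "Cod V (EM_incl V T A B) = IHom V (fst A) (fst B)"
  using incl_equalizer[OF assms] assms by (simp_all add: is_equalizer_def Hom_iff)

lemma incl_equalizes:
  assumes "is_algebra V T A" "is_algebra V T B"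
  shows "IHomArr V (snd A) (Id V (fst B)) \<cdot> EM_incl V T A B =
    IHomArr V (Id V (MOb T (fst A))) (snd B) \<cdot> (FHom (MFun T) (fst A) (fst B) \<cdot> EM_incl V T A B)"
  using incl_equalizer[OF assms] assms by (simp add: is_equalizer_def Hom_iff)

lemma incl_factor:
  assumes "is_algebra V T A" "is_algebra V T B" "h \<in> Arr V" "Cod V h = IHom V (fst A) (fst B)"
    "IHomArr V (snd A) (Id V (fst B)) \<cdot> h =
      IHomArr V (Id V (MOb T (fst A))) (snd B) \<cdot> (FHom (MFun T) (fst A) (fst B) \<cdot> h)"
  shows "\<exists>!k. k \<in> Hom V (Dom V h) (EM_hom V T A B) \<and> EM_incl V T A B \<cdot> k = h"
proof -
  have univ: "\<forall>g\<in>Hom V (Dom V h) (Dom V (IHomArr V (snd A) (Id V (fst B)))).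
      IHomArr V (snd A) (Id V (fst B)) \<cdot> g =
      (IHomArr V (Id V (MOb T (fst A))) (snd B) \<cdot> FHom (MFun T) (fst A) (fst B)) \<cdot> g \<longrightarrow>
      (\<exists>!k. k \<in> Hom V (Dom V h) (EM_hom V T A B) \<and> EM_incl V T A B \<cdot> k = g)"
    using incl_equalizer[OF assms(1,2)] unfolding is_equalizer_def
    by (elim conjE) (erule spec)
  have "h \<in> Hom V (Dom V h) (Dom V (IHomArr V (snd A) (Id V (fst B))))"
    "IHomArr V (snd A) (Id V (fst B)) \<cdot> h =
      (IHomArr V (Id V (MOb T (fst A))) (snd B) \<cdot> FHom (MFun T) (fst A) (fst B)) \<cdot> h"
    using assms by (simp_all add: Hom_iff)
  then show ?thesis
    by (rule univ[THEN bspec, THEN mp])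
qed

text \<open>An equalizer is monic: the composite with the inclusion still satisfies the equalizing
  condition, so the uniqueness part of \<open>incl_factor\<close> applies to both
  factorizations.\<close>

lemma incl_cancel:
  assumes "is_algebra V T A" "is_algebra V T B"
    "h \<in> Hom V Q (EM_hom V T A B)" "k \<in> Hom V Q (EM_hom V T A B)"
    "EM_incl V T A B \<cdot> h = EM_incl V T A B \<cdot> k"
  shows "h = k"
proof -
  have h: "h \<in> Arr V" "Dom V h = Q" "Cod V h = EM_hom V T A B"
    using assms(3) by (simp_all add: Hom_iff)
  have "IHomArr V (snd A) (Id V (fst B)) \<cdot> (EM_incl V T A B \<cdot> h) =
      (IHomArr V (snd A) (Id V (fst B)) \<cdot> EM_incl V T A B) \<cdot> h"
    using assms(1,2) h by simp
  also have "\<dots> = IHomArr V (Id V (MOb T (fst A))) (snd B) \<cdot>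
      (FHom (MFun T) (fst A) (fst B) \<cdot> (EM_incl V T A B \<cdot> h))"
    unfolding incl_equalizes[OF assms(1,2)] using assms(1,2) h by simp
  finally have "\<exists>!k. k \<in> Hom V (Dom V (EM_incl V T A B \<cdot> h)) (EM_hom V T A B) \<and>
      EM_incl V T A B \<cdot> k = EM_incl V T A B \<cdot> h"
    using assms(1,2) h by (intro incl_factor) simp_all
  then have "\<exists>!k. k \<in> Hom V Q (EM_hom V T A B) \<and> EM_incl V T A B \<cdot> k = EM_incl V T A B \<cdot> h"
    using assms(1,2) h by simp
  then show ?thesis
    using assms(3-5) by metis
qed

text \<open>Composites of linear maps are linear, at the level of hom-objects. On elements the chain
  reads \<open>(g f) a = g (f a) = g (b Tf) = (g b) Tf = (d Tg) Tf = d T(g f)\<close>, where the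
  naturality lemmas for \<open>EComp (self V)\<close> justify the regroupings. This makes the
  description defining the composition of \<open>EM\<close> meaningful.\<close>

lemma EComp_EM_ex:
  assumes A: "is_algebra V T A" and B: "is_algebra V T B" and D: "is_algebra V T D"
  shows "EComp (EM V T) A B D \<in> Hom V (EM_hom V T B D \<otimes> EM_hom V T A B) (EM_hom V T A D) \<and>
    EM_incl V T A D \<cdot> EComp (EM V T) A B D =
    EComp (self V) (fst A) (fst B) (fst D) \<cdot> (EM_incl V T B D \<otimes>\<^sub>a EM_incl V T A B)"
proof -
  obtain X a Y b Z d where p: "A = (X, a)" "B = (Y, b)" "D = (Z, d)"
    by (cases A, cases B, cases D) auto
  have [simp]: "fst A = X" "snd A = a" "fst B = Y" "snd B = b" "fst D = Z" "snd D = d"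
    by (simp_all add: p)
  note [simp] = A B D
  have o [simp]: "X \<in> Obj V" "Y \<in> Obj V" "Z \<in> Obj V" "a \<in> Arr V" "b \<in> Arr V" "d \<in> Arr V"
    "Dom V a = MOb T X" "Dom V b = MOb T Y" "Dom V d = MOb T Z" "Cod V a = X" "Cod V b = Y" "Cod V d = Z"
    using algebra_arr[OF A] algebra_arr[OF B] algebra_arr[OF D] by simp_all
  let ?i = "EM_incl V T A B" and ?j = "EM_incl V T B D"
  let ?c = "EComp (self V)" and ?T = "FHom (MFun T)"
  have i: "IHomArr V a (Id V Y) \<cdot> ?i = IHomArr V (Id V (MOb T X)) b \<cdot> (?T X Y \<cdot> ?i)"
    using incl_equalizes[OF A B] by simp
  have j: "IHomArr V b (Id V Z) \<cdot> ?j = IHomArr V (Id V (MOb T Y)) d \<cdot> (?T Y Z \<cdot> ?j)"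
    using incl_equalizes[OF B D] by simp
  have "IHomArr V a (Id V Z) \<cdot> (?c X Y Z \<cdot> (?j \<otimes>\<^sub>a ?i)) =
      (IHomArr V a (Id V Z) \<cdot> ?c X Y Z) \<cdot> (?j \<otimes>\<^sub>a ?i)"
    by simp
  also have "\<dots> = ?c (MOb T X) Y Z \<cdot> (?j \<otimes>\<^sub>a (IHomArr V a (Id V Y) \<cdot> ?i))"
    by (subst EComp_self_pre[where A' = "MOb T X"]) simp_all
  also have "\<dots> = (?c (MOb T X) Y Z \<cdot> (Id V (IHom V Y Z) \<otimes>\<^sub>a IHomArr V (Id V (MOb T X)) b))
      \<cdot> (?j \<otimes>\<^sub>a (?T X Y \<cdot> ?i))"
    unfolding i by simp
  also have "\<dots> = (?c (MOb T X) (MOb T Y) Z \<cdot> (IHomArr V b (Id V Z) \<otimes>\<^sub>a Id V (IHom V (MOb T X) (MOb T Y))))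
      \<cdot> (?j \<otimes>\<^sub>a (?T X Y \<cdot> ?i))"
    by (subst EComp_self_extranatural[where B' = Y]) simp_all
  also have "\<dots> = ?c (MOb T X) (MOb T Y) Z \<cdot> ((IHomArr V b (Id V Z) \<cdot> ?j) \<otimes>\<^sub>a (?T X Y \<cdot> ?i))"
    by simp
  also have "\<dots> = (?c (MOb T X) (MOb T Y) Z \<cdot>
      (IHomArr V (Id V (MOb T Y)) d \<otimes>\<^sub>a Id V (IHom V (MOb T X) (MOb T Y)))) \<cdot>
      ((?T Y Z \<otimes>\<^sub>a ?T X Y) \<cdot> (?j \<otimes>\<^sub>a ?i))"
    unfolding j by simp
  also have "\<dots> = (IHomArr V (Id V (MOb T X)) d \<cdot> ?c (MOb T X) (MOb T Y) (MOb T Z)) \<cdot>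
      ((?T Y Z \<otimes>\<^sub>a ?T X Y) \<cdot> (?j \<otimes>\<^sub>a ?i))"
    by (subst EComp_self_post[where D = "MOb T Z" and D' = Z]) simp_all
  also have "\<dots> = IHomArr V (Id V (MOb T X)) d \<cdot>
      ((?c (MOb T X) (MOb T Y) (MOb T Z) \<cdot> (?T Y Z \<otimes>\<^sub>a ?T X Y)) \<cdot> (?j \<otimes>\<^sub>a ?i))"
    by simp
  also have "?c (MOb T X) (MOb T Y) (MOb T Z) \<cdot> (?T Y Z \<otimes>\<^sub>a ?T X Y) = ?T X Z \<cdot> ?c X Y Z"
    by (subst F.FHom_Comp) simp_all
  also have "(?T X Z \<cdot> ?c X Y Z) \<cdot> (?j \<otimes>\<^sub>a ?i) = ?T X Z \<cdot> (?c X Y Z \<cdot> (?j \<otimes>\<^sub>a ?i))"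
    by simp
  finally have eq: "IHomArr V (snd A) (Id V (fst D)) \<cdot> (?c X Y Z \<cdot> (?j \<otimes>\<^sub>a ?i)) =
      IHomArr V (Id V (MOb T (fst A))) (snd D) \<cdot>
        (?T (fst A) (fst D) \<cdot> (?c X Y Z \<cdot> (?j \<otimes>\<^sub>a ?i)))"
    by simp
  have "\<exists>!k. k \<in> Hom V (Dom V (?c X Y Z \<cdot> (?j \<otimes>\<^sub>a ?i))) (EM_hom V T A D) \<and>
      EM_incl V T A D \<cdot> k = ?c X Y Z \<cdot> (?j \<otimes>\<^sub>a ?i)"
    by (rule incl_factor[OF A D _ _ eq]) simp_all
  then have "\<exists>!k. k \<in> Hom V (EM_hom V T B D \<otimes> EM_hom V T A B) (EM_hom V T A D) \<and>
      EM_incl V T A D \<cdot> k = ?c (fst A) (fst B) (fst D) \<cdot> (?j \<otimes>\<^sub>a ?i)"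
    by simp
  from theI'[OF this] show ?thesis
    by (simp add: EM_def)
qed

text \<open>Each side of the equalizing condition at the name of \<open>f\<close> is the name of the
  corresponding side of the linearity equation, and names are faithful.\<close>

lemma linear_iff_Name:
  assumes "is_algebra V T A" "is_algebra V T B" "f \<in> Hom V (fst A) (fst B)"
  shows "f \<cdot> snd A = snd B \<cdot> map f \<longleftrightarrow>
    IHomArr V (snd A) (Id V (fst B)) \<cdot> Name (self V) f =
    IHomArr V (Id V (MOb T (fst A))) (snd B) \<cdot> (FHom (MFun T) (fst A) (fst B) \<cdot> Name (self V) f)"
proof -
  have f: "f \<in> Arr V" "Dom V f = fst A" "Cod V f = fst B"
    using assms(3) by (simp_all add: Hom_iff)
  have "IHomArr V (snd A) (Id V (fst B)) \<cdot> Name (self V) f = Name (self V) (f \<cdot> snd A)"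
    using assms(1,2) f by (simp add: IHomArr_Name_self)
  moreover have "FHom (MFun T) (fst A) (fst B) \<cdot> Name (self V) f = Name (self V) (map f)"
    using f by (simp add: Name_map)
  moreover have "IHomArr V (Id V (MOb T (fst A))) (snd B) \<cdot> Name (self V) (map f) =
      Name (self V) (snd B \<cdot> map f)"
    using assms(1,2) f by (simp add: IHomArr_Name_self)
  moreover have "f \<cdot> snd A \<in> Hom V (MOb T (fst A)) (fst B)" "snd B \<cdot> map f \<in> Hom V (MOb T (fst A)) (fst B)"
    using assms(1,2) f by (simp_all add: Hom_iff)
  ultimately show ?thesis
    using Name_self_inject by metis
qed

lemma Name_EM_ex:
  assumes "f \<in> Arr (EM_cat V T)" "fst f = A" "snd (snd f) = B"
  shows "Name (EM V T) f \<in> Hom V (Unit V) (EM_hom V T A B) \<and>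
    EM_incl V T A B \<cdot> Name (EM V T) f = Name (self V) (und f)"
proof -
  have "is_algebra V T A" "is_algebra V T B" "und f \<in> Hom V (fst A) (fst B)"
      "und f \<cdot> snd A = snd B \<cdot> map (und f)"
    using assms by (auto simp: EM_cat_Arr_iff)
  then have "\<exists>!k. k \<in> Hom V (Dom V (Name (self V) (und f))) (EM_hom V T A B) \<and>
      EM_incl V T A B \<cdot> k = Name (self V) (und f)"
    by (intro incl_factor linear_iff_Name[THEN iffD1]) (simp_all add: Hom_iff)
  then have "\<exists>!k. k \<in> Hom V (Unit V) (EM_hom V T A B) \<and> EM_incl V T A B \<cdot> k = Name (self V) (und f)"
    using assms by simp
  from theI'[OF this] show ?thesis
    using assms by (simp add: EM_def)
qed

text \<open>The inclusion sends \<open>h\<close> to the name of some map \<open>f\<close>;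
  \<open>h\<close> being an element of the equalizer is precisely linearity of
  \<open>f\<close>.\<close>

lemma EM_element:
  assumes A: "is_algebra V T A" and B: "is_algebra V T B" and h: "h \<in> Hom V (Unit V) (EM_hom V T A B)"
  obtains f where "(A, f, B) \<in> Arr (EM_cat V T)" "Name (EM V T) (A, f, B) = h"
proof -
  have h': "h \<in> Arr V" "Dom V h = Unit V" "Cod V h = EM_hom V T A B"
    using h by (simp_all add: Hom_iff)
  have "EM_incl V T A B \<cdot> h \<in> Hom V (Unit V) (IHom V (fst A) (fst B))"
    using A B h' by (simp add: Hom_iff)
  then obtain f where f: "f \<in> Hom V (fst A) (fst B)" "Name (self V) f = EM_incl V T A B \<cdot> h"
    using A B by (elim Name_self_surj) simp_all
  have "IHomArr V (snd A) (Id V (fst B)) \<cdot> (EM_incl V T A B \<cdot> h) =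
      (IHomArr V (snd A) (Id V (fst B)) \<cdot> EM_incl V T A B) \<cdot> h"
    using A B h' by simp
  also have "\<dots> = IHomArr V (Id V (MOb T (fst A))) (snd B) \<cdot>
      (FHom (MFun T) (fst A) (fst B) \<cdot> (EM_incl V T A B \<cdot> h))"
    unfolding incl_equalizes[OF A B] using A B h' by simp
  finally have "f \<cdot> snd A = snd B \<cdot> map f"
    unfolding linear_iff_Name[OF A B f(1)] f(2) .
  then have arr: "(A, f, B) \<in> Arr (EM_cat V T)"
    using A B f(1) by (simp add: EM_cat_Arr_iff)
  have "Name (EM V T) (A, f, B) = h"
    by (rule incl_cancel[OF A B _ h]) (use Name_EM_ex[OF arr refl refl] f(2) in simp_all)
  with arr show ?thesis
    by (rule that)
qed

text \<open>\<open>ehom_arr\<close> on \<open>EM\<close> is built from descriptions and unitors.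
  Since \<open>EM_incl\<close> respects composition and names, the two transfer lemmas apply with it
  and reduce \<open>ehom_arr\<close> to \<open>IHomArr\<close> on underlying maps.\<close>

lemma incl_ehom_arr:
  assumes f: "f \<in> Arr (EM_cat V T)" "fst f = A'" "snd (snd f) = A"
    and g: "g \<in> Arr (EM_cat V T)" "fst g = B" "snd (snd g) = B'"
  shows "ehom_arr V (EM V T) f g \<in> Hom V (EM_hom V T A B) (EM_hom V T A' B')"
    and "EM_incl V T A' B' \<cdot> ehom_arr V (EM V T) f g =
      IHomArr V (und f) (und g) \<cdot> EM_incl V T A B"
proof -
  have alg [simp]: "is_algebra V T A'" "is_algebra V T A" "is_algebra V T B" "is_algebra V T B'"
    using EM_arr_simps[OF f(1)] EM_arr_simps[OF g(1)] f(2,3) g(2,3) by simp_all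
  have u [simp]: "und f \<in> Arr V" "Dom V (und f) = fst A'" "Cod V (und f) = fst A"
    "und g \<in> Arr V" "Dom V (und g) = fst B" "Cod V (und g) = fst B'"
    using EM_arr_simps[OF f(1)] EM_arr_simps[OF g(1)] f(2,3) g(2,3) by simp_all
  note nf = Name_EM_ex[OF f] and ng = Name_EM_ex[OF g]
  have n [simp]: "Name (EM V T) f \<in> Arr V" "Dom V (Name (EM V T) f) = Unit V"
    "Cod V (Name (EM V T) f) = EM_hom V T A' A"
    "Name (EM V T) g \<in> Arr V" "Dom V (Name (EM V T) g) = Unit V"
    "Cod V (Name (EM V T) g) = EM_hom V T B B'"
    using nf ng by (simp_all add: Hom_iff)
  have c [simp]: "EComp (EM V T) X Y Z \<in> Arr V"
    "Dom V (EComp (EM V T) X Y Z) = EM_hom V T Y Z \<otimes> EM_hom V T X Y"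
    "Cod V (EComp (EM V T) X Y Z) = EM_hom V T X Z"
    if "is_algebra V T X" "is_algebra V T Y" "is_algebra V T Z" for X Y Z
    using EComp_EM_ex[OF that] by (simp_all add: Hom_iff)
  let ?post = "ehom_post V (EM V T) A' g" and ?pre = "ehom_pre V (EM V T) f B"
  note [simp] = inverse_arr_simps[OF LUnit_iso[of "EM_hom V T A' B"]]
    inverse_arr_simps[OF RUnit_iso[of "EM_hom V T A B"]]
  have post_arr [simp]: "?post \<in> Arr V" "Dom V ?post = EM_hom V T A' B" "Cod V ?post = EM_hom V T A' B'"
    using g by (simp_all add: ehom_post_def)
  have pre_arr [simp]: "?pre \<in> Arr V" "Dom V ?pre = EM_hom V T A B" "Cod V ?pre = EM_hom V T A' B"
    using f by (simp_all add: ehom_pre_def)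
  show "ehom_arr V (EM V T) f g \<in> Hom V (EM_hom V T A B) (EM_hom V T A' B')"
    using f g by (simp add: ehom_arr_def Hom_iff)
  let ?P = "EM_hom V T A' B" and ?P' = "IHom V (fst A') (fst B)"
  have "EM_incl V T A' B' \<cdot> (EComp (EM V T) A' B B' \<cdot>
        ((Name (EM V T) g \<otimes>\<^sub>a Id V ?P) \<cdot> inverse_arr V (LUnit V ?P))) =
      (EComp (self V) (fst A') (fst B) (fst B') \<cdot>
        (((EM_incl V T B B' \<cdot> Name (EM V T) g) \<otimes>\<^sub>a Id V ?P') \<cdot> inverse_arr V (LUnit V ?P')))
      \<cdot> EM_incl V T A' B"
    by (rule post_transfer[where S = "EM_hom V T B B'" and S' = "IHom V (fst B) (fst B')"
          and Q = "EM_hom V T A' B'" and Q' = "IHom V (fst A') (fst B')"])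
      (use EComp_EM_ex[of A' B B'] in \<open>simp_all add: Hom_iff\<close>)
  then have post: "EM_incl V T A' B' \<cdot> ?post = IHomArr V (Id V (fst A')) (und g) \<cdot> EM_incl V T A' B"
    using g ng by (simp add: ehom_post_def flip: ehom_post_self)
  let ?R = "EM_hom V T A B" and ?R' = "IHom V (fst A) (fst B)"
  have "EM_incl V T A' B \<cdot> (EComp (EM V T) A' A B \<cdot>
        ((Id V ?R \<otimes>\<^sub>a Name (EM V T) f) \<cdot> inverse_arr V (RUnit V ?R))) =
      (EComp (self V) (fst A') (fst A) (fst B) \<cdot>
        ((Id V ?R' \<otimes>\<^sub>a (EM_incl V T A' A \<cdot> Name (EM V T) f)) \<cdot> inverse_arr V (RUnit V ?R')))
      \<cdot> EM_incl V T A B"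
    by (rule pre_transfer[where S = "EM_hom V T A' A" and S' = "IHom V (fst A') (fst A)"
          and Q = "EM_hom V T A' B" and Q' = "IHom V (fst A') (fst B)"])
      (use EComp_EM_ex[of A' A B] in \<open>simp_all add: Hom_iff\<close>)
  then have pre: "EM_incl V T A' B \<cdot> ?pre = IHomArr V (und f) (Id V (fst B)) \<cdot> EM_incl V T A B"
    using f nf by (simp add: ehom_pre_def flip: ehom_pre_self)
  have "EM_incl V T A' B' \<cdot> ehom_arr V (EM V T) f g = (EM_incl V T A' B' \<cdot> ?post) \<cdot> ?pre"
    using f g by (simp add: ehom_arr_def)
  also have "\<dots> = IHomArr V (Id V (fst A')) (und g) \<cdot> (EM_incl V T A' B \<cdot> ?pre)"
    unfolding post by simp
  also have "\<dots> = (IHomArr V (Id V (fst A')) (und g) \<cdot> IHomArr V (und f) (Id V (fst B))) \<cdot> EM_incl V T A B"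
    unfolding pre by simp
  also have "\<dots> = IHomArr V (und f) (und g) \<cdot> EM_incl V T A B"
    by (subst IHomArr_Comp) simp_all
  finally show "EM_incl V T A' B' \<cdot> ehom_arr V (EM V T) f g =
      IHomArr V (und f) (und g) \<cdot> EM_incl V T A B" .
qed

text \<open>The inverse is \<open>[1, b] \<cdot> T : [X, Y] \<rightarrow> [T X, Y]\<close>, which factors through the equalizer.\<close>

lemma free_restrict_iso:
  assumes X: "X \<in> Obj V" and B: "is_algebra V T B"
  shows "is_iso V (IHomArr V (MUnit T X) (Id V (fst B)) \<cdot> EM_incl V T (free_alg V T X) B)"
proof -
  obtain Y b where p: "B = (Y, b)"
    by (cases B)
  have [simp]: "fst B = Y" "snd B = b" "fst (free_alg V T X) = MOb T X" "snd (free_alg V T X) = MMult T X"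
    by (simp_all add: p free_alg_def)
  have b [simp]: "Y \<in> Obj V" "b \<in> Arr V" "Dom V b = MOb T Y" "Cod V b = Y"
    using algebra_arr[OF B] by (simp_all add: p)
  have b_unit: "b \<cdot> MUnit T Y = Id V Y" and b_mult: "b \<cdot> MMult T Y = b \<cdot> map b"
    using B by (simp_all add: is_algebra_iff p)
  let ?A = "free_alg V T X" and ?T = "FHom (MFun T)"
  have A: "is_algebra V T ?A"
    by (rule is_algebra_free[OF X])
  let ?i = "EM_incl V T ?A B"
  note [simp] = X A B
  let ?r = "IHomArr V (MUnit T X) (Id V Y) \<cdot> ?i" and ?s = "IHomArr V (Id V (MOb T X)) b \<cdot> ?T X Y"
  \<comment> \<open>On an element \<open>f\<close> this chain reads
    \<open>(b Tf) \<mu> = b \<mu> TTf = b Tb TTf = b T(b Tf)\<close>: the extension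
    \<open>b Tf\<close> is linear on the free algebra.\<close>
  have "IHomArr V (MMult T X) (Id V Y) \<cdot> ?s =
      IHomArr V (Id V (MOb T (MOb T X))) b \<cdot> (IHomArr V (MMult T X) (Id V (MOb T Y)) \<cdot> ?T X Y)"
    using Comp_assoc_arr[of "?T X Y" "IHomArr V (Id V (MOb T X)) b" "IHomArr V (MMult T X) (Id V Y)"]
      Comp_assoc_arr[of "?T X Y" "IHomArr V (MMult T X) (Id V (MOb T Y))" "IHomArr V (Id V (MOb T (MOb T X))) b"]
    by (simp add: IHomArr_Comp del: Comp_assoc_arr flip: Comp_assoc_arr)
  also have "\<dots> = IHomArr V (Id V (MOb T (MOb T X))) b \<cdot>
      (IHomArr V (Id V (MOb T (MOb T X))) (MMult T Y) \<cdot> (?T (MOb T X) (MOb T Y) \<cdot> ?T X Y))"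
    by (simp add: MMult_enriched)
  also have "\<dots> = (IHomArr V (Id V (MOb T (MOb T X))) b \<cdot> IHomArr V (Id V (MOb T (MOb T X))) (MMult T Y)) \<cdot>
      (?T (MOb T X) (MOb T Y) \<cdot> ?T X Y)"
    by simp
  also have "\<dots> = (IHomArr V (Id V (MOb T (MOb T X))) b \<cdot> IHomArr V (Id V (MOb T (MOb T X))) (map b)) \<cdot>
      (?T (MOb T X) (MOb T Y) \<cdot> ?T X Y)"
    by (simp add: IHomArr_Comp b_mult)
  also have "\<dots> = IHomArr V (Id V (MOb T (MOb T X))) b \<cdot>
      ((IHomArr V (Id V (MOb T (MOb T X))) (map b) \<cdot> ?T (MOb T X) (MOb T Y)) \<cdot> ?T X Y)"
    by simp
  also have "\<dots> = IHomArr V (Id V (MOb T (MOb T X))) b \<cdot>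
      ((?T (MOb T X) Y \<cdot> IHomArr V (Id V (MOb T X)) b) \<cdot> ?T X Y)"
    by (subst FHom_IHomArr_post[where Y = "MOb T Y"]) simp_all
  also have "\<dots> = IHomArr V (Id V (MOb T (MOb T X))) b \<cdot> (?T (MOb T X) Y \<cdot> ?s)"
    by simp
  finally have "IHomArr V (snd ?A) (Id V (fst B)) \<cdot> ?s =
      IHomArr V (Id V (MOb T (fst ?A))) (snd B) \<cdot> (?T (fst ?A) (fst B) \<cdot> ?s)"
    by simp
  then have "\<exists>!k. k \<in> Hom V (Dom V ?s) (EM_hom V T ?A B) \<and> ?i \<cdot> k = ?s"
    by (intro incl_factor[OF A B]) simp_all
  then obtain k where k: "k \<in> Hom V (Dom V ?s) (EM_hom V T ?A B)" "?i \<cdot> k = ?s"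
    by blast
  then have k' [simp]: "k \<in> Arr V" "Dom V k = IHom V X Y" "Cod V k = EM_hom V T ?A B"
    by (simp_all add: Hom_iff)
  \<comment> \<open>Restricting the extension gives \<open>f\<close> back:
    \<open>b Tf \<eta> = b \<eta> f = f\<close>.\<close>
  have "?r \<cdot> k = IHomArr V (MUnit T X) (Id V Y) \<cdot> ?s"
    using k(2) by simp
  also have "\<dots> = (IHomArr V (MUnit T X) (Id V Y) \<cdot> IHomArr V (Id V (MOb T X)) b) \<cdot> ?T X Y"
    by simp
  also have "\<dots> = (IHomArr V (Id V X) b \<cdot> IHomArr V (MUnit T X) (Id V (MOb T Y))) \<cdot> ?T X Y"
    by (simp add: IHomArr_Comp)
  also have "\<dots> = IHomArr V (Id V X) b \<cdot> IHomArr V (Id V X) (MUnit T Y)"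
    by (simp add: MUnit_enriched)
  also have "\<dots> = Id V (IHom V X Y)"
    by (simp add: IHomArr_Comp b_unit)
  finally have rk: "?r \<cdot> k = Id V (IHom V X Y)" .
  have i_eq: "IHomArr V (Id V (MOb T (MOb T X))) b \<cdot> (?T (MOb T X) Y \<cdot> ?i) =
      IHomArr V (MMult T X) (Id V Y) \<cdot> ?i"
    using incl_equalizes[OF A B] by simp
  \<comment> \<open>Extending the restriction of a linear \<open>g\<close> gives \<open>g\<close>
    back: \<open>b T(g \<eta>) = (b Tg) T\<eta> = g \<mu> T\<eta> = g\<close>, tested after the
    monic \<open>?i\<close>.\<close>
  have "?i \<cdot> (k \<cdot> ?r) = (?i \<cdot> k) \<cdot> ?r"
    by simp
  also have "\<dots> = IHomArr V (Id V (MOb T X)) b \<cdot> ((?T X Y \<cdot> IHomArr V (MUnit T X) (Id V Y)) \<cdot> ?i)"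
    unfolding k(2) by simp
  also have "\<dots> = IHomArr V (Id V (MOb T X)) b \<cdot>
      ((IHomArr V (map (MUnit T X)) (Id V (MOb T Y)) \<cdot> ?T (MOb T X) Y) \<cdot> ?i)"
    by (subst FHom_IHomArr_pre[where Y = "MOb T X"]) simp_all
  also have "\<dots> = (IHomArr V (Id V (MOb T X)) b \<cdot> IHomArr V (map (MUnit T X)) (Id V (MOb T Y))) \<cdot>
      (?T (MOb T X) Y \<cdot> ?i)"
    by simp
  also have "\<dots> = (IHomArr V (map (MUnit T X)) (Id V Y) \<cdot> IHomArr V (Id V (MOb T (MOb T X))) b) \<cdot>
      (?T (MOb T X) Y \<cdot> ?i)"
    by (simp add: IHomArr_Comp)
  also have "\<dots> = IHomArr V (map (MUnit T X)) (Id V Y) \<cdot> (IHomArr V (MMult T X) (Id V Y) \<cdot> ?i)"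
    unfolding i_eq[symmetric] by simp
  also have "\<dots> = (IHomArr V (map (MUnit T X)) (Id V Y) \<cdot> IHomArr V (MMult T X) (Id V Y)) \<cdot> ?i"
    by simp
  also have "\<dots> = ?i \<cdot> Id V (EM_hom V T ?A B)"
    by (simp add: IHomArr_Comp right_unit)
  finally have eq: "?i \<cdot> (k \<cdot> ?r) = ?i \<cdot> Id V (EM_hom V T ?A B)" .
  have kr: "k \<cdot> ?r = Id V (EM_hom V T ?A B)"
    by (rule incl_cancel[OF A B _ _ eq]) (simp_all add: Hom_iff)
  have "is_iso V ?r"
    by (rule is_isoI[OF _ _ kr rk]) (simp_all add: Hom_iff)
  then show ?thesis
    by (simp add: p)
qed

end

section \<open>Distribution monads\<close>

lemma EM_closed_simps [simp]:
  "Arr (EM_closed V T) = Arr (EM_cat V T)" "Dom (EM_closed V T) f = fst f"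
  "Cod (EM_closed V T) f = snd (snd f)" "Id (EM_closed V T) A = (A, Id V (fst A), A)"
  "Comp (EM_closed V T) g f = (fst f, und g \<cdot>\<^bsub>V\<^esub> und f, snd (snd g))"
  "IHomArr (EM_closed V T) f g =
    (alg_ihom V T (snd (snd f)) (fst g), ehom_arr V (EM V T) f g, alg_ihom V T (fst f) (snd (snd g)))"
  by (simp_all add: EM_closed_def Let_def)

lemma fst_alg_ihom [simp]: "fst (alg_ihom V T A B) = EM_hom V T A B"
  by (simp add: alg_ihom_def Let_def)

lemma fst_free_alg [simp]: "fst (free_alg V T X) = MOb T X"
  by (simp add: free_alg_def)

lemma (in closed_symmetric_monoidal_category) FArr_id_functor:
  assumes "f \<in> Arr V"
  shows "FArr V (self V) (self V) (id_functor V (self V)) f = f"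
  unfolding FArr_def
  by (rule the_equality) (use assms in \<open>auto simp: id_functor_def Hom_iff intro: Name_self_inject\<close>)

locale monad_extension =
  closed_symmetric_monoidal_category V + L: Eilenberg_Moore V L + M: self_monad V M
  for V :: "('o, 'm) closed_monoidal" (structure) and L M :: "('o, 'm) self_monad" +
  fixes \<Delta> :: "'o \<Rightarrow> 'm"
  assumes morphism: "monad_morphism V (self V) (self V) L M \<Delta> (id_functor V (self V))"
begin

lemma Delta_natural_transformation: "enriched_natural V (self V) (self V)
    (comp_functor V (MFun L) (id_functor V (self V)))
    (comp_functor V (id_functor V (self V)) (MFun M)) \<Delta>"
  using morphism by (simp add: monad_morphism_def)

lemma Delta_arr [simp]:
  assumes "X \<in> Obj V"
  shows "\<Delta> X \<in> Arr V" "Dom V (\<Delta> X) = MOb L X" "Cod V (\<Delta> X) = MOb M X"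
  using enriched_natural_self(1)[OF Delta_natural_transformation assms assms]
  by (simp_all add: Hom_iff comp_functor_def id_functor_def)

lemma Delta_enriched:
  assumes "X \<in> Obj V" "Y \<in> Obj V"
  shows "IHomArr V (\<Delta> X) (Id V (MOb M Y)) \<cdot> FHom (MFun M) X Y =
    IHomArr V (Id V (MOb L X)) (\<Delta> Y) \<cdot> FHom (MFun L) X Y"
  using enriched_natural_self(2)[OF Delta_natural_transformation assms] assms
  by (simp add: comp_functor_def id_functor_def)

lemma Delta_natural:
  assumes "f \<in> Arr V" "Dom V f = X" "Cod V f = Y"
  shows "\<Delta> Y \<cdot> L.map f = M.map f \<cdot> \<Delta> X"
proof -
  have "X \<in> Obj V" "Y \<in> Obj V"
    using assms by auto
  then show ?thesis
    using assms by (intro enriched_natural_Name[OF Delta_natural_transformation])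
      (simp_all add: Hom_iff comp_functor_def id_functor_def L.Name_map M.Name_map)
qed

lemma Delta_unit: "X \<in> Obj V \<Longrightarrow> \<Delta> X \<cdot> MUnit L X = MUnit M X"
  \<comment> \<open>Only the object part of \<open>id_functor\<close> is unfolded, by applying
    \<open>FOb\<close> to its definition; its occurrence inside \<open>FArr\<close> has to stay
    intact for \<open>FArr_id_functor\<close>.\<close>
  using morphism by (simp add: monad_morphism_def id_functor_def[of V "self V", THEN arg_cong[of _ _ FOb]]
      FArr_id_functor)

lemma Delta_mult:
  "X \<in> Obj V \<Longrightarrow> \<Delta> X \<cdot> MMult L X = MMult M X \<cdot> (\<Delta> (MOb M X) \<cdot> L.map (\<Delta> X))"
  using morphism by (simp add: monad_morphism_def id_functor_def[of V "self V", THEN arg_cong[of _ _ FOb]]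
      FArr_id_functor)

text \<open>The laws of \<open>a\<close> are carried across \<open>\<Delta>\<close> by the two laws
  of a monad morphism and by naturality.\<close>

lemma is_algebra_restrict:
  assumes "is_algebra V M (Z, a)"
  shows "is_algebra V L (Z, a \<cdot> \<Delta> Z)"
proof -
  have [simp]: "Z \<in> Obj V" "a \<in> Arr V" "Dom V a = MOb M Z" "Cod V a = Z"
    and unit: "a \<cdot> MUnit M Z = Id V Z" and mult: "a \<cdot> MMult M Z = a \<cdot> M.map a"
    using assms by (simp_all add: M.is_algebra_iff Hom_iff)
  have "(a \<cdot> \<Delta> Z) \<cdot> MMult L Z = (a \<cdot> MMult M Z) \<cdot> (\<Delta> (MOb M Z) \<cdot> L.map (\<Delta> Z))"
    by (simp add: Delta_mult)
  also have "\<dots> = a \<cdot> ((M.map a \<cdot> \<Delta> (MOb M Z)) \<cdot> L.map (\<Delta> Z))"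
    unfolding mult by simp
  also have "\<dots> = (a \<cdot> \<Delta> Z) \<cdot> L.map (a \<cdot> \<Delta> Z)"
    by (subst Delta_natural[symmetric, where Y = Z]) (simp_all add: L.map_Comp)
  finally show ?thesis
    by (simp add: L.is_algebra_iff Hom_iff Delta_unit unit)
qed

text \<open>The source of linear maps between the spaces \<open>M X\<close>: applied below to
  \<open>M f\<close> and to \<open>\<kappa>\<close>, which are homomorphisms of free
  \<open>M\<close>-algebras by naturality and associativity of \<open>\<kappa>\<close>.\<close>

lemma hom_restrict:
  assumes "is_algebra V M (Z, a)" "is_algebra V M (W, b)" "f \<in> Hom V Z W" "f \<cdot> a = b \<cdot> M.map f"
  shows "((Z, a \<cdot> \<Delta> Z), f, (W, b \<cdot> \<Delta> W)) \<in> Arr (EM_cat V L)"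
proof -
  have [simp]: "Z \<in> Obj V" "a \<in> Arr V" "Dom V a = MOb M Z" "Cod V a = Z"
    "W \<in> Obj V" "b \<in> Arr V" "Dom V b = MOb M W" "Cod V b = W"
    "f \<in> Arr V" "Dom V f = Z" "Cod V f = W"
    using assms(1-3) by (simp_all add: M.is_algebra_iff Hom_iff)
  have "f \<cdot> (a \<cdot> \<Delta> Z) = (f \<cdot> a) \<cdot> \<Delta> Z"
    by simp
  also have "\<dots> = b \<cdot> (M.map f \<cdot> \<Delta> Z)"
    unfolding assms(4) by simp
  also have "\<dots> = (b \<cdot> \<Delta> W) \<cdot> L.map f"
    by (subst Delta_natural[symmetric, where Y = W]) simp_all
  finally show ?thesis
    using assms(1-3) by (simp add: L.EM_cat_Arr_iff is_algebra_restrict)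
qed

section \<open>The spaces \<open>M X\<close> as linear spaces\<close>

abbreviation MX :: "'o \<Rightarrow> ('o, 'm) algebra" where
  "MX \<equiv> dist_space V M \<Delta>"

lemma dist_space_simps [simp]:
  "fst (MX X) = MOb M X" "snd (MX X) = MMult M X \<cdot> \<Delta> (MOb M X)"
  by (simp_all add: dist_space_def)

lemma dist_space_algebra [simp]: "X \<in> Obj V \<Longrightarrow> is_algebra V L (MX X)"
  unfolding dist_space_def using M.is_algebra_free by (intro is_algebra_restrict) (simp add: free_alg_def)

lemma map_linear:
  assumes "f \<in> Arr V" "Dom V f = X" "Cod V f = Y"
  shows "(MX X, M.map f, MX Y) \<in> Arr (EM_cat V L)"
proof -
  have "X \<in> Obj V" "Y \<in> Obj V"
    using assms by auto
  then show ?thesis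
    unfolding dist_space_def using assms M.is_algebra_free[of X] M.is_algebra_free[of Y]
    by (intro hom_restrict) (simp_all add: free_alg_def Hom_iff M.MMult_natural)
qed

lemma mult_linear: "X \<in> Obj V \<Longrightarrow> (MX (MOb M X), MMult M X, MX X) \<in> Arr (EM_cat V L)"
  unfolding dist_space_def using M.is_algebra_free[of "MOb M X"] M.is_algebra_free[of X]
  by (intro hom_restrict) (simp_all add: free_alg_def Hom_iff M.mult_assoc)

text \<open>The multiplication law \<open>Delta_mult\<close> of the monad morphism is literally the
  linearity equation.\<close>

lemma Delta_linear: "X \<in> Obj V \<Longrightarrow> (free_alg V L X, \<Delta> X, MX X) \<in> Arr (EM_cat V L)"
  using L.is_algebra_free[of X] by (simp add: L.EM_cat_Arr_iff free_alg_def Hom_iff Delta_mult)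

text \<open>The action of \<open>M\<close> on internal homs factors through linear maps. On an
  element \<open>f\<close> the chain reads \<open>Mf \<kappa> \<Delta> = \<kappa> MMf \<Delta> =
  \<kappa> \<Delta> LMf\<close>, by enriched naturality of \<open>\<kappa>\<close> and then of
  \<open>\<Delta>\<close>.\<close>

lemma FHom_dist_functor:
  assumes X [simp]: "X \<in> Obj V" and Y [simp]: "Y \<in> Obj V"
  shows "FHom (dist_functor V L M \<Delta>) X Y \<in> Hom V (IHom V X Y) (EM_hom V L (MX X) (MX Y))"
    and "EM_incl V L (MX X) (MX Y) \<cdot> FHom (dist_functor V L M \<Delta>) X Y = FHom (MFun M) X Y"
proof -
  let ?X = "MOb M X" and ?Y = "MOb M Y"
  let ?M = "FHom (MFun M)" and ?L = "FHom (MFun L)"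
  have "IHomArr V (MMult M X \<cdot> \<Delta> ?X) (Id V ?Y) \<cdot> ?M X Y =
      (IHomArr V (\<Delta> ?X) (Id V ?Y) \<cdot> IHomArr V (MMult M X) (Id V ?Y)) \<cdot> ?M X Y"
    by (simp add: IHomArr_Comp)
  also have "\<dots> = IHomArr V (\<Delta> ?X) (Id V ?Y) \<cdot> (IHomArr V (MMult M X) (Id V ?Y) \<cdot> ?M X Y)"
    by simp
  also have "\<dots> = IHomArr V (\<Delta> ?X) (Id V ?Y) \<cdot>
      (IHomArr V (Id V (MOb M ?X)) (MMult M Y) \<cdot> (?M ?X ?Y \<cdot> ?M X Y))"
    by (simp add: M.MMult_enriched)
  also have "\<dots> = (IHomArr V (\<Delta> ?X) (Id V ?Y) \<cdot> IHomArr V (Id V (MOb M ?X)) (MMult M Y)) \<cdot>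
      (?M ?X ?Y \<cdot> ?M X Y)"
    by simp
  also have "\<dots> = (IHomArr V (Id V (MOb L ?X)) (MMult M Y) \<cdot> IHomArr V (\<Delta> ?X) (Id V (MOb M ?Y))) \<cdot>
      (?M ?X ?Y \<cdot> ?M X Y)"
    by (simp add: IHomArr_Comp)
  also have "\<dots> = IHomArr V (Id V (MOb L ?X)) (MMult M Y) \<cdot>
      ((IHomArr V (\<Delta> ?X) (Id V (MOb M ?Y)) \<cdot> ?M ?X ?Y) \<cdot> ?M X Y)"
    by simp
  also have "\<dots> = (IHomArr V (Id V (MOb L ?X)) (MMult M Y) \<cdot> IHomArr V (Id V (MOb L ?X)) (\<Delta> ?Y)) \<cdot>
      (?L ?X ?Y \<cdot> ?M X Y)"
    unfolding Delta_enriched[OF M.FOb_obj[OF X] M.FOb_obj[OF Y]] by simp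
  also have "\<dots> = IHomArr V (Id V (MOb L ?X)) (MMult M Y \<cdot> \<Delta> ?Y) \<cdot> (?L ?X ?Y \<cdot> ?M X Y)"
    by (simp add: IHomArr_Comp)
  finally have "IHomArr V (snd (MX X)) (Id V (fst (MX Y))) \<cdot> ?M X Y =
      IHomArr V (Id V (MOb L (fst (MX X)))) (snd (MX Y)) \<cdot> (?L (fst (MX X)) (fst (MX Y)) \<cdot> ?M X Y)"
    by simp
  then have "\<exists>!k. k \<in> Hom V (Dom V (?M X Y)) (EM_hom V L (MX X) (MX Y)) \<and>
      EM_incl V L (MX X) (MX Y) \<cdot> k = ?M X Y"
    by (intro L.incl_factor) simp_all
  then have "\<exists>!k. k \<in> Hom V (IHom V X Y) (EM_hom V L (MX X) (MX Y)) \<and>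
      EM_incl V L (MX X) (MX Y) \<cdot> k = ?M X Y"
    by simp
  from theI'[OF this]
  show "FHom (dist_functor V L M \<Delta>) X Y \<in> Hom V (IHom V X Y) (EM_hom V L (MX X) (MX Y))"
    and "EM_incl V L (MX X) (MX Y) \<cdot> FHom (dist_functor V L M \<Delta>) X Y = FHom (MFun M) X Y"
    by (simp_all add: dist_functor_def)
qed

section \<open>Restriction of linear maps along the unit of \<open>M\<close>\<close>

lemma dist_restrict_eq:
  "dist_restrict V L M \<Delta> E X = IHomArr V (MUnit M X) (Id V (fst E)) \<cdot> EM_incl V L (MX X) E"
  by (simp add: dist_restrict_def EM_forget_def)

lemma dist_restrict_arr [simp]:
  assumes "X \<in> Obj V" "is_algebra V L E"
  shows "dist_restrict V L M \<Delta> E X \<in> Arr V"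
    "Dom V (dist_restrict V L M \<Delta> E X) = EM_hom V L (MX X) E"
    "Cod V (dist_restrict V L M \<Delta> E X) = IHom V X (fst E)"
  using assms by (simp_all add: dist_restrict_eq)

text \<open>The bridge between invertibility of the restriction as an arrow of \<open>V\<close> and
  statements about individual linear maps.\<close>

lemma dist_restrict_Name:
  assumes "X \<in> Obj V" "is_algebra V L E" "(MX X, f, E) \<in> Arr (EM_cat V L)"
  shows "dist_restrict V L M \<Delta> E X \<cdot> Name (EM V L) (MX X, f, E) = Name (self V) (f \<cdot> MUnit M X)"
proof -
  have f: "f \<in> Arr V" "Dom V f = MOb M X" "Cod V f = fst E"
    using L.EM_arr_simps[OF assms(3)] by simp_all
  have n: "Name (EM V L) (MX X, f, E) \<in> Arr V" "Dom V (Name (EM V L) (MX X, f, E)) = Unit V"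
    "Cod V (Name (EM V L) (MX X, f, E)) = EM_hom V L (MX X) E"
    "EM_incl V L (MX X) E \<cdot> Name (EM V L) (MX X, f, E) = Name (self V) f"
    using L.Name_EM_ex[OF assms(3) refl refl] by (simp_all add: Hom_iff)
  show ?thesis
    using assms(1,2) f n by (simp add: dist_restrict_eq IHomArr_Name_self)
qed

text \<open>Behind the contravariant functors, which act by transposed and braided composition, lies
  the equation \<open>(f Mu) \<delta> = (f \<delta>) u\<close>, that is, naturality of
  \<open>\<delta>\<close>.\<close>

lemma dist_restrict_natural:
  assumes E [simp]: "is_algebra V L E"
  shows "enriched_natural V (op_enriched V (self V)) (self V) (dist_presheaf V L M \<Delta> E)
    (hom_into V (self V) (fst E)) (dist_restrict V L M \<Delta> E)"
proof -
  let ?\<phi> = "dist_restrict V L M \<Delta> E" and ?K = "fst E" and ?c = "EComp (self V)"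
  have K [simp]: "?K \<in> Obj V"
    using L.algebra_arr(1)[OF E] .
  have "ehom_post V (self V) (FOb (dist_presheaf V L M \<Delta> E) X) (?\<phi> Y) \<cdot> FHom (dist_presheaf V L M \<Delta> E) X Y =
      ehom_pre V (self V) (?\<phi> X) (FOb (hom_into V (self V) ?K) Y) \<cdot> FHom (hom_into V (self V) ?K) X Y"
    if X [simp]: "X \<in> Obj V" and Y [simp]: "Y \<in> Obj V" for X Y
  proof -
    let ?x = "MOb M X" and ?y = "MOb M Y"
    let ?H = "EM_hom V L (MX X) E" and ?YX = "EM_hom V L (MX Y) (MX X)"
    let ?d = "FHom (dist_functor V L M \<Delta>) Y X" and ?e = "EComp (EM V L) (MX Y) (MX X) E"
    let ?i = "EM_incl V L (MX X) E" and ?j = "EM_incl V L (MX Y) (MX X)"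
    have d [simp]: "?d \<in> Arr V" "Dom V ?d = IHom V Y X" "Cod V ?d = ?YX"
      using FHom_dist_functor(1)[OF Y X] by (simp_all add: Hom_iff)
    have e [simp]: "?e \<in> Arr V" "Dom V ?e = ?H \<otimes> ?YX" "Cod V ?e = EM_hom V L (MX Y) E"
      and incl_e: "EM_incl V L (MX Y) E \<cdot> ?e = ?c ?y ?x ?K \<cdot> (?i \<otimes>\<^sub>a ?j)"
      using L.EComp_EM_ex[of "MX Y" "MX X" E] by (simp_all add: Hom_iff)
    have br: "Braid V (Cod V f) (Cod V g) \<cdot> (f \<otimes>\<^sub>a g) = (g \<otimes>\<^sub>a f) \<cdot> Braid V (Dom V f) (Dom V g)"
      if "f \<in> Arr V" "g \<in> Arr V" for f g
      by (rule Braid_natural) (use that in \<open>simp_all add: Hom_iff\<close>)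
    \<comment> \<open>The equation \<open>(f Mu) \<delta> = f (\<delta> u) = (f \<delta>) u\<close>
      before transposition: \<open>MUnit_enriched\<close> replaces \<open>Mu \<delta>\<close> by
      \<open>\<delta> u\<close>, and extranaturality moves \<open>\<delta>\<close> over to
      \<open>f\<close>.\<close>
    have "?\<phi> Y \<cdot> (?e \<cdot> (Id V ?H \<otimes>\<^sub>a ?d)) =
        IHomArr V (MUnit M Y) (Id V ?K) \<cdot> ((EM_incl V L (MX Y) E \<cdot> ?e) \<cdot> (Id V ?H \<otimes>\<^sub>a ?d))"
      by (simp add: dist_restrict_eq)
    also have "\<dots> = (IHomArr V (MUnit M Y) (Id V ?K) \<cdot> ?c ?y ?x ?K) \<cdot> (?i \<otimes>\<^sub>a FHom (MFun M) Y X)"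
      unfolding incl_e by (simp add: FHom_dist_functor(2))
    also have "\<dots> = ?c Y ?x ?K \<cdot> (?i \<otimes>\<^sub>a (IHomArr V (MUnit M Y) (Id V ?x) \<cdot> FHom (MFun M) Y X))"
      by (subst EComp_self_pre[where A' = Y]) simp_all
    also have "\<dots> = (?c Y ?x ?K \<cdot> (Id V (IHom V ?x ?K) \<otimes>\<^sub>a IHomArr V (Id V Y) (MUnit M X))) \<cdot>
        (?i \<otimes>\<^sub>a Id V (IHom V Y X))"
      by (simp add: M.MUnit_enriched)
    also have "\<dots> = (?c Y X ?K \<cdot> (IHomArr V (MUnit M X) (Id V ?K) \<otimes>\<^sub>a Id V (IHom V Y X))) \<cdot>
        (?i \<otimes>\<^sub>a Id V (IHom V Y X))"
      by (subst EComp_self_extranatural[where B' = ?x]) simp_all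
    also have "\<dots> = ?c Y X ?K \<cdot> (?\<phi> X \<otimes>\<^sub>a Id V (IHom V Y X))"
      by (simp add: dist_restrict_eq)
    finally have main: "?\<phi> Y \<cdot> (?e \<cdot> (Id V ?H \<otimes>\<^sub>a ?d)) = ?c Y X ?K \<cdot> (?\<phi> X \<otimes>\<^sub>a Id V (IHom V Y X))" .
    \<comment> \<open>Both sides of the naturality square are written as transposes; naturality of
      the braiding moves it to the far right, where the untransposed equation applies.\<close>
    have "ehom_post V (self V) (FOb (dist_presheaf V L M \<Delta> E) X) (?\<phi> Y) \<cdot> FHom (dist_presheaf V L M \<Delta> E) X Y =
        IHomArr V (Id V ?H) (?\<phi> Y) \<cdot> (curry_arr V ?YX ?H (?e \<cdot> Braid V ?YX ?H) \<cdot> ?d)"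
      by (simp add: ehom_post_self dist_presheaf_def comp_functor_def hom_into_def op_functor_def
          dist_functor_def[THEN arg_cong[of _ _ FOb]])
    also have "\<dots> = curry_arr V (IHom V Y X) ?H (?\<phi> Y \<cdot> (?e \<cdot> (Braid V ?YX ?H \<cdot> (?d \<otimes>\<^sub>a Id V ?H))))"
      by (simp add: curry_arr_Comp IHomArr_curry_arr)
    also have "Braid V ?YX ?H \<cdot> (?d \<otimes>\<^sub>a Id V ?H) = (Id V ?H \<otimes>\<^sub>a ?d) \<cdot> Braid V (IHom V Y X) ?H"
      using br[of ?d "Id V ?H"] by simp
    also have "?\<phi> Y \<cdot> (?e \<cdot> ((Id V ?H \<otimes>\<^sub>a ?d) \<cdot> Braid V (IHom V Y X) ?H)) =
        (?\<phi> Y \<cdot> (?e \<cdot> (Id V ?H \<otimes>\<^sub>a ?d))) \<cdot> Braid V (IHom V Y X) ?H"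
      by simp
    also have "\<dots> = ?c Y X ?K \<cdot> ((?\<phi> X \<otimes>\<^sub>a Id V (IHom V Y X)) \<cdot> Braid V (IHom V Y X) ?H)"
      unfolding main by simp
    also have "(?\<phi> X \<otimes>\<^sub>a Id V (IHom V Y X)) \<cdot> Braid V (IHom V Y X) ?H =
        Braid V (IHom V Y X) (IHom V X ?K) \<cdot> (Id V (IHom V Y X) \<otimes>\<^sub>a ?\<phi> X)"
      using br[of "Id V (IHom V Y X)" "?\<phi> X"] by simp
    also have "curry_arr V (IHom V Y X) ?H
          (?c Y X ?K \<cdot> (Braid V (IHom V Y X) (IHom V X ?K) \<cdot> (Id V (IHom V Y X) \<otimes>\<^sub>a ?\<phi> X))) =
        IHomArr V (?\<phi> X) (Id V (IHom V Y ?K)) \<cdot>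
          curry_arr V (IHom V Y X) (IHom V X ?K) (?c Y X ?K \<cdot> Braid V (IHom V Y X) (IHom V X ?K))"
      by (simp add: IHomArr_curry_arr)
    also have "\<dots> = ehom_pre V (self V) (?\<phi> X) (FOb (hom_into V (self V) ?K) Y) \<cdot>
        FHom (hom_into V (self V) ?K) X Y"
      by (simp add: ehom_pre_self hom_into_def)
    finally show ?thesis .
  qed
  then show ?thesis
    by (simp add: enriched_natural_def op_enriched_def Hom_iff dist_presheaf_def comp_functor_def
        hom_into_def op_functor_def dist_functor_def[THEN arg_cong[of _ _ FOb]])
qed

lemma dist_restrict_iso:
  assumes E: "is_algebra V L E" and complete: "dist_complete V L M \<Delta> E" and X: "X \<in> Obj V"
  shows "is_iso V (dist_restrict V L M \<Delta> E X)"
proof -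
  let ?f = "(free_alg V L X, \<Delta> X, MX X)" and ?g = "(E, Id V (fst E), E)"
  let ?h = "ehom_arr V (EM V L) ?f ?g"
  note h = L.incl_ehom_arr[OF Delta_linear[OF X] _ _ L.Id_linear[OF E], simplified, OF refl refl refl refl]
  \<comment> \<open>Completeness gives an inverse among linear maps. The underlying space of
    \<open>alg_ihom\<close> is the hom-object itself, so the underlying arrow of \<open>k\<close>
    inverts \<open>?h\<close> in \<open>V\<close>.\<close>
  obtain k where k: "k \<in> Arr (EM_cat V L)" "fst k = alg_ihom V L (free_alg V L X) E"
    "snd (snd k) = alg_ihom V L (MX X) E"
    "und k \<cdot> ?h = Id V (EM_hom V L (MX X) E)" "?h \<cdot> und k = Id V (EM_hom V L (free_alg V L X) E)"
    using complete X unfolding dist_complete_def is_iso_def is_inverse_def by (auto simp: Hom_iff)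
  have "und k \<in> Hom V (EM_hom V L (free_alg V L X) E) (EM_hom V L (MX X) E)"
    using L.EM_arr_simps[OF k(1)] k(2,3) by (simp add: Hom_iff)
  with h(1) k(4,5) have "is_iso V ?h"
    by (intro is_isoI)
  moreover have "is_iso V (IHomArr V (MUnit L X) (Id V (fst E)) \<cdot> EM_incl V L (free_alg V L X) E)"
    by (rule L.free_restrict_iso[OF X E])
  moreover have "dist_restrict V L M \<Delta> E X =
      (IHomArr V (MUnit L X) (Id V (fst E)) \<cdot> EM_incl V L (free_alg V L X) E) \<cdot> ?h"
  proof -
    note [simp] = X E L.is_algebra_free[OF X]
    have [simp]: "?h \<in> Arr V" "Dom V ?h = EM_hom V L (MX X) E" "Cod V ?h = EM_hom V L (free_alg V L X) E"
      using h(1) by (simp_all add: Hom_iff)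
    have "(IHomArr V (MUnit L X) (Id V (fst E)) \<cdot> EM_incl V L (free_alg V L X) E) \<cdot> ?h =
        IHomArr V (MUnit L X) (Id V (fst E)) \<cdot> (IHomArr V (\<Delta> X) (Id V (fst E)) \<cdot> EM_incl V L (MX X) E)"
      using h(2) by simp
    also have "\<dots> = (IHomArr V (MUnit L X) (Id V (fst E)) \<cdot> IHomArr V (\<Delta> X) (Id V (fst E))) \<cdot>
        EM_incl V L (MX X) E"
      by simp
    also have "\<dots> = dist_restrict V L M \<Delta> E X"
      by (simp add: dist_restrict_eq IHomArr_Comp Delta_unit)
    finally show ?thesis ..
  qed
  moreover have "Cod V ?h = EM_hom V L (free_alg V L X) E"
    using h(1) by (simp add: Hom_iff)
  ultimately show ?thesis
    using X E L.is_algebra_free[OF X] by (simp add: iso_Comp)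
qed

text \<open>Linear maps are passed to their names, where the invertible restriction can be cancelled
  on the left.\<close>

lemma linear_eqI:
  assumes E: "is_algebra V L E" and complete: "dist_complete V L M \<Delta> E" and X: "X \<in> Obj V"
    and f: "(MX X, f, E) \<in> Arr (EM_cat V L)" and g: "(MX X, g, E) \<in> Arr (EM_cat V L)"
    and eq: "f \<cdot> MUnit M X = g \<cdot> MUnit M X"
  shows "f = g"
proof (rule Name_self_inject)
  note nf = L.Name_EM_ex[OF f refl refl, simplified] and ng = L.Name_EM_ex[OF g refl refl, simplified]
  have eq': "dist_restrict V L M \<Delta> E X \<cdot> Name (EM V L) (MX X, f, E) =
      dist_restrict V L M \<Delta> E X \<cdot> Name (EM V L) (MX X, g, E)"
    using dist_restrict_Name[OF X E f] dist_restrict_Name[OF X E g] eq by simp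
  have "Name (EM V L) (MX X, f, E) = Name (EM V L) (MX X, g, E)"
    by (rule iso_cancel_left[OF dist_restrict_iso[OF E complete X] _ _ _ _ eq'])
      (use nf ng X E in \<open>simp_all add: Hom_iff\<close>)
  then show "Name (self V) f = Name (self V) g"
    using nf ng by simp
  show "f \<in> Hom V (MOb M X) (fst E)" "g \<in> Hom V (MOb M X) (fst E)"
    using f g by (simp_all add: L.EM_cat_Arr_iff)
qed

text \<open>\<open>b\<close> is the linear map named by the inverse restriction applied to the name
  of the identity. The retraction property is that choice read through
  \<open>dist_restrict_Name\<close>; the last conclusion keeps the element form, which is what the
  counit asks for.\<close>

lemma dist_retraction:
  assumes E: "is_algebra V L E" and complete: "dist_complete V L M \<Delta> E"
  obtains b where "(MX (fst E), b, E) \<in> Arr (EM_cat V L)" "b \<cdot> MUnit M (fst E) = Id V (fst E)"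
    "dist_restrict V L M \<Delta> E (fst E) \<cdot> Name (EM V L) (MX (fst E), b, E) = Name (self V) (Id V (fst E))"
proof -
  let ?Z = "fst E"
  let ?\<phi> = "dist_restrict V L M \<Delta> E ?Z"
  note Z [simp] = L.algebra_arr(1)[OF E] and [simp] = E
  note [simp] = inverse_arr_simps[OF dist_restrict_iso[OF E complete Z]]
  let ?n = "Name (self V) (Id V ?Z)"
  have "inverse_arr V ?\<phi> \<cdot> ?n \<in> Hom V (Unit V) (EM_hom V L (MX ?Z) E)"
    by (simp add: Hom_iff)
  then obtain b where b: "(MX ?Z, b, E) \<in> Arr (EM_cat V L)"
      "Name (EM V L) (MX ?Z, b, E) = inverse_arr V ?\<phi> \<cdot> ?n"
    by (elim L.EM_element[OF dist_space_algebra[OF Z] E])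
  have "?\<phi> \<cdot> Name (EM V L) (MX ?Z, b, E) = (?\<phi> \<cdot> inverse_arr V ?\<phi>) \<cdot> ?n"
    unfolding b(2) by (intro Comp_assoc_arr[symmetric]) simp_all
  also have "\<dots> = ?n"
    by (simp del: Comp_assoc_arr)
  finally have n: "?\<phi> \<cdot> Name (EM V L) (MX ?Z, b, E) = ?n" .
  have "b \<cdot> MUnit M ?Z = Id V ?Z"
    by (rule Name_self_inject[of _ ?Z ?Z])
      (use n dist_restrict_Name[OF Z E b(1)] L.EM_arr_simps[OF b(1)] in \<open>simp_all add: Hom_iff\<close>)
  with b(1) n show ?thesis
    by (intro that)
qed

text \<open>Both sides of the associativity law are linear on \<open>M M E\<close> and restrict to \<open>b\<close> along \<open>\<delta>\<close>.\<close>

lemma retraction_is_algebra: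
  assumes E: "is_algebra V L E" and complete: "dist_complete V L M \<Delta> E"
    and b: "(MX (fst E), b, E) \<in> Arr (EM_cat V L)" and retraction: "b \<cdot> MUnit M (fst E) = Id V (fst E)"
  shows "is_algebra V M (fst E, b)"
proof -
  let ?Z = "fst E"
  note Z [simp] = L.algebra_arr(1)[OF E]
  have b' [simp]: "b \<in> Arr V" "Dom V b = MOb M ?Z" "Cod V b = ?Z"
    using L.EM_arr_simps[OF b] by simp_all
  have "(b \<cdot> MMult M ?Z) \<cdot> MUnit M (MOb M ?Z) = b"
    by (simp add: M.left_unit)
  also have "\<dots> = (b \<cdot> MUnit M ?Z) \<cdot> b"
    unfolding retraction by simp
  also have "\<dots> = b \<cdot> (MUnit M ?Z \<cdot> b)"
    by simp
  also have "\<dots> = (b \<cdot> M.map b) \<cdot> MUnit M (MOb M ?Z)"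
    by (subst M.MUnit_natural[where X = "MOb M ?Z"]) simp_all
  finally have eq: "(b \<cdot> MMult M ?Z) \<cdot> MUnit M (MOb M ?Z) = (b \<cdot> M.map b) \<cdot> MUnit M (MOb M ?Z)" .
  \<comment> \<open>Linearity of the two sides comes from composing the linear maps
    \<open>\<kappa>\<close> and \<open>M b\<close> with the linear \<open>b\<close>.\<close>
  have "b \<cdot> MMult M ?Z = b \<cdot> M.map b"
    by (rule linear_eqI[OF E complete M.FOb_obj[OF Z] L.Comp_linear[OF mult_linear[OF Z] b]
          L.Comp_linear[OF map_linear[OF b'] b] eq])
  with retraction show ?thesis
    by (simp add: M.is_algebra_iff Hom_iff)
qed

end

theorem theorem8p9p7:
  fixes X :: "('o, 'm) closed_monoidal"
    and L M :: "('o, 'm) self_monad"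
    and \<Delta> :: "'o \<Rightarrow> 'm"
    and \<xi> :: "('o, 'm) algebra \<Rightarrow> 'm"
    and E :: "('o, 'm) algebra"
  assumes "closed_symmetric_monoidal_category X"
    and "finitely_well_complete X"
    and "enriched_monad X (self X) L"
    and "commutative_monad X L"
    and "has_alg_tensors X L"
    and "abstract_distribution_monad X L M \<Delta> \<xi>"
    and "E \<in> Obj (EM X L)"
    and "dist_complete X L M \<Delta> E"
  shows "\<exists>b \<in> Hom (EM X L) (dist_space X M \<Delta> (fst E)) E.
    is_algebra X M (fst E, und b) \<and>
    (\<forall>b' \<in> Hom (EM X L) (dist_space X M \<Delta> (fst E)) E.
       is_algebra X M (fst E, und b') \<longrightarrow> b' = b) \<and>
    is_representation X (self X) (dist_presheaf X L M \<Delta> E) (fst E) (dist_restrict X L M \<Delta> E) \<and>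
    is_counit X (self X) (dist_presheaf X L M \<Delta> E) (fst E) (dist_restrict X L M \<Delta> E)
      (Name (EM X L) b) \<and>
    und b \<cdot>\<^bsub>X\<^esub> MUnit M (fst E) = Id X (fst E) \<and>
    (\<forall>b' \<in> Hom (EM X L) (dist_space X M \<Delta> (fst E)) E.
       und b' \<cdot>\<^bsub>X\<^esub> MUnit M (fst E) = Id X (fst E) \<longrightarrow> b' = b)"
proof -
  have lim: "has_finite_limits X"
    using assms(2) by (simp add: finitely_well_complete_def)
  have M: "enriched_monad X (self X) M"
    and mor: "monad_morphism X (self X) (self X) L M \<Delta> (id_functor X (self X))"
    using assms(6) by (simp_all add: abstract_distribution_monad_def)
  interpret monad_extension X L M \<Delta>
    by (intro monad_extension.intro Eilenberg_Moore.intro Eilenberg_Moore_axioms.intro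
        monad_extension_axioms.intro self_monad.intro assms(1,3) M mor lim)
  let ?Z = "fst E"
  have E: "is_algebra X L E"
    using assms(7) by simp
  note complete = assms(8)
  note Z = L.algebra_arr(1)[OF E]
  obtain b where b: "(MX ?Z, b, E) \<in> Arr (EM_cat X L)"
    and retraction: "b \<cdot>\<^bsub>X\<^esub> MUnit M ?Z = Id X ?Z"
    and counit: "dist_restrict X L M \<Delta> E ?Z \<cdot>\<^bsub>X\<^esub> Name (EM X L) (MX ?Z, b, E) = Name (self X) (Id X ?Z)"
    using dist_retraction[OF E complete] .
  have unique: "b' = (MX ?Z, b, E)"
    if "b' \<in> Hom (EM X L) (MX ?Z) E" "und b' \<cdot>\<^bsub>X\<^esub> MUnit M ?Z = Id X ?Z" for b'
  proof -
    \<comment> \<open>A linear map is a triple recording its source and target, so once these agree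
      only the underlying maps remain to be compared.\<close>
    define f where "f = und b'"
    have f: "b' = (MX ?Z, f, E)"
      using that(1) by (simp add: f_def Hom_iff prod_eq_iff)
    have "f = b"
      by (rule linear_eqI[OF E complete Z _ b]) (use that retraction f in \<open>simp_all add: Hom_iff\<close>)
    with f show ?thesis
      by simp
  qed
  show ?thesis
  proof (intro bexI[of _ "(MX ?Z, b, E)"] conjI ballI impI)
    show "is_algebra X M (?Z, und (MX ?Z, b, E))"
      using retraction_is_algebra[OF E complete b retraction] by simp
    show "is_representation X (self X) (dist_presheaf X L M \<Delta> E) ?Z (dist_restrict X L M \<Delta> E)"
      using dist_restrict_natural[OF E] dist_restrict_iso[OF E complete] by (simp add: is_representation_def)
    show "is_counit X (self X) (dist_presheaf X L M \<Delta> E) ?Z (dist_restrict X L M \<Delta> E)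
        (Name (EM X L) (MX ?Z, b, E))"
      using L.Name_EM_ex[OF b refl refl] counit
      by (simp add: is_counit_def dist_presheaf_def comp_functor_def hom_into_def op_functor_def
          dist_functor_def)
    show "b' = (MX ?Z, b, E)" if "b' \<in> Hom (EM X L) (MX ?Z) E" "is_algebra X M (?Z, und b')" for b'
      using that by (intro unique) (simp_all add: is_algebra_def)
    show "b' = (MX ?Z, b, E)"
      if "b' \<in> Hom (EM X L) (MX ?Z) E" "und b' \<cdot>\<^bsub>X\<^esub> MUnit M ?Z = Id X ?Z" for b'
      using that by (rule unique)
  qed (use b retraction in \<open>simp_all add: Hom_iff\<close>)
qed

end
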